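(* Let $U$, $V$, $V_1$ be real-valued functions of compact support belonging to $L^\infty(\mathbb{R})$, and let $(V_\lambda)_{\lambda>0}$ be a family of real-valued bounded functions of compact support such that $\|V_\lambda-V-\lambda V_1\|=o(\lambda)$ as $\lambda\to 0$, where $\|\cdot\|$ is the norm of $L_2(\mathbb{R})$. Assume that the operator $-\frac{d^2}{dx^2}+U$ has a zero-energy resonance with normalized half-bound state $u$. If $$\int_{\mathbb{R}} V u^2\,dx<0,$$ then the operator $H_\lambda=-\frac{d^2}{dx^2}+U+\lambda V_\lambda$ possesses the coupling constant threshold $\lambda=0$, i.e., for all small positive $\lambda$ there exists a negative eigenvalue $e_\lambda$ of $H_\lambda$ such that $e_\lambda\to 0$ as $\lambda\to 0$. Moreover, the threshold eigenvalue $e_\lambda$ has the asymptotic expansion $$e_\lambda=-\lambda^2\left(\omega_0+\omega_1\lambda+o(\lambda)\right)^2\quad\text{as }\lambda\to 0,$$ where $$\omega_0=\frac{1}{\theta^2+1}\int_{\mathbb{R}} V u^2\,dx,$$ $$\omega_1=\frac{1}{\theta^2+1}\bigg(\int_{\mathbb{R}} V\big(v_*+\omega_0(\theta^2-1)u_1\big)u\,dx+\omega_0^2\int_{\mathbb{R}}(u^2-\Theta^2)\,dx-\omega_0^2\theta^3\theta_1+\int_{\mathbb{R}} V_1u^2\,dx\bigg).$$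
   Context: The operator $H_\lambda=-\frac{d^2}{dx^2}+U+\lambda V_\lambda$ acts in $L_2(\mathbb{R})$ with domain $W_2^2(\mathbb{R})$ (the Sobolev space), where the parameter $\lambda$ is positive. The operator $-\frac{d^2}{dx^2}+U$ possesses a zero-energy resonance if there exists a nontrivial solution $u$ of $-u''+Uu=0$ that is bounded on the whole line; such $u$ is called a half-bound state. A half-bound state is constant to the left and to the right of the support of $U$, and both limits $\lim_{x\to\pm\infty}u(x)$ are nonzero. It is normalized if $\lim_{x\to-\infty}u(x)=1$. For the normalized half-bound state put $\theta:=\lim_{x\to+\infty}u(x)$, and let $\Theta(x)=1$ for $x<0$ and $\Theta(x)=\theta$ for $x>0$. The function $u_1$ is the solution of $-u_1''+Uu_1=0$ on $\mathbb{R}$ such that $u_1(x)=x$ to the left of the support of $U$. There is a constant $\theta_1$ such that $u_1(x)=\theta^{-1}x+\theta_1$ for all $x$ large enough; this defines $\theta_1$. The function $v_*$ is the solution of $-v''+Uv=-Vu$ on $\mathbb{R}$ which vanishes to the left of the supports of $U$ and $V$.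
   Formalization: The supports of V_λ for small λ are assumed to lie in one fixed bounded interval; otherwise the expansion fails, e.g. U=V_1=0, V=-1 on [-1,1] (0 elsewhere), V_λ=V+λ^(7/4) on [-1/λ,1/λ], which shifts e_λ by order λ^(11/4). *)

theory Defs
  imports "HOL-Analysis.Analysis" "HOL-Library.Landau_Symbols"
begin

text \<open>
  Elements of Lebesgue spaces are represented by Lebesgue measurable functions; all notions
  below that refer to such elements are invariant under changes on null sets.
\<close>

definition ess_support :: "(real \<Rightarrow> real) \<Rightarrow> real set" where
  "ess_support f = {x. \<forall>\<epsilon>>0. \<not> (AE y in lebesgue. \<bar>y - x\<bar> < \<epsilon> \<longrightarrow> f y = 0)}"

definition Linf_compact_support :: "(real \<Rightarrow> real) \<Rightarrow> bool" where
  "Linf_compact_support f \<longleftrightarrow>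
     f \<in> borel_measurable lebesgue \<and> (\<exists>C. AE x in lebesgue. \<bar>f x\<bar> \<le> C) \<and> compact (ess_support f)"

definition L2_norm_real :: "(real \<Rightarrow> real) \<Rightarrow> real" where
  "L2_norm_real f = sqrt (\<integral>x. (f x)\<^sup>2 \<partial>lebesgue)"

definition L2_space :: "(real \<Rightarrow> complex) set" where
  "L2_space = {f \<in> borel_measurable lebesgue. integrable lebesgue (\<lambda>x. (cmod (f x))\<^sup>2)}"

text \<open>
  Weak derivatives are tested against continuously differentiable functions of compact support,
  which gives the same notion as testing against smooth ones.
\<close>

definition has_weak_deriv :: "(real \<Rightarrow> complex) \<Rightarrow> (real \<Rightarrow> complex) \<Rightarrow> bool" where
  "has_weak_deriv f g \<longleftrightarrow>
     (\<forall>a b. f absolutely_integrable_on {a..b}) \<and>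
     (\<forall>a b. g absolutely_integrable_on {a..b}) \<and>
     (\<forall>\<phi> \<phi>' :: real \<Rightarrow> real.
        (\<forall>x. (\<phi> has_real_derivative \<phi>' x) (at x)) \<longrightarrow> continuous_on UNIV \<phi>' \<longrightarrow>
        compact (closure {x. \<phi> x \<noteq> 0}) \<longrightarrow>
        (\<integral>x. \<phi>' x *\<^sub>R f x \<partial>lebesgue) = - (\<integral>x. \<phi> x *\<^sub>R g x \<partial>lebesgue))"

definition W22 :: "(real \<Rightarrow> complex) set" where
  "W22 = {f \<in> L2_space. \<exists>f1\<in>L2_space. \<exists>f2\<in>L2_space. has_weak_deriv f f1 \<and> has_weak_deriv f1 f2}"

text \<open>
  The operator with domain \<^const>\<open>W22\<close> is given by its graph, since its values are only determined
  up to null sets.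
\<close>

definition schroedinger_operator ::
  "(real \<Rightarrow> real) \<Rightarrow> ((real \<Rightarrow> complex) \<times> (real \<Rightarrow> complex)) set" where
  "schroedinger_operator W = {(\<psi>, h). \<psi> \<in> W22 \<and> h \<in> L2_space \<and>
     (\<exists>\<psi>1 \<psi>2. has_weak_deriv \<psi> \<psi>1 \<and> has_weak_deriv \<psi>1 \<psi>2 \<and>
        (AE x in lebesgue. h x = - \<psi>2 x + complex_of_real (W x) * \<psi> x))}"

definition is_eigenvalue ::
  "((real \<Rightarrow> complex) \<times> (real \<Rightarrow> complex)) set \<Rightarrow> real \<Rightarrow> bool" where
  "is_eigenvalue T e \<longleftrightarrow>
     (\<exists>\<psi>. \<not> (AE x in lebesgue. \<psi> x = 0) \<and> (\<psi>, \<lambda>x. complex_of_real e * \<psi> x) \<in> T)"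

text \<open>
  Solutions of \<open>- u'' + U u = g\<close> in the Caratheodory sense: \<open>u'\<close> is locally absolutely continuous,
  expressed by \<open>u'\<close> being an indefinite integral of \<open>u''\<close>, and the equation holds almost everywhere.
\<close>

definition solves_schroedinger ::
  "(real \<Rightarrow> real) \<Rightarrow> (real \<Rightarrow> real) \<Rightarrow> (real \<Rightarrow> real) \<Rightarrow> bool" where
  "solves_schroedinger U g u \<longleftrightarrow>
     (\<exists>u' u''.
        (\<forall>x. (u has_real_derivative u' x) (at x)) \<and>
        (\<forall>a b. a \<le> b \<longrightarrow> u'' absolutely_integrable_on {a..b} \<and> integral {a..b} u'' = u' b - u' a) \<and>
        (AE x in lebesgue. - u'' x + U x * u x = g x))"

definition half_bound_state :: "(real \<Rightarrow> real) \<Rightarrow> (real \<Rightarrow> real) \<Rightarrow> bool" where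
  "half_bound_state U u \<longleftrightarrow>
     solves_schroedinger U (\<lambda>_. 0) u \<and> bounded (range u) \<and> (\<exists>x. u x \<noteq> 0)"

definition zero_energy_resonance :: "(real \<Rightarrow> real) \<Rightarrow> bool" where
  "zero_energy_resonance U \<longleftrightarrow> (\<exists>u. half_bound_state U u)"

definition normalized_half_bound_state :: "(real \<Rightarrow> real) \<Rightarrow> (real \<Rightarrow> real) \<Rightarrow> bool" where
  "normalized_half_bound_state U u \<longleftrightarrow> half_bound_state U u \<and> (u \<longlongrightarrow> 1) at_bot"

definition Theta_step :: "real \<Rightarrow> real \<Rightarrow> real" where
  "Theta_step \<theta> x = (if x < 0 then 1 else \<theta>)"

definition H_op ::
  "(real \<Rightarrow> real) \<Rightarrow> (real \<Rightarrow> real \<Rightarrow> real) \<Rightarrow> real \<Rightarrow> ((real \<Rightarrow> complex) \<times> (real \<Rightarrow> complex)) set" where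
  "H_op U Vl l = schroedinger_operator (\<lambda>x. U x + l * Vl l x)"

definition threshold_eigenvalue ::
  "(real \<Rightarrow> ((real \<Rightarrow> complex) \<times> (real \<Rightarrow> complex)) set) \<Rightarrow> (real \<Rightarrow> real) \<Rightarrow> bool" where
  "threshold_eigenvalue H e \<longleftrightarrow>
     (\<forall>\<^sub>F l in at_right 0. e l < 0 \<and> is_eigenvalue (H l) (e l)) \<and> (e \<longlongrightarrow> 0) (at_right 0)"

definition coupling_constant_threshold_zero ::
  "(real \<Rightarrow> ((real \<Rightarrow> complex) \<times> (real \<Rightarrow> complex)) set) \<Rightarrow> bool" where
  "coupling_constant_threshold_zero H \<longleftrightarrow> (\<exists>e. threshold_eigenvalue H e)"

definition omega0 :: "(real \<Rightarrow> real) \<Rightarrow> (real \<Rightarrow> real) \<Rightarrow> real \<Rightarrow> real" where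
  "omega0 V u \<theta> = 1 / (\<theta>\<^sup>2 + 1) * (\<integral>x. V x * (u x)\<^sup>2 \<partial>lebesgue)"

definition omega1 ::
  "(real \<Rightarrow> real) \<Rightarrow> (real \<Rightarrow> real) \<Rightarrow> (real \<Rightarrow> real) \<Rightarrow> real \<Rightarrow> (real \<Rightarrow> real) \<Rightarrow> real \<Rightarrow> (real \<Rightarrow> real) \<Rightarrow> real"
where
  "omega1 V V1 u \<theta> u1 \<theta>1 vs =
     1 / (\<theta>\<^sup>2 + 1) *
       ((\<integral>x. V x * (vs x + omega0 V u \<theta> * (\<theta>\<^sup>2 - 1) * u1 x) * u x \<partial>lebesgue)
        + (omega0 V u \<theta>)\<^sup>2 * (\<integral>x. (u x)\<^sup>2 - (Theta_step \<theta> x)\<^sup>2 \<partial>lebesgue)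
        - (omega0 V u \<theta>)\<^sup>2 * \<theta> ^ 3 * \<theta>1
        + (\<integral>x. V1 x * (u x)\<^sup>2 \<partial>lebesgue))"

end

theory Submission
  imports Defs
begin

text \<open>
  A number \<open>- k\<^sup>2 < 0\<close> is an eigenvalue of \<open>- d\<^sup>2/dx\<^sup>2 + U + \<lambda> V\<^sub>\<lambda>\<close> exactly if the solution that equals
  \<open>exp (k (x + a))\<close> to the left of an interval \<open>[-a, a]\<close> containing all supports continues to a
  multiple of \<open>exp (- k x)\<close> to the right of it. This is one scalar equation for \<open>k\<close>, and the theorem
  is the analysis of this equation for small \<open>\<lambda>\<close>.

  The unperturbed equation \<open>y'' = U y\<close> has the fundamental system \<open>u\<close>, \<open>u\<^sub>1\<close> with Wronskian one, and
  \<open>p = \<lambda> V\<^sub>\<lambda> + k\<^sup>2\<close> is small in \<open>L\<^sup>1(-a, a)\<close>. By variation of constants the solution starting from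
  the left exponential solves the Volterra equation \<open>f = u + k (u\<^sub>1 + a u) + T\<^sub>p f\<close>, where \<open>T\<^sub>p\<close> has
  norm at most \<open>2 M\<^sup>2 \<parallel>p\<parallel>\<^sub>1\<close> for the sup norm. So for small \<open>\<lambda>\<close> and \<open>k\<close> it exists as a fixed point
  (\<open>shooting_exists\<close>), depends continuously on \<open>p\<close> and \<open>k\<close> (\<open>shooting_perturbation\<close>) and tends
  uniformly to \<open>u\<close>. Reading off its coefficients with respect to \<open>u\<close>, \<open>u\<^sub>1\<close> at \<open>a\<close> turns the
  condition \<open>f'(a) + k f(a) = 0\<close> into
  \<open>(k + I) (1 + k (a + \<theta> \<theta>\<^sub>1)) + k \<theta>\<^sup>2 (1 + k a - I\<^sub>1) = 0\<close> with \<open>I = \<integral> p u f\<close>, \<open>I\<^sub>1 = \<integral> p u\<^sub>1 f\<close>,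
  whose left-hand side is \<open>matching\<close>. The equivalence with the operator-theoretic notion of eigenvalue
  is given by \<open>eigenvalue_imp_shooting\<close> and \<open>shooting_imp_eigenvalue\<close>; the first needs that weak
  solutions in \<open>W\<^sub>2\<^sup>2\<close> are classical ones (du Bois-Reymond, \<open>weak_deriv_imp_ac_deriv\<close>).

  To first order the matching condition is \<open>k (1 + \<theta>\<^sup>2) + \<lambda> \<integral> V u\<^sup>2 = 0\<close>, so every family of
  eigenvalues tending to zero satisfies \<open>k/\<lambda> \<rightarrow> - \<omega>\<^sub>0\<close> (\<open>first_order\<close>). Conversely, for negative
  \<open>\<integral> V u\<^sup>2\<close> the left-hand side changes sign between \<open>k = 0\<close> and \<open>k = c \<lambda>\<close>, and the intermediate
  value theorem gives an eigenvalue (\<open>matching_zero_exists\<close>). For the second order, \<open>(f - u)/\<lambda>\<close> tends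
  uniformly to \<open>- \<omega>\<^sub>0 (u\<^sub>1 + a u) + v\<^sub>*\<close>, because \<open>v\<^sub>* = T\<^sub>V u\<close>; dividing the matching condition by
  \<open>\<lambda>\<^sup>2\<close> determines the limit of \<open>(k/\<lambda> + \<omega>\<^sub>0)/\<lambda>\<close> (\<open>second_order\<close>). In the resulting expression the
  auxiliary length \<open>a\<close> cancels and \<open>- \<omega>\<^sub>1\<close> remains (\<open>omega_identities\<close>).
\<close>

section \<open>Absolutely continuous functions\<close>

lemma AE_lebesgue_negligibleE:
  assumes "AE x in lebesgue. P (x :: 'a::euclidean_space)"
  obtains N where "negligible N" "\<And>x. x \<notin> N \<Longrightarrow> P x"
  using assms by (auto simp: eventually_ae_filter negligible_iff_null_sets)

lemma AE_lebesgue_negligibleI: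
  fixes N :: "'a::euclidean_space set"
  assumes "negligible N" "\<And>x. x \<notin> N \<Longrightarrow> P x"
  shows "AE x in lebesgue. P x"
  using assms by (auto simp: eventually_ae_filter negligible_iff_null_sets)

text \<open>
  Local absolute continuity with a.e. derivative \<open>F'\<close>, in integrated form: in this form the relation
  is stable under changes of \<open>F'\<close> on null sets and under gluing.
\<close>
definition ac_deriv :: "(real \<Rightarrow> 'a::euclidean_space) \<Rightarrow> (real \<Rightarrow> 'a) \<Rightarrow> bool" where
  "ac_deriv F F' \<longleftrightarrow>
     (\<forall>a b. a \<le> b \<longrightarrow> F' absolutely_integrable_on {a..b} \<and> integral {a..b} F' = F b - F a)"

lemma ac_derivI:
  assumes "\<And>a b. a \<le> b \<Longrightarrow> F' absolutely_integrable_on {a..b}"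
    and "\<And>a b. a \<le> b \<Longrightarrow> integral {a..b} F' = F b - F a"
  shows "ac_deriv F F'"
  using assms by (auto simp: ac_deriv_def)

lemma ac_deriv_abs_integrable:
  assumes "ac_deriv F F'"
  shows "F' absolutely_integrable_on {a..b}"
  using assms by (cases "a \<le> b") (auto simp: ac_deriv_def)

lemma ac_deriv_integrable:
  assumes "ac_deriv F F'"
  shows "F' integrable_on {a..b}"
  using ac_deriv_abs_integrable[OF assms] set_lebesgue_integral_eq_integral(1) by blast

lemma ac_deriv_integral:
  assumes "ac_deriv F F'" "a \<le> b"
  shows "integral {a..b} F' = F b - F a"
  using assms by (auto simp: ac_deriv_def)

lemma ac_deriv_continuous:
  assumes "ac_deriv F F'"
  shows "continuous_on S F"
proof -
  have "isCont F x" for x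
  proof -
    have "continuous_on {x-1..x+1} (\<lambda>y. F (x-1) + integral {x-1..y} F')"
      by (intro continuous_intros indefinite_integral_continuous_1 ac_deriv_integrable[OF assms])
    moreover have "F (x-1) + integral {x-1..y} F' = F y" if "y \<in> {x-1..x+1}" for y
      using ac_deriv_integral[OF assms, of "x-1" y] that by auto
    ultimately have "continuous_on {x-1..x+1} F"
      by (rule continuous_on_eq)
    then show ?thesis
      by (rule continuous_on_interior) (auto simp: interior_atLeastAtMost_real)
  qed
  then show ?thesis
    by (simp add: continuous_at_imp_continuous_on)
qed

lemma ac_deriv_linear:
  assumes "ac_deriv F F'" "bounded_linear h"
  shows "ac_deriv (\<lambda>x. h (F x)) (\<lambda>x. h (F' x))"
proof (rule ac_derivI)
  fix a b :: real assume "a \<le> b"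
  show "(\<lambda>x. h (F' x)) absolutely_integrable_on {a..b}"
    using absolutely_integrable_linear[OF ac_deriv_abs_integrable[OF assms(1)] assms(2)]
    by (simp add: o_def)
  show "integral {a..b} (\<lambda>x. h (F' x)) = h (F b) - h (F a)"
    using integral_linear[OF ac_deriv_integrable[OF assms(1)] assms(2), of a b]
      ac_deriv_integral[OF assms(1) \<open>a \<le> b\<close>] linear_diff[OF bounded_linear.linear[OF assms(2)]]
    by (simp add: o_def)
qed

lemma ac_deriv_add:
  assumes "ac_deriv F F'" "ac_deriv G G'"
  shows "ac_deriv (\<lambda>x. F x + G x) (\<lambda>x. F' x + G' x)"
  using assms ac_deriv_abs_integrable[OF assms(1)] ac_deriv_abs_integrable[OF assms(2)]
    ac_deriv_integrable[OF assms(1)] ac_deriv_integrable[OF assms(2)]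
  by (intro ac_derivI) (auto intro!: set_integral_add simp: integral_add ac_deriv_integral)

lemma ac_deriv_diff:
  assumes "ac_deriv F F'" "ac_deriv G G'"
  shows "ac_deriv (\<lambda>x. F x - G x) (\<lambda>x. F' x - G' x)"
  using assms ac_deriv_abs_integrable[OF assms(1)] ac_deriv_abs_integrable[OF assms(2)]
    ac_deriv_integrable[OF assms(1)] ac_deriv_integrable[OF assms(2)]
  by (intro ac_derivI) (auto intro!: set_integral_diff simp: integral_diff ac_deriv_integral)

lemma ac_deriv_const: "ac_deriv (\<lambda>x. c) (\<lambda>x. 0)"
  by (rule ac_derivI) auto

lemma ac_deriv_cmult:
  fixes F :: "real \<Rightarrow> real"
  assumes "ac_deriv F F'"
  shows "ac_deriv (\<lambda>x. c * F x) (\<lambda>x. c * F' x)"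
  using ac_deriv_linear[OF assms bounded_linear_mult_right] .

lemma ac_deriv_negligible_change:
  assumes "ac_deriv F F'" "AE x in lebesgue. F' x = G' x"
  shows "ac_deriv F G'"
proof -
  from AE_lebesgue_negligibleE[OF assms(2)]
  obtain N where neg: "negligible N" and N: "\<And>x. x \<notin> N \<Longrightarrow> F' x = G' x"
    by blast
  show ?thesis
  proof (rule ac_derivI)
    fix a b :: real assume "a \<le> b"
    show "G' absolutely_integrable_on {a..b}"
      by (rule absolutely_integrable_spike[OF ac_deriv_abs_integrable[OF assms(1)] neg])
        (use N in force)
    have "integral {a..b} F' = integral {a..b} G'"
      by (rule integral_spike[OF neg]) (use N in force)
    then show "integral {a..b} G' = F b - F a"
      using ac_deriv_integral[OF assms(1) \<open>a \<le> b\<close>] by simp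
  qed
qed

lemma ac_deriv_C1:
  fixes F :: "real \<Rightarrow> 'a::euclidean_space"
  assumes "\<And>x. (F has_vector_derivative F' x) (at x)" "continuous_on UNIV F'"
  shows "ac_deriv F F'"
proof (rule ac_derivI)
  fix a b :: real assume "a \<le> b"
  show "F' absolutely_integrable_on {a..b}"
    by (rule absolutely_integrable_continuous_real) (rule continuous_on_subset[OF assms(2)], simp)
  show "integral {a..b} F' = F b - F a"
    by (rule integral_unique[OF fundamental_theorem_of_calculus[OF \<open>a \<le> b\<close>]])
      (rule has_vector_derivative_at_within[OF assms(1)])
qed

lemma ac_deriv_imp_has_vector_derivative:
  assumes F: "ac_deriv F F'" and c: "continuous_on UNIV F'"
  shows "(F has_vector_derivative F' x) (at x)"
proof -
  have "((\<lambda>y. integral {x-1..y} F') has_vector_derivative F' x) (at x within {x-1..x+1})"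
    by (rule integral_has_vector_derivative) (auto intro: continuous_on_subset[OF c])
  then have "((\<lambda>y. F (x-1) + integral {x-1..y} F') has_vector_derivative F' x) (at x within {x-1..x+1})"
    by (auto intro!: derivative_eq_intros)
  then have "(F has_vector_derivative F' x) (at x within {x-1..x+1})"
  proof (rule has_vector_derivative_transform[rotated 2])
    show "x \<in> {x-1..x+1}" by simp
    show "F y = F (x-1) + integral {x-1..y} F'" if "y \<in> {x-1..x+1}" for y
      using ac_deriv_integral[OF F, of "x-1" y] that by simp
  qed
  moreover have "at x within {x-1..x+1} = at x"
    by (rule at_within_Icc_at) simp_all
  ultimately show ?thesis
    by simp
qed

lemma ac_deriv_zero_const:
  assumes "ac_deriv F F'" "AE x in lebesgue. x \<in> {a..b} \<longrightarrow> F' x = 0" "a \<le> b"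
  shows "F b = F a"
proof -
  from AE_lebesgue_negligibleE[OF assms(2)]
  obtain N where neg: "negligible N" and N: "\<And>x. x \<notin> N \<Longrightarrow> x \<in> {a..b} \<longrightarrow> F' x = 0"
    by blast
  have "integral {a..b} F' = integral {a..b} (\<lambda>_. 0)"
    by (rule integral_spike[OF neg]) (use N in force)
  then show ?thesis
    using ac_deriv_integral[OF assms(1,3)] by simp
qed

text \<open>
  Eigenfunctions are pasted together from an interior solution and two exponentials.
\<close>
lemma ac_deriv_glue:
  assumes F: "ac_deriv F F'" and G: "ac_deriv G G'" and c: "F c = G c"
  shows "ac_deriv (\<lambda>x. if x \<le> c then F x else G x) (\<lambda>x. if x \<le> c then F' x else G' x)"
    (is "ac_deriv ?H ?H'")
proof -
  have 1: "?H' absolutely_integrable_on {a..b} \<and> integral {a..b} ?H' = ?H b - ?H a" 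
    if "a \<le> b" "b \<le> c" for a b
  proof
    show "?H' absolutely_integrable_on {a..b}"
      by (rule absolutely_integrable_spike[OF ac_deriv_abs_integrable[OF F] negligible_empty]) 
        (use that in auto)
    have "integral {a..b} ?H' = integral {a..b} F'"
      by (rule integral_cong) (use that in auto)
    then show "integral {a..b} ?H' = ?H b - ?H a"
      using ac_deriv_integral[OF F that(1)] that by simp
  qed
  have 2: "?H' absolutely_integrable_on {a..b} \<and> integral {a..b} ?H' = ?H b - ?H a" 
    if "a \<le> b" "c \<le> a" for a b
  proof
    show "?H' absolutely_integrable_on {a..b}"
      by (rule absolutely_integrable_spike[OF ac_deriv_abs_integrable[OF G] negligible_sing[of c]]) 
        (use that in auto)
    have "integral {a..b} G' = integral {a..b} ?H'"
      by (rule integral_spike[OF negligible_sing[of c]]) (use that in auto)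
    then have "integral {a..b} ?H' = G b - G a"
      using ac_deriv_integral[OF G that(1)] by simp
    moreover have "?H b = G b" "?H a = G a"
      using that c by (cases "b = c"; cases "a = c"; simp)+
    ultimately show "integral {a..b} ?H' = ?H b - ?H a"
      by simp
  qed
  show ?thesis
  proof (rule ac_derivI)
    fix a b :: real assume ab: "a \<le> b"
    show ai: "?H' absolutely_integrable_on {a..b}"
    proof (cases "a \<le> c \<and> c \<le> b")
      case True
      then show ?thesis
        using absolutely_integrable_on_combine[where f = ?H' and a = a and b = b and c = c] 1[of a c] 2[of c b] by blast
    qed (use 1[of a b] 2[of a b] ab in auto)
    show "integral {a..b} ?H' = ?H b - ?H a"
    proof (cases "a \<le> c \<and> c \<le> b")
      case True
      have "integral {a..c} ?H' + integral {c..b} ?H' = integral {a..b} ?H'"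
        by (rule Henstock_Kurzweil_Integration.integral_combine)
          (use True set_lebesgue_integral_eq_integral(1)[OF ai] in auto)
      then show ?thesis
        using conjunct2[OF 1[of a c]] conjunct2[OF 2[of c b]] True by auto
    qed (use 1[of a b] 2[of a b] ab in auto)
  qed
qed

definition primitive_from :: "real \<Rightarrow> (real \<Rightarrow> 'a::euclidean_space) \<Rightarrow> real \<Rightarrow> 'a" where
  "primitive_from c f x = (if c \<le> x then integral {c..x} f else - integral {x..c} f)"

lemma primitive_from_self [simp]: "primitive_from c f c = 0"
  by (simp add: primitive_from_def)

lemma ac_deriv_primitive_from:
  assumes "\<And>a b. f absolutely_integrable_on {a..b}"
  shows "ac_deriv (primitive_from c f) f"
proof (rule ac_derivI)
  fix a b :: real assume "a \<le> b"
  have i: "f integrable_on {x..y}" for x y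
    using assms set_lebesgue_integral_eq_integral(1) by blast
  have comb: "x \<le> y \<Longrightarrow> y \<le> z \<Longrightarrow> integral {x..y} f + integral {y..z} f = integral {x..z} f" for x y z
    by (rule Henstock_Kurzweil_Integration.integral_combine) (use i in auto)
  show "integral {a..b} f = primitive_from c f b - primitive_from c f a"
    using \<open>a \<le> b\<close> comb[of c a b] comb[of a c b] comb[of a b c]
    by (auto simp: primitive_from_def algebra_simps)
qed (rule assms)

lemma absolutely_integrable_scaleR_continuous:
  fixes f :: "real \<Rightarrow> real" and G :: "real \<Rightarrow> 'a::euclidean_space"
  assumes "f absolutely_integrable_on {a..b}" "continuous_on {a..b} G"
  shows "(\<lambda>x. f x *\<^sub>R G x) absolutely_integrable_on {a..b}"
proof (rule absolutely_integrable_bounded_measurable_product[of "\<lambda>x y. y *\<^sub>R x"])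
  show "bilinear (\<lambda>x y. y *\<^sub>R x :: 'a)"
    by (auto simp: bilinear_def linear_iff algebra_simps)
  show "G \<in> borel_measurable (lebesgue_on {a..b})"
    by (rule continuous_imp_measurable_on_sets_lebesgue[OF assms(2)]) auto
  show "bounded (G ` {a..b})"
    by (rule compact_imp_bounded[OF compact_continuous_image[OF assms(2)]]) auto
qed (use assms in auto)

lemma absolutely_integrable_continuous_scaleR:
  fixes f :: "real \<Rightarrow> real" and G :: "real \<Rightarrow> 'a::euclidean_space"
  assumes "continuous_on {a..b} f" "G absolutely_integrable_on {a..b}"
  shows "(\<lambda>x. f x *\<^sub>R G x) absolutely_integrable_on {a..b}"
proof (rule absolutely_integrable_bounded_measurable_product[of "\<lambda>x y. x *\<^sub>R y"])
  show "bilinear (\<lambda>x y. x *\<^sub>R y :: 'a)"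
    by (auto simp: bilinear_def linear_iff algebra_simps)
  show "f \<in> borel_measurable (lebesgue_on {a..b})"
    by (rule continuous_imp_measurable_on_sets_lebesgue[OF assms(1)]) auto
  show "bounded (f ` {a..b})"
    by (rule compact_imp_bounded[OF compact_continuous_image[OF assms(1)]]) auto
qed (use assms in auto)

text \<open>
  The defect \<open>D x y\<close> of the product rule over \<open>[x, y]\<close> is additive in the interval and bounded by
  \<open>2 (A y - A x) (B y - B x)\<close>, where \<open>A\<close>, \<open>B\<close> are primitives of \<open>\<bar>F'\<bar>\<close> and \<open>norm G'\<close>. Since \<open>A\<close> is
  continuous, summing over fine partitions gives \<open>D = 0\<close>; Bolzano's bisection principle performs
  the summation.
\<close>
lemma ac_deriv_scaleR:
  fixes F :: "real \<Rightarrow> real" and G :: "real \<Rightarrow> 'a::euclidean_space"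
  assumes F: "ac_deriv F F'" and G: "ac_deriv G G'"
  shows "ac_deriv (\<lambda>x. F x *\<^sub>R G x) (\<lambda>x. F' x *\<^sub>R G x + F x *\<^sub>R G' x)"
proof -
  let ?P = "\<lambda>x. F' x *\<^sub>R G x + F x *\<^sub>R G' x"
  have aiF: "\<And>a b. F' absolutely_integrable_on {a..b}" and aiG: "\<And>a b. G' absolutely_integrable_on {a..b}"
    using ac_deriv_abs_integrable F G by blast+
  have cF: "\<And>S. continuous_on S F" and cG: "\<And>S. continuous_on S G"
    using ac_deriv_continuous F G by blast+
  have ai1: "(\<lambda>x. F' x *\<^sub>R G x) absolutely_integrable_on {a..b}" for a b
    using absolutely_integrable_scaleR_continuous[OF aiF cG] .
  have ai2: "(\<lambda>x. F x *\<^sub>R G' x) absolutely_integrable_on {a..b}" for a b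
    using absolutely_integrable_continuous_scaleR[OF cF aiG] .
  have aiP: "?P absolutely_integrable_on {a..b}" for a b
    using set_integral_add(1)[OF ai1 ai2] .
  define A where "A = primitive_from 0 (\<lambda>x. \<bar>F' x\<bar>)"
  define B where "B = primitive_from 0 (\<lambda>x. norm (G' x))"
  have A: "ac_deriv A (\<lambda>x. \<bar>F' x\<bar>)" and B: "ac_deriv B (\<lambda>x. norm (G' x))"
    unfolding A_def B_def
    using aiF aiG set_integrable_abs set_integrable_norm by (blast intro: ac_deriv_primitive_from)+
  have dF: "\<bar>F t - F s\<bar> \<le> A y - A x" if "x \<le> s" "s \<le> t" "t \<le> y" for s t x y
  proof -
    have "\<bar>F t - F s\<bar> = norm (integral {s..t} F')"
      using ac_deriv_integral[OF F \<open>s \<le> t\<close>] by simp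
    also have "\<dots> \<le> integral {s..t} (\<lambda>x. \<bar>F' x\<bar>)"
      by (rule integral_norm_bound_integral) (use F A ac_deriv_integrable in auto)
    also have "\<dots> \<le> integral {x..y} (\<lambda>x. \<bar>F' x\<bar>)"
      by (rule integral_subset_le) (use that A ac_deriv_integrable in auto)
    finally show ?thesis
      using ac_deriv_integral[OF A, of x y] that by simp
  qed
  have dG: "norm (G t - G s) \<le> B y - B x" if "x \<le> s" "s \<le> t" "t \<le> y" for s t x y
  proof -
    have "norm (G t - G s) = norm (integral {s..t} G')"
      using ac_deriv_integral[OF G \<open>s \<le> t\<close>] by simp
    also have "\<dots> \<le> integral {s..t} (\<lambda>x. norm (G' x))"
      by (rule integral_norm_bound_integral) (use G B ac_deriv_integrable in auto)
    also have "\<dots> \<le> integral {x..y} (\<lambda>x. norm (G' x))"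
      by (rule integral_subset_le) (use that B ac_deriv_integrable in auto)
    finally show ?thesis
      using ac_deriv_integral[OF B, of x y] that by simp
  qed
  have Bmono: "x \<le> y \<Longrightarrow> B x \<le> B y" for x y
    using dG[of x x x y] by simp
  define D where "D x y = F y *\<^sub>R G y - F x *\<^sub>R G x - integral {x..y} ?P" for x y
  have D: "norm (D x y) \<le> 2 * (A y - A x) * (B y - B x)" if xy: "x \<le> y" for x y
  proof -
    have e1: "((\<lambda>t. F' t *\<^sub>R (G y - G t)) has_integral ((F y - F x) *\<^sub>R G y - integral {x..y} (\<lambda>t. F' t *\<^sub>R G t))) {x..y}"
    proof -
      have "((\<lambda>t. F' t *\<^sub>R G y) has_integral (F y - F x) *\<^sub>R G y) {x..y}"
        using ac_deriv_integrable[OF F, of x y] ac_deriv_integral[OF F xy]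
        by (metis has_integral_scaleR_left integrable_integral)
      moreover have "((\<lambda>t. F' t *\<^sub>R G t) has_integral integral {x..y} (\<lambda>t. F' t *\<^sub>R G t)) {x..y}"
        using ai1 set_lebesgue_integral_eq_integral(1) by blast
      ultimately show ?thesis
        by (simp add: scaleR_diff_right has_integral_diff)
    qed
    have e2: "((\<lambda>t. (F x - F t) *\<^sub>R G' t) has_integral (F x *\<^sub>R (G y - G x) - integral {x..y} (\<lambda>t. F t *\<^sub>R G' t))) {x..y}"
    proof -
      have "((\<lambda>t. F x *\<^sub>R G' t) has_integral F x *\<^sub>R (G y - G x)) {x..y}"
        using ac_deriv_integrable[OF G, of x y] ac_deriv_integral[OF G xy]
        by (metis has_integral_cmul integrable_integral)
      moreover have "((\<lambda>t. F t *\<^sub>R G' t) has_integral integral {x..y} (\<lambda>t. F t *\<^sub>R G' t)) {x..y}"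
        using ai2 set_lebesgue_integral_eq_integral(1) by blast
      ultimately show ?thesis
        by (simp add: scaleR_diff_left has_integral_diff)
    qed
    have "integral {x..y} ?P = integral {x..y} (\<lambda>t. F' t *\<^sub>R G t) + integral {x..y} (\<lambda>t. F t *\<^sub>R G' t)"
      using ai1 ai2 set_lebesgue_integral_eq_integral(1) by (intro integral_add) blast+
    then have "D x y = integral {x..y} (\<lambda>t. F' t *\<^sub>R (G y - G t)) + integral {x..y} (\<lambda>t. (F x - F t) *\<^sub>R G' t)"
      unfolding D_def integral_unique[OF e1] integral_unique[OF e2]
      by (simp add: scaleR_diff_left scaleR_diff_right)
    moreover have "norm (integral {x..y} (\<lambda>t. F' t *\<^sub>R (G y - G t))) \<le> integral {x..y} (\<lambda>t. \<bar>F' t\<bar> * (B y - B x))"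
    proof (rule integral_norm_bound_integral)
      show "(\<lambda>t. \<bar>F' t\<bar> * (B y - B x)) integrable_on {x..y}"
        using ac_deriv_integrable[OF A] integrable_on_mult_left by blast
      fix t assume "t \<in> {x..y}"
      then have "norm (G y - G t) \<le> B y - B x" using dG[of x t y y] by auto
      then show "norm (F' t *\<^sub>R (G y - G t)) \<le> \<bar>F' t\<bar> * (B y - B x)"
        by (simp add: mult_left_mono)
    qed (use e1 in blast)
    moreover have "norm (integral {x..y} (\<lambda>t. (F x - F t) *\<^sub>R G' t)) \<le> integral {x..y} (\<lambda>t. (A y - A x) * norm (G' t))"
    proof (rule integral_norm_bound_integral)
      show "(\<lambda>t. (A y - A x) * norm (G' t)) integrable_on {x..y}"
        using ac_deriv_integrable[OF B] integrable_on_mult_right by blast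
      fix t assume "t \<in> {x..y}"
      then have "\<bar>F x - F t\<bar> \<le> A y - A x" using dF[of x x t y] by auto
      then show "norm ((F x - F t) *\<^sub>R G' t) \<le> (A y - A x) * norm (G' t)"
        by (simp add: mult_right_mono)
    qed (use e2 in blast)
    moreover have "integral {x..y} (\<lambda>t. \<bar>F' t\<bar> * (B y - B x)) = (A y - A x) * (B y - B x)"
      using ac_deriv_integral[OF A xy] by simp
    moreover have "integral {x..y} (\<lambda>t. (A y - A x) * norm (G' t)) = (A y - A x) * (B y - B x)"
      using ac_deriv_integral[OF B xy] by simp
    ultimately have "norm (D x y) \<le> (A y - A x) * (B y - B x) + (A y - A x) * (B y - B x)"
      by (metis norm_triangle_mono)
    then show ?thesis
      by (simp add: algebra_simps)
  qed
  show ?thesis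
  proof (rule ac_derivI)
    fix a b :: real assume ab: "a \<le> b"
    have *: "norm (D a b) \<le> 2 * e * (B b - B a)" if e: "e > 0" for e
      using ab
    proof (rule Bolzano)
      fix x y z assume h: "norm (D x y) \<le> 2 * e * (B y - B x)" "norm (D y z) \<le> 2 * e * (B z - B y)"
        "x \<le> y" "y \<le> z"
      have "integral {x..y} ?P + integral {y..z} ?P = integral {x..z} ?P"
        using h(3,4) set_lebesgue_integral_eq_integral(1)[OF aiP] by (rule Henstock_Kurzweil_Integration.integral_combine)
      then have "D x z = D x y + D y z"
        by (simp add: D_def algebra_simps)
      then show "norm (D x z) \<le> 2 * e * (B z - B x)"
        using h(1,2) norm_triangle_ineq[of "D x y" "D y z"] by (simp add: algebra_simps)
    next
      fix x
      have "isCont A x"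
        using ac_deriv_continuous[OF A, of UNIV] by (simp add: continuous_on_eq_continuous_at)
      then obtain d where d: "d > 0" "\<And>y. \<bar>y - x\<bar> < d \<Longrightarrow> \<bar>A y - A x\<bar> < e/2"
        using e unfolding continuous_at_eps_delta dist_real_def by (metis half_gt_zero)
      show "\<exists>d>0. \<forall>s t. s \<le> x \<and> x \<le> t \<and> t - s < d \<longrightarrow> norm (D s t) \<le> 2 * e * (B t - B s)"
      proof (intro exI conjI allI impI)
        fix s t assume st: "s \<le> x \<and> x \<le> t \<and> t - s < d"
        have "A t - A s \<le> e"
        proof -
          have "\<bar>A s - A x\<bar> < e/2" "\<bar>A t - A x\<bar> < e/2"
            using st by (intro d(2); simp)+
          then show ?thesis by linarith
        qed
        then have "2 * (A t - A s) * (B t - B s) \<le> 2 * e * (B t - B s)"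
          using Bmono[of s t] st by (intro mult_right_mono) auto
        with D[of s t] st show "norm (D s t) \<le> 2 * e * (B t - B s)" by linarith
      qed (rule d(1))
    qed
    have "norm (D a b) \<le> 0 + e" if e: "e > 0" for e
    proof -
      define M where "M = 2 * (B b - B a) + 1"
      have "M > 0" using Bmono[OF ab] by (simp add: M_def)
      have "norm (D a b) \<le> (e / M) * (2 * (B b - B a))"
        using *[of "e / M"] e \<open>M > 0\<close> by (simp add: mult_ac)
      also have "\<dots> \<le> (e / M) * M"
        using e \<open>M > 0\<close> by (intro mult_left_mono) (auto simp: M_def)
      finally show ?thesis using \<open>M > 0\<close> by simp
    qed
    then have "norm (D a b) \<le> 0"
      by (rule field_le_epsilon)
    then show "integral {a..b} ?P = F b *\<^sub>R G b - F a *\<^sub>R G a"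
      by (simp add: D_def)
  qed (rule aiP)
qed

lemma ac_deriv_mult:
  fixes F G :: "real \<Rightarrow> real"
  assumes "ac_deriv F F'" "ac_deriv G G'"
  shows "ac_deriv (\<lambda>x. F x * G x) (\<lambda>x. F' x * G x + F x * G' x)"
  using ac_deriv_scaleR[OF assms] by simp

lemma continuous_on_interval_bound:
  fixes f :: "real \<Rightarrow> real"
  assumes "continuous_on {s..t} f"
  obtains B where "\<And>x. x \<in> {s..t} \<Longrightarrow> \<bar>f x\<bar> \<le> B"
proof -
  have "bounded (f ` {s..t})"
    by (intro compact_imp_bounded compact_continuous_image assms) simp
  then obtain B where "\<forall>y\<in>f ` {s..t}. norm y \<le> B"
    unfolding bounded_iff by blast
  then have "\<bar>f x\<bar> \<le> B" if "x \<in> {s..t}" for x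
    using that by simp
  then show thesis
    by (rule that)
qed

section \<open>Weak derivatives\<close>

lemma lebesgue_integral_eq_interval_integral:
  fixes f :: "real \<Rightarrow> 'a::euclidean_space"
  assumes "f absolutely_integrable_on {a..b}" "\<And>x. x \<notin> {a..b} \<Longrightarrow> f x = 0"
  shows "integrable lebesgue f" "integral\<^sup>L lebesgue f = integral {a..b} f"
proof -
  have eq: "(\<lambda>x. indicator {a..b} x *\<^sub>R f x) = f"
    using assms(2) by (force simp: indicator_def)
  show "integrable lebesgue f"
    using assms(1) by (simp add: set_integrable_def eq)
  show "integral\<^sup>L lebesgue f = integral {a..b} f"
    using set_lebesgue_integral_eq_integral(2)[OF assms(1)] by (simp add: set_lebesgue_integral_def eq)
qed

lemma test_function_support:
  fixes \<phi> :: "real \<Rightarrow> real"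
  assumes d: "\<And>x. (\<phi> has_real_derivative \<phi>' x) (at x)" and c: "compact (closure {x. \<phi> x \<noteq> 0})"
  obtains n where "n > 0" "\<And>x. n \<le> \<bar>x\<bar> \<Longrightarrow> \<phi> x = 0" "\<And>x. n \<le> \<bar>x\<bar> \<Longrightarrow> \<phi>' x = 0"
proof -
  have "bounded {x. \<phi> x \<noteq> 0}"
    using c bounded_closure_image compact_imp_bounded bounded_subset closure_subset by metis
  then obtain m where m: "m > 0" "\<And>x. \<phi> x \<noteq> 0 \<Longrightarrow> \<bar>x\<bar> \<le> m"
    by (auto simp: bounded_pos)
  have z: "\<phi>' x = 0" if x: "m < \<bar>x\<bar>" for x
  proof -
    have "((\<lambda>_. 0) has_real_derivative \<phi>' x) (at x)"
    proof (rule has_field_derivative_transform_within_open[OF d])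
      show "open {y. m < \<bar>y\<bar>}"
        by (intro open_Collect_less continuous_intros)
    qed (use m x in force)+
    then show ?thesis
      using DERIV_const DERIV_unique by blast
  qed
  show thesis
    by (rule that[of "m + 1"]) (use m z in force)+
qed

lemma ac_deriv_imp_weak_deriv:
  assumes F: "ac_deriv F F'"
  shows "has_weak_deriv F F'"
  unfolding has_weak_deriv_def
proof (intro conjI allI impI)
  show "F absolutely_integrable_on {a..b}" for a b
    by (intro absolutely_integrable_continuous_real ac_deriv_continuous[OF F])
  show "F' absolutely_integrable_on {a..b}" for a b
    by (rule ac_deriv_abs_integrable[OF F])
  fix \<phi> \<phi>' :: "real \<Rightarrow> real"
  assume d: "\<forall>x. (\<phi> has_real_derivative \<phi>' x) (at x)" and c: "continuous_on UNIV \<phi>'"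
    and s: "compact (closure {x. \<phi> x \<noteq> 0})"
  obtain n where n: "n > 0" "\<And>x. n \<le> \<bar>x\<bar> \<Longrightarrow> \<phi> x = 0" "\<And>x. n \<le> \<bar>x\<bar> \<Longrightarrow> \<phi>' x = 0"
    using test_function_support[OF spec[OF d] s] by blast
  have \<phi>: "ac_deriv \<phi> \<phi>'"
    by (rule ac_deriv_C1[OF _ c]) (use d in \<open>simp add: has_real_derivative_iff_has_vector_derivative\<close>)
  have prod: "ac_deriv (\<lambda>x. \<phi> x *\<^sub>R F x) (\<lambda>x. \<phi>' x *\<^sub>R F x + \<phi> x *\<^sub>R F' x)"
    by (rule ac_deriv_scaleR[OF \<phi> F])
  have ai1: "(\<lambda>x. \<phi>' x *\<^sub>R F x) absolutely_integrable_on {-n..n}"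
    by (rule absolutely_integrable_scaleR_continuous[OF ac_deriv_abs_integrable[OF \<phi>] ac_deriv_continuous[OF F]])
  have ai2: "(\<lambda>x. \<phi> x *\<^sub>R F' x) absolutely_integrable_on {-n..n}"
    by (rule absolutely_integrable_continuous_scaleR[OF ac_deriv_continuous[OF \<phi>] ac_deriv_abs_integrable[OF F]])
  have "integral {-n..n} (\<lambda>x. \<phi>' x *\<^sub>R F x) + integral {-n..n} (\<lambda>x. \<phi> x *\<^sub>R F' x) =
      integral {-n..n} (\<lambda>x. \<phi>' x *\<^sub>R F x + \<phi> x *\<^sub>R F' x)"
    by (rule integral_add[symmetric])
      (use ai1 ai2 set_lebesgue_integral_eq_integral(1) in blast)+
  also have "\<dots> = 0"
    using ac_deriv_integral[OF prod, of "-n" n] n by simp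
  finally have zero: "integral {-n..n} (\<lambda>x. \<phi>' x *\<^sub>R F x) + integral {-n..n} (\<lambda>x. \<phi> x *\<^sub>R F' x) = 0" .
  show "(\<integral>x. \<phi>' x *\<^sub>R F x \<partial>lebesgue) = - (\<integral>x. \<phi> x *\<^sub>R F' x \<partial>lebesgue)"
  proof -
    have "x \<notin> {-n..n} \<Longrightarrow> \<phi> x = 0 \<and> \<phi>' x = 0" for x
      using n(2,3)[of x] by auto
    then show ?thesis
      using lebesgue_integral_eq_interval_integral(2)[OF ai1] lebesgue_integral_eq_interval_integral(2)[OF ai2]
        zero by (simp add: eq_neg_iff_add_eq_0)
  qed
qed

text \<open>
  By Lebesgue differentiation almost every value is the limit of averages over one-sided intervals.
\<close>
lemma zero_interval_integrals_imp_AE_zero: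
  fixes h :: "real \<Rightarrow> 'a::euclidean_space"
  assumes i: "\<And>a b. h integrable_on {a..b}" and z: "\<And>a b. a < b \<Longrightarrow> integral {a..b} h = 0"
  shows "AE x in lebesgue. h x = 0"
proof -
  obtain N where N: "negligible N" "\<And>x e. \<lbrakk>x \<notin> N; 0 < e\<rbrakk> \<Longrightarrow>
               \<exists>d>0. \<forall>t. 0 < t \<and> t < d \<longrightarrow>
                   norm (integral (cbox x (x + t *\<^sub>R One)) h /\<^sub>R t ^ DIM(real) - h x) < e"
    using integrable_ccontinuous_explicit[of h] i by auto
  have "h x = 0" if x: "x \<notin> N" for x
  proof (rule ccontr)
    assume "h x \<noteq> 0"
    with N(2)[OF x, of "norm (h x)"] obtain d where d: "d > 0" "\<And>t. 0 < t \<Longrightarrow> t < d \<Longrightarrow>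
        norm (integral (cbox x (x + t *\<^sub>R One)) h /\<^sub>R t ^ DIM(real) - h x) < norm (h x)"
      by auto
    have "integral (cbox x (x + (d/2) *\<^sub>R One)) h = 0"
      using z[of x "x + d/2"] d(1) by simp
    then show False
      using d(2)[of "d/2"] d(1) by simp
  qed
  with N(1) show ?thesis
    by (rule AE_lebesgue_negligibleI)
qed

text \<open>
  Continuous approximations of the indicator of \<open>[a, b]\<close>, with slopes \<open>\<plusminus> n\<close>.
\<close>
definition trapezoid :: "real \<Rightarrow> real \<Rightarrow> nat \<Rightarrow> real \<Rightarrow> real" where
  "trapezoid a b n t = max 0 (min 1 (min (real n * (t - a)) (real n * (b - t))))"

lemma trapezoid_continuous: "continuous_on S (trapezoid a b n)"
  unfolding trapezoid_def by (intro continuous_intros)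

lemma trapezoid_zero: "t \<notin> {a..b} \<Longrightarrow> trapezoid a b n t = 0"
proof -
  assume "t \<notin> {a..b}"
  then have "real n * (t - a) \<le> 0 \<or> real n * (b - t) \<le> 0"
    by (auto simp: mult_le_0_iff)
  then show ?thesis
    by (auto simp: trapezoid_def)
qed

lemma trapezoid_bounds: "0 \<le> trapezoid a b n t" "trapezoid a b n t \<le> 1"
  by (auto simp: trapezoid_def)

lemma trapezoid_tendsto:
  assumes "t \<notin> {a, b}"
  shows "(\<lambda>n. trapezoid a b n t) \<longlonglongrightarrow> indicator {a..b} t"
proof (cases "t \<in> {a..b}")
  case True
  with assms have t: "a < t" "t < b" by auto
  obtain N :: nat where N: "real N > 1 / (t - a)" "real N > 1 / (b - t)"
    using reals_Archimedean2[of "max (1 / (t - a)) (1 / (b - t))"] by auto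
  have "trapezoid a b n t = 1" if "n \<ge> N" for n
  proof -
    have "real n > 1 / (t - a)" "real n > 1 / (b - t)"
      using N that by linarith+
    then have "real n * (t - a) > 1" "real n * (b - t) > 1"
      using t by (simp_all add: field_simps)
    then show ?thesis by (simp add: trapezoid_def)
  qed
  then have "\<forall>\<^sub>F n in sequentially. trapezoid a b n t = 1"
    by (auto simp: eventually_sequentially)
  then show ?thesis
    using True by (simp add: tendsto_eventually)
qed (simp add: trapezoid_zero)

text \<open>
  The lemma of du Bois-Reymond. A continuous \<open>\<rho>\<close> of compact support is, up to a multiple of a
  fixed bump of mass one, the derivative of a test function. So the difference \<open>h\<close> of \<open>f\<close> and the
  primitive of \<open>g\<close> satisfies \<open>\<integral> \<rho> (h - C) = 0\<close> for the mean \<open>C\<close> of \<open>h\<close> against the bump, and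
  trapezoids \<open>\<rho>\<close> show that \<open>h - C\<close> has vanishing integral over every interval.
\<close>
lemma weak_deriv_imp_ac_deriv:
  assumes fg: "has_weak_deriv f g"
  obtains F where "ac_deriv F g" "AE x in lebesgue. f x = F x"
proof -
  have f: "\<And>a b. f absolutely_integrable_on {a..b}" and g: "\<And>a b. g absolutely_integrable_on {a..b}"
    using fg by (auto simp: has_weak_deriv_def)
  define G where "G = primitive_from 0 g"
  have G: "ac_deriv G g"
    unfolding G_def by (rule ac_deriv_primitive_from[OF g])
  have wG: "has_weak_deriv G g"
    by (rule ac_deriv_imp_weak_deriv[OF G])
  define h where "h x = f x - G x" for x
  have h: "h absolutely_integrable_on {a..b}" for a b
    unfolding h_def
    by (intro set_integral_diff(1) f absolutely_integrable_continuous_real ac_deriv_continuous[OF G])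
  have int_h: "integrable lebesgue (\<lambda>x. \<rho> x *\<^sub>R h x)"
    if "continuous_on UNIV \<rho>" "\<And>x. x \<notin> {-n..n} \<Longrightarrow> \<rho> x = 0" for \<rho> :: "real \<Rightarrow> real" and n
    by (rule lebesgue_integral_eq_interval_integral(1)[where a = "-n" and b = n])
      (use that in \<open>auto intro!: absolutely_integrable_continuous_scaleR h intro: continuous_on_subset\<close>)
  have orth: "(\<integral>x. \<eta> x *\<^sub>R h x \<partial>lebesgue) = 0"
    if \<eta>: "continuous_on UNIV \<eta>" "\<And>x. x \<notin> {-n..n} \<Longrightarrow> \<eta> x = 0" "n > 0" "integral {-n..n} \<eta> = 0"
    for \<eta> :: "real \<Rightarrow> real" and n
  proof -
    define \<phi> where "\<phi> = primitive_from (-n) \<eta>"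
    have ac: "ac_deriv \<phi> \<eta>"
      unfolding \<phi>_def
      by (intro ac_deriv_primitive_from absolutely_integrable_continuous_real continuous_on_subset[OF \<eta>(1)]) simp
    have d: "(\<phi> has_real_derivative \<eta> x) (at x)" for x
      using ac_deriv_imp_has_vector_derivative[OF ac \<eta>(1)]
      by (simp add: has_real_derivative_iff_has_vector_derivative)
    have "\<phi> (-n) = 0" by (simp add: \<phi>_def)
    have "\<phi> x = 0" if x: "x \<notin> {-n..n}" for x
    proof (cases "x < -n")
      case True
      have "\<phi> (-n) = \<phi> x"
        by (rule ac_deriv_zero_const[OF ac _ less_imp_le[OF True]])
          (rule AE_lebesgue_negligibleI[OF negligible_sing[of "-n"]], auto intro: \<eta>(2))
      then show ?thesis using \<open>\<phi> (-n) = 0\<close> by simp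
    next
      case False
      then have "n < x" using x by auto
      have "\<phi> x = \<phi> n"
        by (rule ac_deriv_zero_const[OF ac _ less_imp_le[OF \<open>n < x\<close>]])
          (rule AE_lebesgue_negligibleI[OF negligible_sing[of "n"]], auto intro: \<eta>(2))
      moreover have "\<phi> n = \<phi> (-n)"
        using ac_deriv_integral[OF ac, of "-n" n] \<eta>(3,4) by simp
      ultimately show ?thesis using \<open>\<phi> (-n) = 0\<close> by simp
    qed
    then have "{x. \<phi> x \<noteq> 0} \<subseteq> {-n..n}" by blast
    then have "compact (closure {x. \<phi> x \<noteq> 0})"
      by (meson bounded_closed_interval bounded_subset compact_closure)
    then have "(\<integral>x. \<eta> x *\<^sub>R f x \<partial>lebesgue) = - (\<integral>x. \<phi> x *\<^sub>R g x \<partial>lebesgue)"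
      "(\<integral>x. \<eta> x *\<^sub>R G x \<partial>lebesgue) = - (\<integral>x. \<phi> x *\<^sub>R g x \<partial>lebesgue)"
      using fg wG d \<eta>(1) unfolding has_weak_deriv_def by blast+
    moreover have "integrable lebesgue (\<lambda>x. \<eta> x *\<^sub>R k x)" if k: "k absolutely_integrable_on {-n..n}" for k :: "real \<Rightarrow> complex"
      by (rule lebesgue_integral_eq_interval_integral(1)[where a = "-n" and b = n])
        (use \<eta> in \<open>auto intro!: absolutely_integrable_continuous_scaleR k intro: continuous_on_subset\<close>)
    moreover have "G absolutely_integrable_on {-n..n}"
      by (intro absolutely_integrable_continuous_real ac_deriv_continuous[OF G])
    ultimately have "integrable lebesgue (\<lambda>x. \<eta> x *\<^sub>R f x)" "integrable lebesgue (\<lambda>x. \<eta> x *\<^sub>R G x)"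
      "(\<integral>x. \<eta> x *\<^sub>R f x \<partial>lebesgue) = (\<integral>x. \<eta> x *\<^sub>R G x \<partial>lebesgue)"
      using f by auto
    then show ?thesis
      by (simp add: h_def scaleR_diff_right)
  qed
  define bump where "bump x = max 0 (1 - \<bar>x\<bar>)" for x :: real
  have bump: "continuous_on S bump" "\<And>x. x \<notin> {-1..1} \<Longrightarrow> bump x = 0" for S
    by (auto simp: bump_def intro!: continuous_intros)
  have bump1: "integral {-n..n} bump = 1" if "n \<ge> 1" for n
  proof -
    have "(bump has_integral (1/2 + 1/2)) {-1..1}"
    proof (rule has_integral_combine[of "-1" 0 1])
      have "((\<lambda>x. 1 + x) has_integral ((0 + 0^2/2) - (-1 + (-1)^2/2))) {-1..0::real}"
        by (rule fundamental_theorem_of_calculus)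
          (auto intro!: derivative_eq_intros simp: has_real_derivative_iff_has_vector_derivative[symmetric])
      then have "((\<lambda>x. 1 + x) has_integral 1/2) {-1..0::real}" by simp
      then show "(bump has_integral 1/2) {-1..0}"
        by (rule has_integral_eq[rotated]) (auto simp: bump_def field_simps)
      have "((\<lambda>x. 1 - x) has_integral ((1 - 1^2/2) - (0 - 0^2/2))) {0..1::real}"
        by (rule fundamental_theorem_of_calculus)
          (auto intro!: derivative_eq_intros simp: has_real_derivative_iff_has_vector_derivative[symmetric])
      then have "((\<lambda>x. 1 - x) has_integral 1/2) {0..1::real}" by simp
      then show "(bump has_integral 1/2) {0..1}"
        by (rule has_integral_eq[rotated]) (auto simp: bump_def field_simps)
    qed auto
    then have "(bump has_integral 1) {-1..1}" by simp
    then have "(bump has_integral 1) {-n..n}"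
      by (rule has_integral_on_superset) (use bump(2) that in auto)
    then show ?thesis by (rule integral_unique)
  qed
  define C where "C = (\<integral>x. bump x *\<^sub>R h x \<partial>lebesgue)"
  have mean: "(\<integral>x. \<rho> x *\<^sub>R h x \<partial>lebesgue) = integral {-n..n} \<rho> *\<^sub>R C"
    if \<rho>: "continuous_on UNIV \<rho>" "\<And>x. x \<notin> {-n..n} \<Longrightarrow> \<rho> x = 0" and n: "n \<ge> 1"
    for \<rho> :: "real \<Rightarrow> real" and n
  proof -
    let ?c = "integral {-n..n} \<rho>"
    have b: "\<And>x. x \<notin> {-n..n} \<Longrightarrow> bump x = 0"
      using bump(2) n by force
    have i: "\<rho> integrable_on {-n..n}" "bump integrable_on {-n..n}"
      using \<rho>(1) bump(1) by (auto intro!: integrable_continuous_real intro: continuous_on_subset)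
    have "integral {-n..n} (\<lambda>x. \<rho> x - ?c * bump x) = 0"
      using i bump1[OF n] by (simp add: integral_diff integrable_on_mult_right)
    then have "(\<integral>x. (\<rho> x - ?c * bump x) *\<^sub>R h x \<partial>lebesgue) = 0"
      by (intro orth[of _ n]) (use \<rho> bump(1) b n in \<open>auto intro!: continuous_intros\<close>)
    moreover have "integrable lebesgue (\<lambda>x. \<rho> x *\<^sub>R h x)" "integrable lebesgue (\<lambda>x. bump x *\<^sub>R h x)"
      using int_h[of \<rho> n] int_h[of bump n] \<rho> bump(1) b by auto
    ultimately show ?thesis
      by (simp add: C_def scaleR_diff_left flip: scaleR_scaleR)
  qed
  have hC: "(\<lambda>x. h x - C) absolutely_integrable_on {a..b}" for a b
    by (intro set_integral_diff(1) h absolutely_integrable_continuous_real continuous_intros)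
  have "integral {a..b} (\<lambda>x. h x - C) = 0" if ab: "a < b" for a b
  proof -
    define n where "n = max 1 (max \<bar>a\<bar> \<bar>b\<bar>)"
    have n: "n \<ge> 1" "{a..b} \<subseteq> {-n..n}"
      by (auto simp: n_def)
    have z: "(\<integral>x. trapezoid a b k x *\<^sub>R (h x - C) \<partial>lebesgue) = 0" for k
    proof -
      have tz: "trapezoid a b k x = 0" if "x \<notin> {-n..n}" for x
        using that n(2) trapezoid_zero[of x a b k] by blast
      have i: "integrable lebesgue (\<lambda>x. trapezoid a b k x *\<^sub>R h x)"
        by (rule int_h[of _ n]) (use tz in \<open>auto intro: trapezoid_continuous\<close>)
      have t: "trapezoid a b k absolutely_integrable_on {-n..n}"
        by (intro absolutely_integrable_continuous_real trapezoid_continuous)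
      note tt = lebesgue_integral_eq_interval_integral[OF t tz]
      have "(\<integral>x. trapezoid a b k x *\<^sub>R (h x - C) \<partial>lebesgue) =
          (\<integral>x. trapezoid a b k x *\<^sub>R h x \<partial>lebesgue) - (\<integral>x. trapezoid a b k x *\<^sub>R C \<partial>lebesgue)"
        using i tt(1) by (simp add: scaleR_diff_right)
      also have "\<dots> = 0"
        using mean[of "trapezoid a b k" n, OF trapezoid_continuous tz n(1)] tt by simp
      finally show ?thesis .
    qed
    have "(\<lambda>k. \<integral>x. trapezoid a b k x *\<^sub>R (h x - C) \<partial>lebesgue) \<longlonglongrightarrow>
        (\<integral>x. indicator {a..b} x *\<^sub>R (h x - C) \<partial>lebesgue)"
    proof (rule integral_dominated_convergence[where w="\<lambda>x. norm (indicator {a..b} x *\<^sub>R (h x - C))"])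
      show m: "(\<lambda>x. indicator {a..b} x *\<^sub>R (h x - C)) \<in> borel_measurable lebesgue"
        using hC[of a b] by (simp add: set_integrable_def borel_measurable_integrable)
      show "integrable lebesgue (\<lambda>x. norm (indicator {a..b} x *\<^sub>R (h x - C)))"
        using hC[of a b] by (simp add: set_integrable_def del: norm_scaleR)
      show "AE x in lebesgue. (\<lambda>k. trapezoid a b k x *\<^sub>R (h x - C)) \<longlonglongrightarrow> indicator {a..b} x *\<^sub>R (h x - C)"
        by (rule AE_lebesgue_negligibleI[of "{a,b}"])
          (use trapezoid_tendsto[of _ a b] in \<open>auto intro!: tendsto_scaleR\<close>)
      fix k
      have eq: "(\<lambda>x. trapezoid a b k x *\<^sub>R (h x - C)) = (\<lambda>x. trapezoid a b k x *\<^sub>R (indicator {a..b} x *\<^sub>R (h x - C)))"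
        using trapezoid_zero[of _ a b k] by (force simp: indicator_def)
      have "trapezoid a b k \<in> borel_measurable lebesgue"
        using borel_measurable_continuous_onI[OF trapezoid_continuous, of a b k]
        by (simp add: measurable_completion)
      then show "(\<lambda>x. trapezoid a b k x *\<^sub>R (h x - C)) \<in> borel_measurable lebesgue"
        unfolding eq using m by (rule borel_measurable_scaleR)
      show "AE x in lebesgue. norm (trapezoid a b k x *\<^sub>R (h x - C)) \<le> norm (indicator {a..b} x *\<^sub>R (h x - C))"
        using trapezoid_bounds[of a b k] trapezoid_zero[of _ a b k]
        by (intro AE_I2) (auto simp: indicator_def mult_left_le_one_le)
    qed
    then have "(\<integral>x. indicator {a..b} x *\<^sub>R (h x - C) \<partial>lebesgue) = 0"
      using z by (simp add: LIMSEQ_const_iff)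
    then show ?thesis
      using set_lebesgue_integral_eq_integral(2)[OF hC[of a b]] by (simp add: set_lebesgue_integral_def)
  qed
  then have "AE x in lebesgue. h x - C = 0"
    using zero_interval_integrals_imp_AE_zero[of "\<lambda>x. h x - C"] set_lebesgue_integral_eq_integral(1)[OF hC] by blast
  then have "AE x in lebesgue. f x = G x + C"
    by eventually_elim (simp add: h_def algebra_simps)
  moreover have "ac_deriv (\<lambda>x. G x + C) g"
    using ac_deriv_add[OF G ac_deriv_const[of C]] by simp
  ultimately show thesis
    using that by blast
qed

section \<open>Essentially bounded functions of compact support\<close>

text \<open>
  A point outside the essential support lies in a rational interval on which the function vanishes
  a.e.; there are countably many of these.
\<close>
lemma AE_zero_outside_ess_support: "AE x in lebesgue. x \<notin> ess_support f \<longrightarrow> f x = 0"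
proof -
  let ?Q = "{(p, q) \<in> \<rat> \<times> \<rat>. AE y in lebesgue. p < y \<and> y < q \<longrightarrow> f y = 0}"
  have "countable ?Q"
    by (rule countable_subset[of _ "\<rat> \<times> \<rat>"]) (auto intro: countable_SIGMA countable_rat)
  then have "AE y in lebesgue. \<forall>(p, q)\<in>?Q. p < y \<and> y < q \<longrightarrow> f y = 0"
    by (subst AE_ball_countable) auto
  then show ?thesis
  proof eventually_elim
    case (elim x)
    show ?case
    proof
      assume "x \<notin> ess_support f"
      then obtain e where e: "e > 0" "AE y in lebesgue. \<bar>y - x\<bar> < e \<longrightarrow> f y = 0"
        by (auto simp: ess_support_def)
      obtain p where p: "p \<in> \<rat>" "x - e < p" "p < x"
        using Rats_dense_in_real[of "x - e" x] e(1) by auto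
      obtain q where q: "q \<in> \<rat>" "x < q" "q < x + e"
        using Rats_dense_in_real[of x "x + e"] e(1) by auto
      have "AE y in lebesgue. p < y \<and> y < q \<longrightarrow> f y = 0"
        using e(2) by eventually_elim (use p q in auto)
      then have "(p, q) \<in> ?Q" using p q by auto
      then show "f x = 0" using elim p q by auto
    qed
  qed
qed

lemma Linf_abs_integrable:
  assumes "Linf_compact_support f"
  shows "f absolutely_integrable_on {a..b}"
proof -
  obtain C where "AE x in lebesgue. \<bar>f x\<bar> \<le> C" and m: "f \<in> borel_measurable lebesgue"
    using assms by (auto simp: Linf_compact_support_def)
  then have "AE x in lebesgue. x \<in> {a..b} \<longrightarrow> norm (f x) \<le> C"
    by auto
  then show ?thesis
    unfolding set_integrable_def
    by (intro integrableI_bounded_set_indicator[where B = C]) (use m in \<open>auto simp: emeasure_lborel_Icc_eq\<close>)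
qed

lemma Linf_bounds:
  assumes "Linf_compact_support f"
  obtains C n where "AE x in lebesgue. \<bar>f x\<bar> \<le> C" "\<And>x. n \<le> \<bar>x\<bar> \<Longrightarrow> x \<notin> ess_support f"
    "AE x in lebesgue. n \<le> \<bar>x\<bar> \<longrightarrow> f x = 0"
proof -
  obtain C where C: "AE x in lebesgue. \<bar>f x\<bar> \<le> C" and "compact (ess_support f)"
    using assms by (auto simp: Linf_compact_support_def)
  then obtain m where m: "\<And>x. x \<in> ess_support f \<Longrightarrow> \<bar>x\<bar> \<le> m"
    using compact_imp_bounded[of "ess_support f"] by (auto simp: bounded_iff)
  have out: "x \<notin> ess_support f" if "m + 1 \<le> \<bar>x\<bar>" for x
    using m[of x] that by auto
  have "AE x in lebesgue. m + 1 \<le> \<bar>x\<bar> \<longrightarrow> f x = 0"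
    using AE_zero_outside_ess_support[of f] by eventually_elim (use out in blast)
  with C out show thesis
    using that by blast
qed

lemma bounded_compact_square_integrable:
  fixes g :: "real \<Rightarrow> real"
  assumes m: "g \<in> borel_measurable lebesgue" and C: "AE x in lebesgue. \<bar>g x\<bar> \<le> C"
    and n: "AE x in lebesgue. n \<le> \<bar>x\<bar> \<longrightarrow> g x = 0"
  shows "integrable lebesgue (\<lambda>x. (g x)\<^sup>2)"
proof (rule Bochner_Integration.integrable_bound[where f = "\<lambda>x. C\<^sup>2 * indicator {-n..n} x"])
  show "integrable lebesgue (\<lambda>x. C\<^sup>2 * indicator {-n..n} x)"
    by (intro integrable_mult_right) (simp add: emeasure_lborel_Icc_eq)
  show "(\<lambda>x. (g x)\<^sup>2) \<in> borel_measurable lebesgue"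
    using m by measurable
  show "AE x in lebesgue. norm ((g x)\<^sup>2) \<le> norm (C\<^sup>2 * indicator {-n..n} x)"
    using C n
  proof eventually_elim
    case (elim x)
    show ?case
    proof (cases "x \<in> {-n..n}")
      case True
      then show ?thesis using elim(1) abs_le_square_iff[of "g x" C] by (simp add: abs_le_square_iff)
    next
      case False
      then have "n \<le> \<bar>x\<bar>" by auto
      then show ?thesis using elim(2) by simp
    qed
  qed
qed

lemma lebesgue_integral_AE_zero_outside:
  fixes g :: "real \<Rightarrow> real"
  assumes m: "g \<in> borel_measurable lebesgue" and i: "g absolutely_integrable_on {-a..a}"
    and z: "AE x in lebesgue. a \<le> \<bar>x\<bar> \<longrightarrow> g x = 0"
  shows "integral\<^sup>L lebesgue g = integral {-a..a} g"
proof -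
  have "integral\<^sup>L lebesgue g = (\<integral>x. indicator {-a..a} x *\<^sub>R g x \<partial>lebesgue)"
  proof (rule integral_cong_AE[OF m])
    show "(\<lambda>x. indicator {-a..a} x *\<^sub>R g x) \<in> borel_measurable lebesgue"
      using i by (simp add: set_integrable_def borel_measurable_integrable)
    show "AE x in lebesgue. g x = indicator {-a..a} x *\<^sub>R g x"
      using z by eventually_elim (auto simp: indicator_def)
  qed
  also have "\<dots> = integral {-a..a} g"
    using set_lebesgue_integral_eq_integral(2)[OF i] by (simp add: set_lebesgue_integral_def)
  finally show ?thesis .
qed

text \<open>
  Integrated form of \<open>2 s \<bar>g\<bar> \<le> g\<^sup>2 + s\<^sup>2\<close>. Keeping \<open>s\<close> free avoids the division by the norm that the
  optimal choice, which gives Cauchy-Schwarz, would require.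
\<close>
lemma L1_le_L2:
  fixes g :: "real \<Rightarrow> real"
  assumes m: "g \<in> borel_measurable lebesgue" and i: "integrable lebesgue (\<lambda>x. (g x)\<^sup>2)"
    and "s > 0" "a \<ge> 0"
  shows "integral {-a..a} (\<lambda>x. \<bar>g x\<bar>) \<le> (L2_norm_real g)\<^sup>2 / (2 * s) + a * s"
proof -
  have sq: "(\<lambda>x. (g x)\<^sup>2) absolutely_integrable_on {-a..a}"
    unfolding set_integrable_def by (intro integrable_mult_indicator i) auto
  have dom: "(\<lambda>x. (g x)\<^sup>2 / (2 * s) + s / 2) integrable_on {-a..a}"
    by (intro integrable_add integrable_on_divide set_lebesgue_integral_eq_integral(1)[OF sq]) auto
  have le: "\<bar>g x\<bar> \<le> (g x)\<^sup>2 / (2 * s) + s / 2" for x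
  proof -
    have "0 \<le> (\<bar>g x\<bar> - s)\<^sup>2" by simp
    then have "2 * s * \<bar>g x\<bar> \<le> (g x)\<^sup>2 + s\<^sup>2"
      by (simp add: power2_diff algebra_simps)
    then show ?thesis
      using \<open>s > 0\<close> by (simp add: field_simps power2_eq_square)
  qed
  have "g absolutely_integrable_on {-a..a}"
  proof (rule measurable_bounded_by_integrable_imp_absolutely_integrable[OF _ _ dom])
    show "g \<in> borel_measurable (lebesgue_on {-a..a})"
      using m by (rule measurable_restrict_space1)
  qed (use le in auto)
  then have "(\<lambda>x. \<bar>g x\<bar>) integrable_on {-a..a}"
    by (intro set_lebesgue_integral_eq_integral(1) set_integrable_abs)
  then have "integral {-a..a} (\<lambda>x. \<bar>g x\<bar>) \<le> integral {-a..a} (\<lambda>x. (g x)\<^sup>2 / (2 * s) + s / 2)"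
    by (intro integral_le dom le)
  also have "\<dots> = integral {-a..a} (\<lambda>x. (g x)\<^sup>2) / (2 * s) + a * s"
    using set_lebesgue_integral_eq_integral(1)[OF sq] \<open>a \<ge> 0\<close>
    by (subst integral_add) (auto intro!: integrable_on_divide)
  also have "integral {-a..a} (\<lambda>x. (g x)\<^sup>2) \<le> (L2_norm_real g)\<^sup>2"
  proof -
    have "integral {-a..a} (\<lambda>x. (g x)\<^sup>2) = (\<integral>x. indicator {-a..a} x *\<^sub>R (g x)\<^sup>2 \<partial>lebesgue)"
      using set_lebesgue_integral_eq_integral(2)[OF sq] by (simp add: set_lebesgue_integral_def)
    also have "\<dots> \<le> (\<integral>x. (g x)\<^sup>2 \<partial>lebesgue)"
      using sq i by (intro integral_mono) (auto simp: set_integrable_def indicator_def)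
    also have "\<dots> = (L2_norm_real g)\<^sup>2"
      by (simp add: L2_norm_real_def)
    finally show ?thesis .
  qed
  finally show ?thesis
    using \<open>s > 0\<close> by (simp add: divide_right_mono)
qed

text \<open>
  All estimates below use only the \<open>L\<^sup>1\<close> norm on \<open>[-a, a]\<close>, which the \<open>L\<^sup>2\<close> norm controls.
\<close>
lemma remainder_L1_small:
  assumes V: "Linf_compact_support V" "Linf_compact_support V1" "\<And>l. l > 0 \<Longrightarrow> Linf_compact_support (Vl l)"
    and o: "(\<lambda>l. L2_norm_real (\<lambda>x. Vl l x - V x - l * V1 x)) \<in> o[at_right 0](\<lambda>l. l)" and a: "a > 0"
  shows "((\<lambda>l. integral {-a..a} (\<lambda>x. \<bar>Vl l x - V x - l * V1 x\<bar>) / l) \<longlongrightarrow> 0) (at_right 0)"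
proof (rule Lim_null_comparison)
  let ?N = "\<lambda>l. L2_norm_real (\<lambda>x. Vl l x - V x - l * V1 x)"
  have "((\<lambda>l. ?N l / l) \<longlongrightarrow> 0) (at_right 0)"
    by (rule smalloD_tendsto[OF o])
  then have "((\<lambda>l. ?N l / l * (1/2 + a) + a * l) \<longlongrightarrow> 0 * (1/2 + a) + a * 0) (at_right 0)"
    by (intro tendsto_intros)
  then show "((\<lambda>l. ?N l / l * (1/2 + a) + a * l) \<longlongrightarrow> 0) (at_right 0)"
    by simp
  have "\<forall>\<^sub>F l in at_right (0::real). l > 0"
    by (simp add: eventually_at_right_less)
  then show "\<forall>\<^sub>F l in at_right 0. norm (integral {-a..a} (\<lambda>x. \<bar>Vl l x - V x - l * V1 x\<bar>) / l) \<le> ?N l / l * (1/2 + a) + a * l"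
  proof eventually_elim
    case (elim l)
    define g where "g x = Vl l x - V x - l * V1 x" for x
    obtain C1 n1 where 1: "AE x in lebesgue. \<bar>V x\<bar> \<le> C1" "AE x in lebesgue. n1 \<le> \<bar>x\<bar> \<longrightarrow> V x = 0"
      using Linf_bounds[OF V(1)] by metis
    obtain C2 n2 where 2: "AE x in lebesgue. \<bar>V1 x\<bar> \<le> C2" "AE x in lebesgue. n2 \<le> \<bar>x\<bar> \<longrightarrow> V1 x = 0"
      using Linf_bounds[OF V(2)] by metis
    obtain C3 n3 where 3: "AE x in lebesgue. \<bar>Vl l x\<bar> \<le> C3" "AE x in lebesgue. n3 \<le> \<bar>x\<bar> \<longrightarrow> Vl l x = 0"
      using Linf_bounds[OF V(3)[OF elim]] by metis
    have m: "g \<in> borel_measurable lebesgue"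
    proof -
      have "V \<in> borel_measurable lebesgue" "V1 \<in> borel_measurable lebesgue" "Vl l \<in> borel_measurable lebesgue"
        using V(1,2) V(3)[OF elim] by (auto simp: Linf_compact_support_def)
      then show ?thesis
        unfolding g_def[abs_def] by (intro borel_measurable_diff borel_measurable_times borel_measurable_const)
    qed
    have "AE x in lebesgue. \<bar>g x\<bar> \<le> C3 + C1 + l * C2"
      using 1(1) 2(1) 3(1)
    proof eventually_elim
      case (elim x)
      have "\<bar>l * V1 x\<bar> \<le> l * C2"
        using elim(2) \<open>l > 0\<close> by (simp add: abs_mult)
      then show ?case
        unfolding g_def using elim(1,3) by linarith
    qed
    moreover have "AE x in lebesgue. max n1 (max n2 n3) \<le> \<bar>x\<bar> \<longrightarrow> g x = 0"
      using 1(2) 2(2) 3(2) by eventually_elim (auto simp: g_def)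
    ultimately have sq: "integrable lebesgue (\<lambda>x. (g x)\<^sup>2)"
      by (rule bounded_compact_square_integrable[OF m])
    define N where "N = L2_norm_real g"
    have N0: "0 \<le> N"
      by (simp add: N_def L2_norm_real_def)
    \<comment> \<open>adding \<open>l\<^sup>2 = o(l)\<close> to the norm keeps \<open>s\<close> positive also where the remainder vanishes\<close>
    have s: "N + l\<^sup>2 > 0"
      using N0 elim by (simp add: add_nonneg_pos)
    have "integral {-a..a} (\<lambda>x. \<bar>g x\<bar>) \<le> N\<^sup>2 / (2 * (N + l\<^sup>2)) + a * (N + l\<^sup>2)"
      unfolding N_def by (rule L1_le_L2[OF m sq]) (use s a in \<open>auto simp: N_def\<close>)
    also have "N\<^sup>2 / (2 * (N + l\<^sup>2)) \<le> N / 2"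
    proof -
      have "N\<^sup>2 \<le> N * (N + l\<^sup>2)"
        using N0 by (simp add: power2_eq_square distrib_left)
      then show ?thesis
        using s by (simp add: field_simps)
    qed
    finally have "integral {-a..a} (\<lambda>x. \<bar>g x\<bar>) / l \<le> (N / 2 + a * (N + l\<^sup>2)) / l"
      using elim by (simp add: divide_right_mono)
    also have "\<dots> = N / l * (1/2 + a) + a * l"
      using elim by (simp add: field_simps power2_eq_square)
    finally have "integral {-a..a} (\<lambda>x. \<bar>g x\<bar>) / l \<le> N / l * (1/2 + a) + a * l" .
    moreover have "0 \<le> integral {-a..a} (\<lambda>x. \<bar>g x\<bar>)"
    proof (rule Henstock_Kurzweil_Integration.integral_nonneg)
      have "g absolutely_integrable_on {-a..a}"
        unfolding g_def[abs_def] using Linf_abs_integrable[OF V(1)] Linf_abs_integrable[OF V(2)]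
          Linf_abs_integrable[OF V(3)[OF elim]] by (intro set_integral_diff(1)) auto
      then show "(\<lambda>x. \<bar>g x\<bar>) integrable_on {-a..a}"
        by (intro set_lebesgue_integral_eq_integral(1) set_integrable_abs)
    qed simp
    ultimately show ?case
      using elim unfolding N_def g_def by simp
  qed
qed

section \<open>Second order linear equations\<close>

lemma solves_schroedinger_ac:
  assumes "solves_schroedinger U g u"
  obtains u' where "ac_deriv u u'" "ac_deriv u' (\<lambda>x. U x * u x - g x)"
proof -
  obtain u' u'' where d: "\<And>x. (u has_real_derivative u' x) (at x)"
    and ac: "\<And>a b. a \<le> b \<Longrightarrow> u'' absolutely_integrable_on {a..b} \<and> integral {a..b} u'' = u' b - u' a"
    and eq: "AE x in lebesgue. - u'' x + U x * u x = g x"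
    using assms unfolding solves_schroedinger_def by blast
  have u'': "ac_deriv u' u''"
    using ac by (auto simp: ac_deriv_def)
  have "(u has_vector_derivative u' x) (at x)" for x
    using d by (simp add: has_real_derivative_iff_has_vector_derivative)
  then have "ac_deriv u u'"
    by (intro ac_deriv_C1 ac_deriv_continuous[OF u''])
  moreover have "AE x in lebesgue. u'' x = U x * u x - g x"
    using eq by (rule eventually_mono) simp
  then have "ac_deriv u' (\<lambda>x. U x * u x - g x)"
    by (rule ac_deriv_negligible_change[OF u''])
  ultimately show thesis
    using that by blast
qed

lemma wronskian_constant:
  fixes u u' v v' U :: "real \<Rightarrow> real"
  assumes u: "ac_deriv u u'" "ac_deriv u' (\<lambda>x. U x * u x)"
    and v: "ac_deriv v v'" "ac_deriv v' (\<lambda>x. U x * v x)"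
  shows "u x * v' x - u' x * v x = u y * v' y - u' y * v y"
proof -
  have "ac_deriv (\<lambda>x. u x * v' x - u' x * v x)
      (\<lambda>x. (u' x * v' x + u x * (U x * v x)) - ((U x * u x) * v x + u' x * v' x))"
    by (intro ac_deriv_diff ac_deriv_mult u v)
  then have "ac_deriv (\<lambda>x. u x * v' x - u' x * v x) (\<lambda>_. 0)"
    by (rule ac_deriv_negligible_change) simp
  from ac_deriv_zero_const[OF this] show ?thesis
    by (metis (no_types, lifting) AE_I2 linear)
qed

text \<open>
  Describes the solutions of the zero-energy equation outside the support of \<open>U\<close>.
\<close>
lemma affine_where_second_derivative_vanishes:
  fixes y z z' :: "real \<Rightarrow> real"
  assumes y: "ac_deriv y z" and z: "ac_deriv z z'"
    and eq: "AE x in lebesgue. x \<in> {s..t} \<longrightarrow> z' x = 0" and r: "r \<in> {s..t}"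
  shows "z r = z s" "y r = y s + z s * (r - s)"
proof -
  have const: "z x = z s" if x: "x \<in> {s..r}" for x
  proof (rule ac_deriv_zero_const[OF z])
    show "AE w in lebesgue. w \<in> {s..x} \<longrightarrow> z' w = 0"
      using eq by eventually_elim (use x r in auto)
  qed (use x in simp)
  show "z r = z s"
    using const[of r] r by simp
  have "y r - y s = integral {s..r} z"
    using ac_deriv_integral[OF y, of s r] r by simp
  also have "\<dots> = integral {s..r} (\<lambda>_. z s)"
    by (rule integral_cong) (rule const)
  also have "\<dots> = z s * (r - s)"
    using r by simp
  finally show "y r = y s + z s * (r - s)" by simp
qed

lemma ac_deriv_exp: "ac_deriv (\<lambda>x. exp (\<kappa> * x)) (\<lambda>x. \<kappa> * exp (\<kappa> * x :: real))"
  by (rule ac_deriv_C1)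
    (auto intro!: derivative_eq_intros continuous_intros
      simp: has_real_derivative_iff_has_vector_derivative[symmetric])

text \<open>
  The equation \<open>y'' = \<kappa>\<^sup>2 y\<close> factorizes: \<open>(y' + \<kappa> y) exp (- \<kappa> x)\<close> is conserved, and therefore
  \<open>y exp (\<kappa> x)\<close> has a derivative proportional to \<open>exp (2 \<kappa> x)\<close>. Both signs of \<open>\<kappa>\<close> are used, one
  on each side of the support of the potential.
\<close>
lemma free_solution_exponential:
  fixes y z z' :: "real \<Rightarrow> real"
  assumes y: "ac_deriv y z" and z: "ac_deriv z z'"
    and eq: "AE x in lebesgue. x \<in> {s..t} \<longrightarrow> z' x = \<kappa>\<^sup>2 * y x" and "s \<le> t" "\<kappa> \<noteq> 0"
  shows "(z t + \<kappa> * y t) * exp (- \<kappa> * t) = (z s + \<kappa> * y s) * exp (- \<kappa> * s)"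
    and "y t * exp (\<kappa> * t) - y s * exp (\<kappa> * s) =
      (z s + \<kappa> * y s) * exp (- \<kappa> * s) / (2 * \<kappa>) * (exp (2 * \<kappa> * t) - exp (2 * \<kappa> * s))"
proof -
  have c: "(z r + \<kappa> * y r) * exp (- \<kappa> * r) = (z s + \<kappa> * y s) * exp (- \<kappa> * s)" if r: "r \<in> {s..t}" for r
  proof -
    have "ac_deriv (\<lambda>x. (z x + \<kappa> * y x) * exp (- \<kappa> * x))
        (\<lambda>x. (z' x + \<kappa> * z x) * exp (- \<kappa> * x) + (z x + \<kappa> * y x) * (- \<kappa> * exp (- \<kappa> * x)))"
      by (intro ac_deriv_mult ac_deriv_add ac_deriv_cmult y z ac_deriv_exp)
    moreover have "AE x in lebesgue. x \<in> {s..r} \<longrightarrow>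
        (z' x + \<kappa> * z x) * exp (- \<kappa> * x) + (z x + \<kappa> * y x) * (- \<kappa> * exp (- \<kappa> * x)) = 0"
      using eq by eventually_elim (use r in \<open>auto simp: algebra_simps power2_eq_square\<close>)
    moreover have "s \<le> r" using r by simp
    ultimately show ?thesis by (rule ac_deriv_zero_const)
  qed
  from c[of t] \<open>s \<le> t\<close> show "(z t + \<kappa> * y t) * exp (- \<kappa> * t) = (z s + \<kappa> * y s) * exp (- \<kappa> * s)"
    by simp
  let ?c = "(z s + \<kappa> * y s) * exp (- \<kappa> * s)"
  have "y t * exp (\<kappa> * t) - ?c / (2 * \<kappa>) * exp ((2 * \<kappa>) * t) =
      y s * exp (\<kappa> * s) - ?c / (2 * \<kappa>) * exp ((2 * \<kappa>) * s)"
  proof -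
    have "ac_deriv (\<lambda>x. y x * exp (\<kappa> * x) - ?c / (2 * \<kappa>) * exp ((2 * \<kappa>) * x))
        (\<lambda>x. (z x * exp (\<kappa> * x) + y x * (\<kappa> * exp (\<kappa> * x))) - ?c / (2 * \<kappa>) * ((2 * \<kappa>) * exp ((2 * \<kappa>) * x)))"
      by (intro ac_deriv_mult ac_deriv_diff ac_deriv_cmult y ac_deriv_exp)
    moreover have "AE x in lebesgue. x \<in> {s..t} \<longrightarrow>
        (z x * exp (\<kappa> * x) + y x * (\<kappa> * exp (\<kappa> * x))) - ?c / (2 * \<kappa>) * ((2 * \<kappa>) * exp ((2 * \<kappa>) * x)) = 0"
    proof (intro AE_I2 impI)
      fix x assume "x \<in> {s..t}"
      then have "?c * exp ((2 * \<kappa>) * x) = (z x + \<kappa> * y x) * (exp (- \<kappa> * x) * exp ((2 * \<kappa>) * x))"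
        using c by (metis mult.assoc)
      also have "exp (- \<kappa> * x) * exp ((2 * \<kappa>) * x) = exp (\<kappa> * x)"
        by (simp flip: exp_add)
      finally show "(z x * exp (\<kappa> * x) + y x * (\<kappa> * exp (\<kappa> * x))) - ?c / (2 * \<kappa>) * ((2 * \<kappa>) * exp ((2 * \<kappa>) * x)) = 0"
        using \<open>\<kappa> \<noteq> 0\<close> by (simp add: field_simps)
    qed
    ultimately show ?thesis
      using \<open>s \<le> t\<close> by (rule ac_deriv_zero_const)
  qed
  moreover have "p - q = d * (v - w)" if "p - d * v = q - d * w" for p q d v w :: real
    using that by (simp add: algebra_simps)
  ultimately show "y t * exp (\<kappa> * t) - y s * exp (\<kappa> * s) =
      ?c / (2 * \<kappa>) * (exp (2 * \<kappa> * t) - exp (2 * \<kappa> * s))"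
    by blast
qed

lemma not_square_integrable_if_large_on_long_intervals:
  fixes y :: "real \<Rightarrow> real"
  assumes i: "integrable lebesgue (\<lambda>x. (y x)\<^sup>2)"
    and large: "\<And>n::nat. \<exists>s. \<forall>x\<in>{s..s + real n}. 1 \<le> \<bar>y x\<bar>"
  shows False
proof -
  have "real n \<le> (\<integral>x. (y x)\<^sup>2 \<partial>lebesgue)" for n
  proof -
    obtain s where s: "\<And>x. x \<in> {s..s + real n} \<Longrightarrow> 1 \<le> \<bar>y x\<bar>"
      using large by blast
    have "real n = (\<integral>x. indicator {s..s + real n} x \<partial>lebesgue)"
      by simp
    also have "\<dots> \<le> (\<integral>x. (y x)\<^sup>2 \<partial>lebesgue)"
    proof (rule integral_mono)
      fix x show "indicator {s..s + real n} x \<le> (y x)\<^sup>2"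
        using s[of x] by (auto simp: indicator_def abs_le_square_iff[of 1, simplified])
    qed (use i in auto)
    finally show ?thesis .
  qed
  then show False
    by (meson not_less reals_Archimedean2)
qed

lemma exp_growth_exceeds_one:
  fixes A B k :: real
  assumes "A \<noteq> 0" "k > 0"
  obtains X where "\<And>r. r \<ge> X \<Longrightarrow> 1 \<le> \<bar>A * exp (k * r) + B * exp (- k * r)\<bar>"
proof (rule that)
  let ?X = "max 0 ((1 + \<bar>B\<bar>) / (\<bar>A\<bar> * k))"
  fix r assume r: "r \<ge> ?X"
  have "(1 + \<bar>B\<bar>) / (\<bar>A\<bar> * k) \<le> r" "0 \<le> r" using r by auto
  then have "1 + \<bar>B\<bar> \<le> \<bar>A\<bar> * (k * r)"
    using assms by (simp add: field_simps)
  also have "\<dots> \<le> \<bar>A\<bar> * exp (k * r)"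
  proof (rule mult_left_mono)
    show "k * r \<le> exp (k * r)"
      using exp_ge_add_one_self[of "k * r"] by linarith
  qed simp
  finally have "1 + \<bar>B\<bar> \<le> \<bar>A * exp (k * r)\<bar>" by (simp add: abs_mult)
  moreover have "\<bar>B * exp (- k * r)\<bar> \<le> \<bar>B\<bar>"
    using assms \<open>0 \<le> r\<close> by (simp add: abs_mult mult_left_le)
  ultimately show "1 \<le> \<bar>A * exp (k * r) + B * exp (- k * r)\<bar>"
    by linarith
qed

text \<open>
  The growing exponential is not square integrable, so its coefficient \<open>c\<close> vanishes.
\<close>
lemma square_integrable_free_solution_right:
  fixes y z z' :: "real \<Rightarrow> real"
  assumes y: "ac_deriv y z" and z: "ac_deriv z z'"
    and eq: "AE x in lebesgue. s \<le> x \<longrightarrow> z' x = k\<^sup>2 * y x" and "k > 0"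
    and i: "integrable lebesgue (\<lambda>x. (y x)\<^sup>2)"
  shows "z s = - k * y s" "\<And>t. s \<le> t \<Longrightarrow> y t * exp (k * t) = y s * exp (k * s)"
proof -
  define c where "c = (z s + k * y s) * exp (- k * s)"
  have e: "y t * exp (k * t) - y s * exp (k * s) = c / (2 * k) * (exp (2 * k * t) - exp (2 * k * s))"
    if "s \<le> t" for t
    unfolding c_def
    by (rule free_solution_exponential(2)[OF y z]) (use eq that \<open>k > 0\<close> in auto)
  define B where "B = y s * exp (k * s) - c / (2 * k) * exp (2 * k * s)"
  have f: "y t = c / (2 * k) * exp (k * t) + B * exp (- k * t)" if "s \<le> t" for t
  proof -
    have "y t * exp (k * t) = c / (2 * k) * exp (2 * k * t) + B"
      using e[OF that] by (simp add: B_def algebra_simps)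
    then have "y t * exp (k * t) * exp (- k * t) = (c / (2 * k) * exp (2 * k * t) + B) * exp (- k * t)"
      by simp
    also have "\<dots> = c / (2 * k) * (exp (2 * k * t) * exp (- k * t)) + B * exp (- k * t)"
      by (simp add: algebra_simps)
    finally show ?thesis
      by (simp flip: exp_add add: mult.assoc)
  qed
  have "c = 0"
  proof (rule ccontr)
    assume "c \<noteq> 0"
    then obtain X where X: "\<And>r. r \<ge> X \<Longrightarrow> 1 \<le> \<bar>c / (2 * k) * exp (k * r) + B * exp (- k * r)\<bar>"
      using exp_growth_exceeds_one[of "c / (2 * k)" k B] \<open>k > 0\<close> by auto
    have "\<exists>s'. \<forall>x\<in>{s'..s' + real n}. 1 \<le> \<bar>y x\<bar>" for n :: nat
    proof (intro exI[of _ "max s X"] ballI)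
      fix x assume "x \<in> {max s X..max s X + real n}"
      then have "s \<le> x" "X \<le> x" by auto
      then show "1 \<le> \<bar>y x\<bar>" using f[of x] X[of x] by simp
    qed
    then show False
      by (rule not_square_integrable_if_large_on_long_intervals[OF i])
  qed
  then show "z s = - k * y s"
    by (simp add: c_def)
  show "y t * exp (k * t) = y s * exp (k * s)" if "s \<le> t" for t
    using e[OF that] \<open>c = 0\<close> by simp
qed

text \<open>
  The mirror image, with \<open>\<kappa> = - k\<close> in the factorization.
\<close>
lemma square_integrable_free_solution_left:
  fixes y z z' :: "real \<Rightarrow> real"
  assumes y: "ac_deriv y z" and z: "ac_deriv z z'"
    and eq: "AE x in lebesgue. x \<le> s \<longrightarrow> z' x = k\<^sup>2 * y x" and "k > 0"
    and i: "integrable lebesgue (\<lambda>x. (y x)\<^sup>2)"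
  shows "z s = k * y s" "\<And>t. t \<le> s \<Longrightarrow> y t * exp (- k * t) = y s * exp (- k * s)"
proof -
  define c where "c = (z s - k * y s) * exp (k * s)"
  have e: "y s * exp (- k * s) - y t * exp (- k * t) = - c / (2 * k) * (exp (- 2 * k * s) - exp (- 2 * k * t))"
    if "t \<le> s" for t
  proof -
    have ae: "AE x in lebesgue. x \<in> {t..s} \<longrightarrow> z' x = (-k)\<^sup>2 * y x"
      using eq by eventually_elim auto
    have "c = (z t - k * y t) * exp (k * t)"
      using free_solution_exponential(1)[OF y z ae that] \<open>k > 0\<close> by (simp add: c_def)
    then show ?thesis
      using free_solution_exponential(2)[OF y z ae that] \<open>k > 0\<close> by simp
  qed
  define B where "B = y s * exp (- k * s) + c / (2 * k) * exp (- 2 * k * s)"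
  have f: "y t = (- c / (2 * k)) * exp (k * - t) + B * exp (- k * - t)" if "t \<le> s" for t
  proof -
    have "y t * exp (- k * t) = - c / (2 * k) * exp (- 2 * k * t) + B"
      using e[OF that] by (simp add: B_def algebra_simps)
    then have "y t * exp (- k * t) * exp (k * t) = (- c / (2 * k) * exp (- 2 * k * t) + B) * exp (k * t)"
      by simp
    also have "\<dots> = - c / (2 * k) * (exp (- 2 * k * t) * exp (k * t)) + B * exp (k * t)"
      by (simp add: algebra_simps)
    finally show ?thesis
      by (simp flip: exp_add add: mult.assoc)
  qed
  have "c = 0"
  proof (rule ccontr)
    assume "c \<noteq> 0"
    then obtain X where X: "\<And>r. r \<ge> X \<Longrightarrow> 1 \<le> \<bar>(- c / (2 * k)) * exp (k * r) + B * exp (- k * r)\<bar>"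
      using exp_growth_exceeds_one[of "- c / (2 * k)" k B] \<open>k > 0\<close> by auto
    have "\<exists>s'. \<forall>x\<in>{s'..s' + real n}. 1 \<le> \<bar>y x\<bar>" for n :: nat
    proof (intro exI[of _ "min s (- X) - real n"] ballI)
      fix x assume "x \<in> {min s (- X) - real n..min s (- X) - real n + real n}"
      then have "x \<le> s" "X \<le> - x" by auto
      then show "1 \<le> \<bar>y x\<bar>" using f[of x] X[of "- x"] by simp
    qed
    then show False
      by (rule not_square_integrable_if_large_on_long_intervals[OF i])
  qed
  then show "z s = k * y s"
    by (simp add: c_def)
  show "y t * exp (- k * t) = y s * exp (- k * s)" if "t \<le> s" for t
    using e[OF that] \<open>c = 0\<close> by simp
qed

section \<open>The shooting problem\<close>

text \<open>
  A half-bound state \<open>u\<close> and the second solution \<open>u1\<close>, recorded through their data at the ends of an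
  interval \<open>[-a, a]\<close> outside of which \<open>U\<close> vanishes.
\<close>
locale resonance =
  fixes U u u' u1 u1' :: "real \<Rightarrow> real" and \<theta> \<theta>1 a M :: real
  assumes a_pos: "0 < a"
    and U_outside: "AE x in lebesgue. a \<le> \<bar>x\<bar> \<longrightarrow> U x = 0"
    and ac_u: "ac_deriv u u'" "ac_deriv u' (\<lambda>x. U x * u x)"
    and ac_u1: "ac_deriv u1 u1'" "ac_deriv u1' (\<lambda>x. U x * u1 x)"
    and at_left_end: "u (-a) = 1" "u' (-a) = 0" "u1 (-a) = -a" "u1' (-a) = 1"
    and at_right_end: "u a = \<theta>" "u' a = 0" "u1 a = a / \<theta> + \<theta>1" "u1' a = 1 / \<theta>"
    and \<theta>_nonzero: "\<theta> \<noteq> 0"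
    and bound: "\<And>x. x \<in> {-a..a} \<Longrightarrow> \<bar>u x\<bar> \<le> M" "\<And>x. x \<in> {-a..a} \<Longrightarrow> \<bar>u1 x\<bar> \<le> M"
begin

lemma M_ge_1: "1 \<le> M"
  using bound(1)[of "-a"] at_left_end(1) a_pos by simp

lemma pos\<theta>: "0 < 1 + \<theta>\<^sup>2"
  by (simp add: add_pos_nonneg)

lemma wronskian: "u x * u1' x - u' x * u1 x = 1"
  using wronskian_constant[OF ac_u ac_u1, of x "-a"] at_left_end by simp

definition L1 :: "(real \<Rightarrow> real) \<Rightarrow> real" where
  "L1 p = integral {-a..a} (\<lambda>t. \<bar>p t\<bar>)"

lemma L1_nonneg: "p absolutely_integrable_on {-a..a} \<Longrightarrow> 0 \<le> L1 p"
  unfolding L1_def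
  by (intro Henstock_Kurzweil_Integration.integral_nonneg set_lebesgue_integral_eq_integral(1) set_integrable_abs) auto

lemma weighted_integrable:
  fixes p w :: "real \<Rightarrow> real"
  assumes "p absolutely_integrable_on {-a..a}" "continuous_on {-a..a} w" "x \<le> a"
  shows "(\<lambda>t. p t * w t) absolutely_integrable_on {-a..x}" "(\<lambda>t. p t * w t) integrable_on {-a..x}"
proof -
  have "(\<lambda>t. p t * w t) absolutely_integrable_on {-a..a}"
    using absolutely_integrable_scaleR_continuous[OF assms(1,2)] by simp
  then show "(\<lambda>t. p t * w t) absolutely_integrable_on {-a..x}"
    by (rule absolutely_integrable_on_subinterval) (use assms(3) in auto)
  then show "(\<lambda>t. p t * w t) integrable_on {-a..x}"
    by (rule set_lebesgue_integral_eq_integral(1))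
qed

lemma weighted_integral_bound:
  assumes p: "p absolutely_integrable_on {-a..a}" and w: "continuous_on {-a..a} w"
    and B: "\<And>t. t \<in> {-a..a} \<Longrightarrow> \<bar>w t\<bar> \<le> B" and x: "x \<in> {-a..a}"
  shows "\<bar>integral {-a..x} (\<lambda>t. p t * w t)\<bar> \<le> B * L1 p"
proof -
  have ip: "(\<lambda>t. \<bar>p t\<bar>) integrable_on {-a..a}"
    using p by (intro set_lebesgue_integral_eq_integral(1) set_integrable_abs)
  have i: "(\<lambda>t. B * \<bar>p t\<bar>) integrable_on {-a..s}" if "s \<le> a" for s
    by (rule integrable_subinterval_real[OF integrable_on_mult_right[OF ip]]) (use that in auto)
  have B0: "0 \<le> B"
    using B[of a] a_pos abs_ge_zero[of "w a"] by auto
  have "norm (integral {-a..x} (\<lambda>t. p t * w t)) \<le> integral {-a..x} (\<lambda>t. B * \<bar>p t\<bar>)"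
  proof (rule integral_norm_bound_integral)
    show "(\<lambda>t. p t * w t) integrable_on {-a..x}"
      using weighted_integrable(2)[OF p w] x by simp
    show "(\<lambda>t. B * \<bar>p t\<bar>) integrable_on {-a..x}" using i x by simp
    fix t assume "t \<in> {-a..x}"
    then have "\<bar>w t\<bar> \<le> B" using B x by auto
    then show "norm (p t * w t) \<le> B * \<bar>p t\<bar>"
      using mult_right_mono[of "\<bar>w t\<bar>" B "\<bar>p t\<bar>"] by (simp add: abs_mult mult.commute)
  qed
  also have "\<dots> \<le> integral {-a..a} (\<lambda>t. B * \<bar>p t\<bar>)"
    by (rule integral_subset_le) (use i x B0 in auto)
  also have "\<dots> = B * L1 p"
    by (simp add: L1_def)
  finally show ?thesis by simp
qed

lemma continuous_u: "continuous_on S u" "continuous_on S u1"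
  using ac_deriv_continuous[OF ac_u(1)] ac_deriv_continuous[OF ac_u1(1)] by auto

text \<open>
  The solution operator of \<open>y'' = U y + p f\<close> with zero data at \<open>- a\<close>, by variation of constants.
\<close>
definition volterra :: "(real \<Rightarrow> real) \<Rightarrow> (real \<Rightarrow> real) \<Rightarrow> real \<Rightarrow> real" where
  "volterra p f x = u1 x * integral {-a..x} (\<lambda>t. p t * (u t * f t))
     - u x * integral {-a..x} (\<lambda>t. p t * (u1 t * f t))"

lemma volterra_bound:
  assumes p: "p absolutely_integrable_on {-a..a}" and f: "continuous_on {-a..a} f"
    and B: "\<And>t. t \<in> {-a..a} \<Longrightarrow> \<bar>f t\<bar> \<le> B" and x: "x \<in> {-a..a}"
  shows "\<bar>volterra p f x\<bar> \<le> 2 * M\<^sup>2 * L1 p * B"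
proof -
  have B0: "0 \<le> B"
    using B[of a] a_pos abs_ge_zero[of "f a"] by auto
  have 1: "\<bar>integral {-a..x} (\<lambda>t. p t * (v t * f t))\<bar> \<le> (M * B) * L1 p"
    if v: "continuous_on {-a..a} v" "\<And>t. t \<in> {-a..a} \<Longrightarrow> \<bar>v t\<bar> \<le> M" for v
  proof (rule weighted_integral_bound[OF p _ _ x])
    show "continuous_on {-a..a} (\<lambda>t. v t * f t)"
      by (intro continuous_intros v f)
    show "\<bar>v t * f t\<bar> \<le> M * B" if "t \<in> {-a..a}" for t
      using v(2)[OF that] B[OF that] M_ge_1 by (auto simp: abs_mult intro!: mult_mono)
  qed
  have 2: "\<bar>v x * integral {-a..x} (\<lambda>t. p t * (w t * f t))\<bar> \<le> M * ((M * B) * L1 p)"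
    if v: "\<bar>v x\<bar> \<le> M" and w: "continuous_on {-a..a} w" "\<And>t. t \<in> {-a..a} \<Longrightarrow> \<bar>w t\<bar> \<le> M"
    for v w :: "real \<Rightarrow> real"
    using v 1[OF w] M_ge_1 by (auto simp: abs_mult intro!: mult_mono)
  have "\<bar>volterra p f x\<bar> \<le> M * ((M * B) * L1 p) + M * ((M * B) * L1 p)"
    unfolding volterra_def
    using 2[of u1 u] 2[of u u1] bound x continuous_u by (smt (verit))
  then show ?thesis
    by (simp add: power2_eq_square mult_ac)
qed

text \<open>
  The solution of \<open>f'' = (U + p) f\<close> with \<open>f (- a) = 1\<close> and \<open>f' (- a) = k\<close>, the data of
  \<open>exp (k (x + a))\<close>, as an integral equation: \<open>u + k (u1 + a u)\<close> is the solution for \<open>p = 0\<close>.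
\<close>
definition shooting_solution :: "(real \<Rightarrow> real) \<Rightarrow> real \<Rightarrow> (real \<Rightarrow> real) \<Rightarrow> bool" where
  "shooting_solution p k f \<longleftrightarrow> continuous_on {-a..a} f \<and>
     (\<forall>x\<in>{-a..a}. f x = u x + k * (u1 x + a * u x) + volterra p f x)"

text \<open>
  This is \<open>\<theta> (f' a + k f a)\<close> for the shooting solution \<open>f\<close>, because \<open>k + \<integral> p u f\<close> and
  \<open>1 + k a - \<integral> p u1 f\<close> are its coefficients with respect to \<open>u1\<close> and \<open>u\<close> at the right end. It
  vanishes if and only if \<open>f\<close> continues to a decaying exponential.
\<close>
definition matching :: "(real \<Rightarrow> real) \<Rightarrow> real \<Rightarrow> (real \<Rightarrow> real) \<Rightarrow> real" where
  "matching p k f =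
     (k + integral {-a..a} (\<lambda>t. p t * (u t * f t))) * (1 + k * (a + \<theta> * \<theta>1))
     + k * \<theta>\<^sup>2 * (1 + k * a - integral {-a..a} (\<lambda>t. p t * (u1 t * f t)))"

text \<open>
  The Wronskian of \<open>y\<close> with a solution \<open>v\<close> of the homogeneous equation has derivative \<open>h v\<close>; the
  Wronskians with \<open>u\<close> and \<open>u1\<close> together determine \<open>y\<close>.
\<close>
lemma variation_of_constants:
  assumes y: "ac_deriv y z" and z: "ac_deriv z (\<lambda>x. U x * y x + h x)" and x: "-a \<le> x"
  shows "z x * u x - y x * u' x = z (-a) + integral {-a..x} (\<lambda>t. h t * u t)"
    and "z x * u1 x - y x * u1' x = - a * z (-a) - y (-a) + integral {-a..x} (\<lambda>t. h t * u1 t)"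
    and "y x = u1 x * (z (-a) + integral {-a..x} (\<lambda>t. h t * u t))
       + u x * (a * z (-a) + y (-a) - integral {-a..x} (\<lambda>t. h t * u1 t))"
proof -
  have gen: "z x * v x - y x * v' x = z (-a) * v (-a) - y (-a) * v' (-a) + integral {-a..x} (\<lambda>t. h t * v t)"
    if v: "ac_deriv v v'" "ac_deriv v' (\<lambda>x. U x * v x)" for v v'
  proof -
    have "ac_deriv (\<lambda>x. z x * v x - y x * v' x)
        (\<lambda>x. ((U x * y x + h x) * v x + z x * v' x) - (z x * v' x + y x * (U x * v x)))"
      by (intro ac_deriv_diff ac_deriv_mult y z v)
    then have "ac_deriv (\<lambda>x. z x * v x - y x * v' x) (\<lambda>x. h x * v x)"
      by (rule ac_deriv_negligible_change) (simp add: algebra_simps)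
    from ac_deriv_integral[OF this x] show ?thesis by simp
  qed
  show 1: "z x * u x - y x * u' x = z (-a) + integral {-a..x} (\<lambda>t. h t * u t)"
    using gen[OF ac_u] at_left_end by simp
  show 2: "z x * u1 x - y x * u1' x = - a * z (-a) - y (-a) + integral {-a..x} (\<lambda>t. h t * u1 t)"
    using gen[OF ac_u1] at_left_end by simp
  have "y x = y x * (u x * u1' x - u' x * u1 x)"
    by (simp add: wronskian)
  also have "\<dots> = u1 x * (z x * u x - y x * u' x) - u x * (z x * u1 x - y x * u1' x)"
    by (simp add: algebra_simps)
  finally show "y x = u1 x * (z (-a) + integral {-a..x} (\<lambda>t. h t * u t))
       + u x * (a * z (-a) + y (-a) - integral {-a..x} (\<lambda>t. h t * u1 t))"
    unfolding 1 2 by (simp add: algebra_simps)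
qed

end

section \<open>Eigenvalues and the matching condition\<close>

lemma exp_decay_integrable:
  assumes "k > 0"
  shows "integrable lebesgue (\<lambda>x. exp (- k * \<bar>x :: real\<bar>))"
proof -
  have 1: "(\<lambda>x. exp (- k * \<bar>x\<bar>)) absolutely_integrable_on {0..}"
  proof (rule nonnegative_absolutely_integrable_1)
    show "(\<lambda>x. exp (- k * \<bar>x\<bar>)) integrable_on {0..}"
      by (rule integrable_eq[OF integrable_on_exp_minus_to_infinity[OF assms]]) auto
  qed auto
  have 2: "(\<lambda>x. exp (- k * \<bar>- x\<bar>)) absolutely_integrable_on {..0}"
    using has_absolute_integral_reflect_real[of "{..0}" "{0..}" "\<lambda>x. exp (- k * \<bar>x\<bar>)"] 1 by auto
  have "(\<lambda>x. exp (- k * \<bar>x\<bar>)) absolutely_integrable_on ({..0} \<union> {0..})"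
    using 1 2 by (intro absolutely_integrable_Un) auto
  moreover have "{..0} \<union> {0..} = (UNIV :: real set)"
    by auto
  ultimately show ?thesis
    by (simp add: set_integrable_def)
qed

lemma L2_space_exp_decay:
  assumes m: "f \<in> borel_measurable lebesgue" and "k > 0"
    and b: "AE x in lebesgue. cmod (f x) \<le> C * exp (- k * \<bar>x\<bar>)"
  shows "f \<in> L2_space"
proof -
  have "integrable lebesgue (\<lambda>x. C\<^sup>2 * exp (- (2 * k) * \<bar>x\<bar>))"
    by (intro integrable_mult_right exp_decay_integrable) (use \<open>k > 0\<close> in auto)
  then have "integrable lebesgue (\<lambda>x. (cmod (f x))\<^sup>2)"
  proof (rule Bochner_Integration.integrable_bound)
    show "(\<lambda>x. (cmod (f x))\<^sup>2) \<in> borel_measurable lebesgue"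
      using m by measurable
    show "AE x in lebesgue. norm ((cmod (f x))\<^sup>2) \<le> norm (C\<^sup>2 * exp (- (2 * k) * \<bar>x\<bar>))"
      using b
    proof eventually_elim
      case (elim x)
      then have "(cmod (f x))\<^sup>2 \<le> (C * exp (- k * \<bar>x\<bar>))\<^sup>2"
        by (intro power_mono) auto
      then show ?case
        by (simp add: power_mult_distrib mult.assoc flip: exp_double)
    qed
  qed
  then show ?thesis
    using m by (simp add: L2_space_def)
qed

lemma exponential_tails_bound:
  fixes f :: "real \<Rightarrow> real"
  assumes c: "continuous_on UNIV f" and "a > 0" "k > 0"
    and l: "\<And>x. x \<le> -a \<Longrightarrow> f x = A * exp (k * x)" and r: "\<And>x. a \<le> x \<Longrightarrow> f x = B * exp (- k * x)"
  obtains C where "\<And>x. \<bar>f x\<bar> \<le> C * exp (- k * \<bar>x\<bar>)"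
proof -
  obtain S where S: "\<And>x. x \<in> {-a..a} \<Longrightarrow> \<bar>f x\<bar> \<le> S"
    using continuous_on_interval_bound[OF continuous_on_subset[OF c subset_UNIV]] by blast
  then have S0: "0 \<le> S"
    using S[of a] \<open>a > 0\<close> abs_ge_zero[of "f a"] by force
  have "\<bar>f x\<bar> \<le> (\<bar>A\<bar> + \<bar>B\<bar> + S * exp (k * a)) * exp (- k * \<bar>x\<bar>)" for x
  proof -
    consider "x \<le> -a" | "a \<le> x" | "x \<in> {-a..a}" by fastforce
    then have "\<bar>f x\<bar> \<le> \<bar>A\<bar> * exp (- k * \<bar>x\<bar>) \<or> \<bar>f x\<bar> \<le> \<bar>B\<bar> * exp (- k * \<bar>x\<bar>)
        \<or> \<bar>f x\<bar> \<le> S * exp (k * a) * exp (- k * \<bar>x\<bar>)"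
    proof cases
      case 1 then show ?thesis using l[of x] \<open>a > 0\<close> by (simp add: abs_mult)
    next
      case 2 then show ?thesis using r[of x] \<open>a > 0\<close> by (simp add: abs_mult)
    next
      case 3
      then have "k * \<bar>x\<bar> \<le> k * a" using \<open>k > 0\<close> by (intro mult_left_mono) auto
      then have "1 \<le> exp (k * a) * exp (- k * \<bar>x\<bar>)"
        by (simp flip: exp_add)
      then have "S * 1 \<le> S * (exp (k * a) * exp (- k * \<bar>x\<bar>))"
        using S0 by (rule mult_left_mono)
      then show ?thesis using S[OF 3] by (simp add: mult.assoc)
    qed
    moreover have "0 \<le> \<bar>A\<bar> * exp (- k * \<bar>x\<bar>)" "0 \<le> \<bar>B\<bar> * exp (- k * \<bar>x\<bar>)" "0 \<le> S * exp (k * a) * exp (- k * \<bar>x\<bar>)"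
      using S0 by auto
    ultimately show ?thesis
      unfolding distrib_right by (elim disjE) linarith+
  qed
  then show thesis using that by blast
qed

context resonance
begin

text \<open>
  Square integrability fixes the logarithmic derivative of \<open>y\<close> at both ends of \<open>[-a, a]\<close>. It remains
  to normalize \<open>y\<close> at \<open>- a\<close>. If \<open>y\<close> vanished there, then \<open>y\<close> would be a fixed point of the
  contraction \<open>volterra p\<close> and hence be zero everywhere.
\<close>
lemma eigenfunction_imp_shooting:
  fixes y z W :: "real \<Rightarrow> real"
  assumes y: "ac_deriv y z" and z: "ac_deriv z (\<lambda>x. (U x + W x + k\<^sup>2) * y x)"
    and W: "AE x in lebesgue. a \<le> \<bar>x\<bar> \<longrightarrow> W x = 0" "W absolutely_integrable_on {-a..a}"
    and k: "k > 0" and i: "integrable lebesgue (\<lambda>x. (y x)\<^sup>2)" and nz: "y x0 \<noteq> 0"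
    and small: "4 * M\<^sup>2 * L1 (\<lambda>x. W x + k\<^sup>2) \<le> 1"
  obtains f where "shooting_solution (\<lambda>x. W x + k\<^sup>2) k f" "matching (\<lambda>x. W x + k\<^sup>2) k f = 0"
proof -
  define p where "p x = W x + k\<^sup>2" for x
  have p: "p absolutely_integrable_on {-a..a}"
    unfolding p_def by (intro set_integral_add(1) W(2) absolutely_integrable_continuous_real continuous_intros)
  have cy: "continuous_on S y" for S
    by (rule ac_deriv_continuous[OF y])
  have "AE x in lebesgue. a \<le> \<bar>x\<bar> \<longrightarrow> (U x + W x + k\<^sup>2) * y x = k\<^sup>2 * y x"
    using U_outside W(1) by eventually_elim auto
  then have r: "AE x in lebesgue. a \<le> x \<longrightarrow> (U x + W x + k\<^sup>2) * y x = k\<^sup>2 * y x"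
    and l: "AE x in lebesgue. x \<le> -a \<longrightarrow> (U x + W x + k\<^sup>2) * y x = k\<^sup>2 * y x"
    by (eventually_elim, auto)+
  note R = square_integrable_free_solution_right[OF y z r k i]
  note L = square_integrable_free_solution_left[OF y z l k i]
  have z2: "ac_deriv z (\<lambda>x. U x * y x + p x * y x)"
    by (rule ac_deriv_negligible_change[OF z]) (simp add: p_def algebra_simps)
  note V = variation_of_constants[OF y z2]
  have nza: "y (-a) \<noteq> 0"
  proof
    assume y0: "y (-a) = 0"
    then have z0: "z (-a) = 0" using L(1) by simp
    have yv: "y x = volterra p y x" if "x \<in> {-a..a}" for x
      using V(3)[of x] that y0 z0 by (simp add: volterra_def mult_ac)
    obtain m where m: "m \<in> {-a..a}" "\<And>x. x \<in> {-a..a} \<Longrightarrow> \<bar>y x\<bar> \<le> \<bar>y m\<bar>"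
    proof -
      have "continuous_on {-a..a} (\<lambda>x. \<bar>y x\<bar>)"
        by (intro continuous_intros cy)
      from continuous_attains_sup[OF _ _ this] show thesis
        using a_pos that by auto
    qed
    have "2 * \<bar>y m\<bar> \<le> 4 * M\<^sup>2 * L1 p * \<bar>y m\<bar>"
      using volterra_bound[OF p cy m(2) m(1)] yv[OF m(1)] by (simp add: mult_ac)
    also have "\<dots> \<le> 1 * \<bar>y m\<bar>"
      using small by (intro mult_right_mono) (auto simp: p_def[abs_def])
    finally have inside: "y x = 0" if "x \<in> {-a..a}" for x
      using m(2)[OF that] by simp
    show False
    proof (cases "x0 \<in> {-a..a}")
      case False
      then consider "a \<le> x0" | "x0 \<le> -a" by force
      then show False
        using R(2)[of x0] L(2)[of x0] inside[of a] inside[of "-a"] a_pos nz by cases auto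
    qed (use inside nz in auto)
  qed
  define f where "f x = y x / y (-a)" for x
  have int_f: "integral {-a..x} (\<lambda>t. p t * (v t * f t)) = integral {-a..x} (\<lambda>t. p t * y t * v t) / y (-a)" for x v
    by (simp add: f_def mult_ac flip: integral_divide)
  have zk: "z (-a) / y (-a) = k"
    using L(1) nza by simp
  have "shooting_solution p k f"
    unfolding shooting_solution_def
  proof (intro conjI ballI)
    show "continuous_on {-a..a} f"
      unfolding f_def using nza by (intro continuous_intros cy) auto
    fix x assume "x \<in> {-a..a}"
    then have "y x = u1 x * (z (-a) + integral {-a..x} (\<lambda>t. p t * y t * u t))
       + u x * (a * z (-a) + y (-a) - integral {-a..x} (\<lambda>t. p t * y t * u1 t))"
      by (intro V(3)) auto
    moreover have "(A * (Z + P) + B * (a * Z + y (-a) - Q)) / y (-a) =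
        A * (Z / y (-a) + P / y (-a)) + B * (a * (Z / y (-a)) + 1 - Q / y (-a))" for A B Z P Q
      using nza by (simp add: field_simps)
    ultimately have "f x = u1 x * (z (-a) / y (-a) + integral {-a..x} (\<lambda>t. p t * y t * u t) / y (-a))
       + u x * (a * (z (-a) / y (-a)) + 1 - integral {-a..x} (\<lambda>t. p t * y t * u1 t) / y (-a))"
      unfolding f_def by metis
    then show "f x = u x + k * (u1 x + a * u x) + volterra p f x"
      unfolding volterra_def int_f zk by (simp add: algebra_simps)
  qed
  moreover have "matching p k f = 0"
  proof -
    have 1: "k + integral {-a..a} (\<lambda>t. p t * (u t * f t)) = \<theta> * (z a / y (-a))"
      using V(1)[of a] a_pos at_right_end nza zk unfolding int_f
      by (simp add: field_simps)
    have 2: "1 + k * a - integral {-a..a} (\<lambda>t. p t * (u1 t * f t)) =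
        - (z a / y (-a)) * (a / \<theta> + \<theta>1) + (y a / y (-a)) / \<theta>"
    proof -
      define Q where "Q = integral {-a..a} (\<lambda>t. p t * y t * u1 t)"
      have "Q = z a * (a / \<theta> + \<theta>1) - y a / \<theta> + a * z (-a) + y (-a)"
        using V(2)[of a] a_pos at_right_end by (simp add: Q_def)
      then have "Q / y (-a) = z a / y (-a) * (a / \<theta> + \<theta>1) - y a / y (-a) / \<theta> + a * (z (-a) / y (-a)) + 1"
        using nza by (simp add: add_divide_distrib diff_divide_distrib)
      then show ?thesis
        unfolding int_f Q_def[symmetric] zk by simp
    qed
    define Z Y where "Z = z a / y (-a)" and "Y = y a / y (-a)"
    have "Z = - k * Y" using R(1) by (simp add: Z_def Y_def)
    then show ?thesis
      unfolding matching_def 1 2 Z_def[symmetric] Y_def[symmetric]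
      using \<theta>_nonzero by (simp add: field_simps power2_eq_square)
  qed
  ultimately show thesis
    using that unfolding p_def[abs_def] by blast
qed

text \<open>
  An eigenfunction has a representative with absolutely continuous derivative, and its real or its
  imaginary part is a nontrivial real solution.
\<close>
lemma eigenvalue_imp_shooting:
  assumes eig: "is_eigenvalue (schroedinger_operator (\<lambda>x. U x + W x)) (- k\<^sup>2)"
    and W: "AE x in lebesgue. a \<le> \<bar>x\<bar> \<longrightarrow> W x = 0" "W absolutely_integrable_on {-a..a}"
    and k: "k > 0" and small: "4 * M\<^sup>2 * L1 (\<lambda>x. W x + k\<^sup>2) \<le> 1"
  obtains f where "shooting_solution (\<lambda>x. W x + k\<^sup>2) k f" "matching (\<lambda>x. W x + k\<^sup>2) k f = 0"
proof -
  obtain \<psi> \<psi>1 \<psi>2 where nz: "\<not> (AE x in lebesgue. \<psi> x = 0)" and L2: "\<psi> \<in> L2_space"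
    and w1: "has_weak_deriv \<psi> \<psi>1" and w2: "has_weak_deriv \<psi>1 \<psi>2"
    and eq: "AE x in lebesgue. complex_of_real (- k\<^sup>2) * \<psi> x = - \<psi>2 x + complex_of_real (U x + W x) * \<psi> x"
    using eig by (auto simp: is_eigenvalue_def schroedinger_operator_def W22_def)
  obtain F where F: "ac_deriv F \<psi>1" "AE x in lebesgue. \<psi> x = F x"
    using weak_deriv_imp_ac_deriv[OF w1] .
  obtain F1 where F1: "ac_deriv F1 \<psi>2" "AE x in lebesgue. \<psi>1 x = F1 x"
    using weak_deriv_imp_ac_deriv[OF w2] .
  have FF1: "ac_deriv F F1"
    by (rule ac_deriv_negligible_change[OF F(1) F1(2)])
  have "AE x in lebesgue. \<psi>2 x = (U x + W x + k\<^sup>2) *\<^sub>R F x"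
    using eq F(2) by eventually_elim (simp add: scaleR_conv_of_real algebra_simps)
  then have F1q: "ac_deriv F1 (\<lambda>x. (U x + W x + k\<^sup>2) *\<^sub>R F x)"
    by (rule ac_deriv_negligible_change[OF F1(1)])
  have Fm: "F \<in> borel_measurable lebesgue"
    using borel_measurable_continuous_onI[OF ac_deriv_continuous[OF F(1)]] by (simp add: measurable_completion)
  have Fi: "integrable lebesgue (\<lambda>x. (cmod (F x))\<^sup>2)"
  proof (rule integrable_cong_AE_imp)
    show "integrable lebesgue (\<lambda>x. (cmod (\<psi> x))\<^sup>2)"
      using L2 by (simp add: L2_space_def)
    show "(\<lambda>x. (cmod (F x))\<^sup>2) \<in> borel_measurable lebesgue"
      using Fm by measurable
    show "AE x in lebesgue. (cmod (\<psi> x))\<^sup>2 = (cmod (F x))\<^sup>2"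
      using F(2) by eventually_elim simp
  qed
  obtain x0 where "F x0 \<noteq> 0"
    using nz F(2) by (metis (mono_tags, lifting) AE_I2 eventually_mono)
  then obtain h :: "complex \<Rightarrow> real" where h: "bounded_linear h" "h (F x0) \<noteq> 0" "\<And>c. \<bar>h c\<bar> \<le> cmod c"
    using bounded_linear_Re bounded_linear_Im abs_Re_le_cmod abs_Im_le_cmod complex_eq_iff
    by (metis zero_complex.simps)
  have y: "ac_deriv (\<lambda>x. h (F x)) (\<lambda>x. h (F1 x))"
    by (rule ac_deriv_linear[OF FF1 h(1)])
  have z: "ac_deriv (\<lambda>x. h (F1 x)) (\<lambda>x. (U x + W x + k\<^sup>2) * h (F x))"
    using ac_deriv_linear[OF F1q h(1)] by (simp add: linear_simps(5)[OF h(1)])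
  have i: "integrable lebesgue (\<lambda>x. (h (F x))\<^sup>2)"
  proof (rule Bochner_Integration.integrable_bound[OF Fi])
    show "(\<lambda>x. (h (F x))\<^sup>2) \<in> borel_measurable lebesgue"
      using borel_measurable_continuous_onI[OF ac_deriv_continuous[OF y]]
      by (intro borel_measurable_power) (simp add: measurable_completion)
    show "AE x in lebesgue. norm ((h (F x))\<^sup>2) \<le> norm ((cmod (F x))\<^sup>2)"
      using h(3) by (intro AE_I2) (simp add: abs_le_square_iff[symmetric])
  qed
  show thesis
    using eigenfunction_imp_shooting[OF y z W k i h(2) small] that by blast
qed

text \<open>
  The eigenfunction is \<open>f\<close> on \<open>[-a, a]\<close>, continued by exponentials. At \<open>- a\<close>
  the data of \<open>f\<close> are those of \<open>exp (k (x + a))\<close> by construction; at \<open>a\<close> the vanishing of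
  \<open>matching\<close> makes the derivatives agree.
\<close>
lemma shooting_imp_eigenvalue:
  assumes f: "shooting_solution (\<lambda>x. W x + k\<^sup>2) k f" and match: "matching (\<lambda>x. W x + k\<^sup>2) k f = 0"
    and W: "AE x in lebesgue. a \<le> \<bar>x\<bar> \<longrightarrow> W x = 0" "W absolutely_integrable_on {-a..a}"
    and k: "k > 0"
    and UW: "(\<lambda>x. U x + W x) \<in> borel_measurable lebesgue" "AE x in lebesgue. \<bar>U x + W x\<bar> \<le> K"
  shows "is_eigenvalue (schroedinger_operator (\<lambda>x. U x + W x)) (- k\<^sup>2)"
proof -
  define p where "p x = W x + k\<^sup>2" for x
  have p: "p absolutely_integrable_on {-a..a}"
    unfolding p_def by (intro set_integral_add(1) W(2) absolutely_integrable_continuous_real continuous_intros)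
  have fc: "continuous_on {-a..a} f"
    and fe: "\<And>x. x \<in> {-a..a} \<Longrightarrow> f x = u x + k * (u1 x + a * u x) + volterra p f x"
    using f by (auto simp: shooting_solution_def p_def[abs_def])
  \<comment> \<open>cutting \<open>p f\<close> off to \<open>[-a, a]\<close> extends \<open>f\<close> to a function \<open>g\<close> on the line that can be glued\<close>
  define w where "w v x = indicator {-a..a} x * (p x * (v x * f x))" for v x
  have wi: "w v absolutely_integrable_on {s..t}" if "continuous_on {-a..a} v" for v s t
  proof -
    have "(\<lambda>x. p x * (v x * f x)) absolutely_integrable_on {-a..a}"
      by (intro weighted_integrable(1)[OF p]) (use that fc in \<open>auto intro: continuous_intros\<close>)
    then have "integrable lebesgue (w v)"
      by (simp add: set_integrable_def w_def[abs_def])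
    then show ?thesis
      unfolding set_integrable_def by (intro integrable_mult_indicator) auto
  qed
  define \<beta> where "\<beta> x = k + primitive_from (-a) (w u) x" for x
  define \<alpha> where "\<alpha> x = (1 + k * a) - primitive_from (-a) (w u1) x" for x
  have ac_\<beta>: "ac_deriv \<beta> (w u)"
    using ac_deriv_add[OF ac_deriv_const ac_deriv_primitive_from[OF wi[OF continuous_u(1)]]]
    unfolding \<beta>_def[abs_def] by simp
  have ac_\<alpha>: "ac_deriv \<alpha> (\<lambda>x. - w u1 x)"
    using ac_deriv_diff[OF ac_deriv_const ac_deriv_primitive_from[OF wi[OF continuous_u(2)]]]
    unfolding \<alpha>_def[abs_def] by simp
  have pw: "primitive_from (-a) (w v) x = integral {-a..x} (\<lambda>t. p t * (v t * f t))" if "x \<in> {-a..a}" for v x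
    using that unfolding primitive_from_def w_def by (auto intro!: integral_cong)
  define g where "g x = \<beta> x * u1 x + \<alpha> x * u x" for x
  define g' where "g' x = \<beta> x * u1' x + \<alpha> x * u' x" for x
  have gf: "g x = f x" if "x \<in> {-a..a}" for x
    using fe[OF that] pw[OF that] by (simp add: g_def \<alpha>_def \<beta>_def volterra_def algebra_simps)
  have ac_g: "ac_deriv g g'"
  proof -
    have "ac_deriv g (\<lambda>x. (w u x * u1 x + \<beta> x * u1' x) + (- w u1 x * u x + \<alpha> x * u' x))"
      unfolding g_def[abs_def] by (intro ac_deriv_add ac_deriv_mult ac_\<alpha> ac_\<beta> ac_u ac_u1)
    then show ?thesis
      by (rule ac_deriv_negligible_change) (simp add: w_def g'_def algebra_simps)
  qed
  have ac_g': "ac_deriv g' (\<lambda>x. U x * g x + indicator {-a..a} x * (p x * f x))"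
  proof -
    have "ac_deriv g' (\<lambda>x. (w u x * u1' x + \<beta> x * (U x * u1 x)) + (- w u1 x * u' x + \<alpha> x * (U x * u x)))"
      unfolding g'_def[abs_def] by (intro ac_deriv_add ac_deriv_mult ac_\<alpha> ac_\<beta> ac_u ac_u1)
    moreover have "(w u x * u1' x + \<beta> x * (U x * u1 x)) + (- w u1 x * u' x + \<alpha> x * (U x * u x)) =
        U x * g x + indicator {-a..a} x * (p x * f x)" for x
    proof -
      have "(w u x * u1' x + \<beta> x * (U x * u1 x)) + (- w u1 x * u' x + \<alpha> x * (U x * u x)) =
          U x * g x + indicator {-a..a} x * (p x * f x) * (u x * u1' x - u' x * u1 x)"
        by (simp add: w_def g_def algebra_simps)
      then show ?thesis by (simp add: wronskian)
    qed
    ultimately show ?thesis by simp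
  qed
  have g_left: "g (-a) = 1" "g' (-a) = k"
    by (simp_all add: g_def g'_def \<alpha>_def \<beta>_def at_left_end algebra_simps)
  have g_right: "g' a = - k * g a"
  proof -
    have \<beta>a: "\<beta> a = k + integral {-a..a} (\<lambda>t. p t * (u t * f t))"
      and \<alpha>a: "\<alpha> a = 1 + k * a - integral {-a..a} (\<lambda>t. p t * (u1 t * f t))"
      using pw[of a] a_pos by (simp_all add: \<alpha>_def \<beta>_def)
    have "\<theta> * (g' a + k * g a) = \<beta> a * (1 + k * (a + \<theta> * \<theta>1)) + k * \<theta>\<^sup>2 * \<alpha> a"
      using \<theta>_nonzero by (simp add: g_def g'_def at_right_end field_simps power2_eq_square)
    also have "\<dots> = 0"
      using match unfolding \<beta>a \<alpha>a matching_def p_def by simp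
    finally show ?thesis using \<theta>_nonzero by simp
  qed
  define \<psi> where "\<psi> x = (if x \<le> -a then exp (k * a) * exp (k * x)
      else if x \<le> a then g x else g a * exp (k * a) * exp (- k * x))" for x
  define \<psi>' where "\<psi>' x = (if x \<le> -a then exp (k * a) * (k * exp (k * x))
      else if x \<le> a then g' x else g a * exp (k * a) * (- k * exp (- k * x)))" for x
  have ac_\<psi>: "ac_deriv \<psi> \<psi>'"
    unfolding \<psi>_def[abs_def] \<psi>'_def[abs_def]
    by (intro ac_deriv_glue ac_deriv_cmult ac_deriv_exp ac_g)
      (use a_pos g_left in \<open>auto simp flip: exp_add\<close>)
  have "ac_deriv \<psi>' (\<lambda>x. if x \<le> -a then exp (k * a) * (k * (k * exp (k * x)))
      else if x \<le> a then U x * g x + indicator {-a..a} x * (p x * f x)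
      else g a * exp (k * a) * (- k * (- k * exp (- k * x))))"
    unfolding \<psi>'_def[abs_def]
    by (intro ac_deriv_glue ac_deriv_cmult ac_deriv_exp ac_g')
      (use a_pos g_left g_right in \<open>auto simp flip: exp_add\<close>)
  then have ac_\<psi>': "ac_deriv \<psi>' (\<lambda>x. (U x + W x + k\<^sup>2) * \<psi> x)"
  proof (rule ac_deriv_negligible_change)
    show "AE x in lebesgue. (if x \<le> -a then exp (k * a) * (k * (k * exp (k * x)))
      else if x \<le> a then U x * g x + indicator {-a..a} x * (p x * f x)
      else g a * exp (k * a) * (- k * (- k * exp (- k * x)))) = (U x + W x + k\<^sup>2) * \<psi> x"
      using U_outside W(1)
    proof eventually_elim
      case (elim x)
      consider "x \<le> -a" | "x > a" | "x \<in> {-a..a}" "\<not> x \<le> -a" by fastforce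
      then show ?case
      proof cases
        case 3
        then show ?thesis using gf[of x] by (simp add: \<psi>_def p_def algebra_simps)
      qed (use elim a_pos in \<open>auto simp: \<psi>_def power2_eq_square\<close>)
    qed
  qed
  have c\<psi>: "continuous_on UNIV \<psi>" and c\<psi>': "continuous_on UNIV \<psi>'"
    using ac_deriv_continuous ac_\<psi> ac_\<psi>' by blast+
  obtain C where C: "\<And>x. \<bar>\<psi> x\<bar> \<le> C * exp (- k * \<bar>x\<bar>)"
  proof -
    have l: "\<psi> x = exp (k * a) * exp (k * x)" if "x \<le> -a" for x
      using that by (simp add: \<psi>_def)
    have r: "\<psi> x = (g a * exp (k * a)) * exp (- k * x)" if "a \<le> x" for x
      using that a_pos by (auto simp: \<psi>_def mult.assoc simp flip: exp_add)
    show thesis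
      using exponential_tails_bound[OF c\<psi> a_pos k l r] that by blast
  qed
  obtain C' where C': "\<And>x. \<bar>\<psi>' x\<bar> \<le> C' * exp (- k * \<bar>x\<bar>)"
  proof -
    have l: "\<psi>' x = (k * exp (k * a)) * exp (k * x)" if "x \<le> -a" for x
      using that by (simp add: \<psi>'_def)
    have r: "\<psi>' x = (- k * g a * exp (k * a)) * exp (- k * x)" if "a \<le> x" for x
      using that a_pos g_right by (auto simp: \<psi>'_def mult.assoc simp flip: exp_add)
    show thesis
      using exponential_tails_bound[OF c\<psi>' a_pos k l r] that by blast
  qed
  have m: "\<psi> \<in> borel_measurable lebesgue" "\<psi>' \<in> borel_measurable lebesgue"
    using borel_measurable_continuous_onI[OF c\<psi>] borel_measurable_continuous_onI[OF c\<psi>']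
    by (simp_all add: measurable_completion)
  define \<Psi> where "\<Psi> x = complex_of_real (\<psi> x)" for x
  define \<Psi>1 where "\<Psi>1 x = complex_of_real (\<psi>' x)" for x
  define \<Psi>2 where "\<Psi>2 x = complex_of_real ((U x + W x + k\<^sup>2) * \<psi> x)" for x
  have w1: "has_weak_deriv \<Psi> \<Psi>1" and w2: "has_weak_deriv \<Psi>1 \<Psi>2"
    unfolding \<Psi>_def[abs_def] \<Psi>1_def[abs_def] \<Psi>2_def[abs_def]
    by (rule ac_deriv_imp_weak_deriv[OF ac_deriv_linear[OF ac_\<psi> bounded_linear_of_real]],
        rule ac_deriv_imp_weak_deriv[OF ac_deriv_linear[OF ac_\<psi>' bounded_linear_of_real]])
  have L: "\<Psi> \<in> L2_space" "\<Psi>1 \<in> L2_space"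
    unfolding \<Psi>_def[abs_def] \<Psi>1_def[abs_def]
    by (rule L2_space_exp_decay[OF _ k, where C = C], use m C in simp_all)
      (rule L2_space_exp_decay[OF _ k, where C = C'], use m C' in simp_all)
  have L2: "\<Psi>2 \<in> L2_space"
  proof (rule L2_space_exp_decay[OF _ k])
    show "\<Psi>2 \<in> borel_measurable lebesgue"
      unfolding \<Psi>2_def[abs_def] using UW(1) m(1) by measurable
    show "AE x in lebesgue. cmod (\<Psi>2 x) \<le> ((K + k\<^sup>2) * C) * exp (- k * \<bar>x\<bar>)"
      using UW(2)
    proof eventually_elim
      case (elim x)
      then have K0: "0 \<le> K" by linarith
      have "\<bar>U x + W x + k\<^sup>2\<bar> * \<bar>\<psi> x\<bar> \<le> (K + k\<^sup>2) * (C * exp (- k * \<bar>x\<bar>))"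
      proof (rule mult_mono)
        show "\<bar>U x + W x + k\<^sup>2\<bar> \<le> K + k\<^sup>2"
          using elim abs_triangle_ineq[of "U x + W x" "k\<^sup>2"] by simp
        show "0 \<le> K + k\<^sup>2" using K0 by simp
      qed (rule C, simp)
      then show ?case
        unfolding \<Psi>2_def norm_of_real by (simp add: abs_mult mult_ac)
    qed
  qed
  have "\<not> (AE x in lebesgue. \<Psi> x = 0)"
  proof
    assume "AE x in lebesgue. \<Psi> x = 0"
    from AE_lebesgue_negligibleE[OF this]
    obtain N where N: "negligible N" "\<And>x. x \<notin> N \<Longrightarrow> \<Psi> x = 0"
      by blast
    have "{-a-1<..<-a} \<subseteq> N"
      using N(2) by (force simp: \<Psi>_def \<psi>_def)
    then have "negligible {-a-1<..<-a}"
      using N(1) negligible_subset by blast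
    then show False
      by (simp add: open_not_negligible)
  qed
  moreover have "(\<Psi>, \<lambda>x. complex_of_real (- k\<^sup>2) * \<Psi> x) \<in> schroedinger_operator (\<lambda>x. U x + W x)"
  proof -
    have "(\<lambda>x. complex_of_real (- k\<^sup>2) * \<Psi> x) \<in> L2_space"
      using L(1) unfolding L2_space_def by (auto simp: norm_mult power_mult_distrib)
    moreover have "AE x in lebesgue. complex_of_real (- k\<^sup>2) * \<Psi> x = - \<Psi>2 x + complex_of_real (U x + W x) * \<Psi> x"
      by (simp add: \<Psi>2_def \<Psi>_def algebra_simps)
    ultimately show ?thesis
      unfolding schroedinger_operator_def W22_def using L L2 w1 w2 by blast
  qed
  ultimately show ?thesis
    unfolding is_eigenvalue_def by blast
qed

end

section \<open>Existence and stability of shooting solutions\<close>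

lemma uniform_limit_dominated:
  fixes f :: "'n \<Rightarrow> 'b \<Rightarrow> real"
  assumes "\<forall>\<^sub>F n in F. \<forall>x\<in>S. \<bar>f n x - g x\<bar> \<le> b n" "(b \<longlongrightarrow> 0) F"
  shows "uniform_limit S f g F"
proof (rule uniform_limitI)
  fix e :: real assume "e > 0"
  then have "\<forall>\<^sub>F n in F. b n < e"
    using order_tendstoD(2)[OF assms(2)] by simp
  with assms(1) show "\<forall>\<^sub>F n in F. \<forall>x\<in>S. dist (f n x) (g x) < e"
    by eventually_elim (force simp: dist_real_def)
qed

lemma uniform_limit_constants:
  fixes c :: "'n \<Rightarrow> real"
  assumes "(c \<longlongrightarrow> d) F"
  shows "uniform_limit S (\<lambda>n x. c n) (\<lambda>x. d) F"
  by (rule uniform_limit_dominated[where b = "\<lambda>n. \<bar>c n - d\<bar>"])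
    (use assms in \<open>auto intro: tendsto_rabs_zero LIM_zero\<close>)

context resonance
begin

lemma L1_add:
  assumes "p absolutely_integrable_on {-a..a}" "q absolutely_integrable_on {-a..a}"
  shows "L1 (\<lambda>x. p x + q x) \<le> L1 p + L1 q"
proof -
  have i: "(\<lambda>t. \<bar>r t\<bar>) integrable_on {-a..a}" if "r absolutely_integrable_on {-a..a}" for r :: "real \<Rightarrow> real"
    using that by (intro set_lebesgue_integral_eq_integral(1) set_integrable_abs)
  have "L1 (\<lambda>x. p x + q x) \<le> integral {-a..a} (\<lambda>t. \<bar>p t\<bar> + \<bar>q t\<bar>)"
    unfolding L1_def
    by (intro integral_le integrable_add i set_integral_add(1) assms) (simp add: abs_triangle_ineq)
  also have "\<dots> = L1 p + L1 q"
    unfolding L1_def by (intro integral_add i assms)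
  finally show ?thesis .
qed

lemma L1_cmult: "L1 (\<lambda>x. c * p x) = \<bar>c\<bar> * L1 p"
  by (simp add: L1_def abs_mult)

lemma L1_const: "L1 (\<lambda>x. c) = 2 * a * \<bar>c\<bar>"
  using a_pos by (simp add: L1_def)

lemma const_integrable: "(\<lambda>x. c :: real) absolutely_integrable_on {-a..a}"
  by (intro absolutely_integrable_continuous_real continuous_intros)

lemma volterra_continuous:
  assumes p: "p absolutely_integrable_on {-a..a}" and f: "continuous_on {-a..a} f"
  shows "continuous_on {-a..a} (volterra p f)"
proof -
  have I: "continuous_on {-a..a} (\<lambda>x. integral {-a..x} (\<lambda>t. p t * (v t * f t)))" if "continuous_on {-a..a} v" for v
    by (intro indefinite_integral_continuous_1 weighted_integrable(2)[OF p]) (use that f in \<open>auto intro: continuous_intros\<close>)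
  then show ?thesis
    unfolding volterra_def[abs_def] by (intro continuous_intros I continuous_u)
qed

lemma volterra_diff_right:
  assumes p: "p absolutely_integrable_on {-a..a}" and f: "continuous_on {-a..a} f" and g: "continuous_on {-a..a} g"
    and x: "x \<in> {-a..a}"
  shows "volterra p (\<lambda>t. f t - g t) x = volterra p f x - volterra p g x"
proof -
  have I: "integral {-a..x} (\<lambda>t. p t * (v t * (f t - g t))) =
      integral {-a..x} (\<lambda>t. p t * (v t * f t)) - integral {-a..x} (\<lambda>t. p t * (v t * g t))"
    if v: "continuous_on {-a..a} v" for v
  proof -
    have "(\<lambda>t. p t * (v t * f t)) integrable_on {-a..x}" "(\<lambda>t. p t * (v t * g t)) integrable_on {-a..x}"
      using x by (auto intro!: weighted_integrable(2)[OF p] continuous_intros v f g)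
    then show ?thesis
      by (subst integral_diff[symmetric]) (auto simp: algebra_simps)
  qed
  then show ?thesis
    unfolding volterra_def I[OF continuous_u(1)] I[OF continuous_u(2)] by (simp add: algebra_simps)
qed

lemma volterra_diff_left:
  assumes p: "p absolutely_integrable_on {-a..a}" and q: "q absolutely_integrable_on {-a..a}"
    and f: "continuous_on {-a..a} f" and x: "x \<in> {-a..a}"
  shows "volterra (\<lambda>t. p t - q t) f x = volterra p f x - volterra q f x"
proof -
  have I: "integral {-a..x} (\<lambda>t. (p t - q t) * (v t * f t)) =
      integral {-a..x} (\<lambda>t. p t * (v t * f t)) - integral {-a..x} (\<lambda>t. q t * (v t * f t))"
    if v: "continuous_on {-a..a} v" for v
  proof -
    have "(\<lambda>t. p t * (v t * f t)) integrable_on {-a..x}" "(\<lambda>t. q t * (v t * f t)) integrable_on {-a..x}"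
      using x by (auto intro!: weighted_integrable(2)[OF p] weighted_integrable(2)[OF q] continuous_intros v f)
    then show ?thesis
      by (subst integral_diff[symmetric]) (auto simp: algebra_simps)
  qed
  then show ?thesis
    unfolding volterra_def I[OF continuous_u(1)] I[OF continuous_u(2)] by (simp add: algebra_simps)
qed

text \<open>
  Banach's fixed point theorem for bounded continuous functions on the line. The retraction \<open>c\<close> onto
  \<open>[-a, a]\<close> makes the integral operator act on this space.
\<close>
lemma shooting_exists:
  assumes p: "p absolutely_integrable_on {-a..a}" and small: "4 * M\<^sup>2 * L1 p \<le> 1"
  shows "\<exists>f. shooting_solution p k f"
proof -
  define c where "c x = max (-a) (min a x)" for x
  have c: "c x \<in> {-a..a}" "x \<in> {-a..a} \<Longrightarrow> c x = x" for x
    using a_pos by (auto simp: c_def)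
  define S where "S f x = u x + k * (u1 x + a * u x) + volterra p f x" for f x
  have Sc: "continuous_on {-a..a} (S f)" if "continuous_on {-a..a} f" for f
    unfolding S_def[abs_def] by (intro continuous_intros continuous_u volterra_continuous p that)
  have bc: "(\<lambda>x. S \<phi> (c x)) \<in> bcontfun" for \<phi> :: "real \<Rightarrow>\<^sub>C real"
  proof -
    have S: "continuous_on {-a..a} (S \<phi>)" by (rule Sc) simp
    have "continuous_on UNIV (\<lambda>x. S \<phi> (c x))"
      by (rule continuous_on_compose2[OF S]) (use c(1) in \<open>auto simp: c_def intro!: continuous_intros\<close>)
    moreover have "bounded (S \<phi> ` {-a..a})"
      by (intro compact_imp_bounded compact_continuous_image S) simp
    then have "bounded (range (\<lambda>x. S \<phi> (c x)))"
      by (rule bounded_subset) (use c(1) in blast)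
    ultimately show ?thesis by (simp add: bcontfun_def)
  qed
  define T where "T \<phi> = Bcontfun (\<lambda>x. S \<phi> (c x))" for \<phi> :: "real \<Rightarrow>\<^sub>C real"
  have T: "apply_bcontfun (T \<phi>) x = S \<phi> (c x)" for \<phi> x
    unfolding T_def by (simp add: Bcontfun_inverse bc)
  have "\<exists>!\<phi>. T \<phi> = \<phi>"
  proof (rule banach_fix_type[of "1/2"])
    show "\<forall>\<phi> \<psi>. dist (T \<phi>) (T \<psi>) \<le> 1/2 * dist \<phi> \<psi>"
    proof (intro allI dist_bound)
      fix \<phi> \<psi> :: "real \<Rightarrow>\<^sub>C real" and x
      have "dist (T \<phi> x) (T \<psi> x) = \<bar>volterra p (\<lambda>t. \<phi> t - \<psi> t) (c x)\<bar>"
        using volterra_diff_right[OF p _ _ c(1)[of x], of \<phi> \<psi>] by (simp add: T S_def dist_real_def)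
      also have "\<dots> \<le> 2 * M\<^sup>2 * L1 p * dist \<phi> \<psi>"
      proof (rule volterra_bound[OF p _ _ c(1)])
        show "continuous_on {-a..a} (\<lambda>t. \<phi> t - \<psi> t)" by (intro continuous_intros) simp_all
        show "\<bar>\<phi> t - \<psi> t\<bar> \<le> dist \<phi> \<psi>" for t
          using dist_bounded[of \<phi> t \<psi>] by (simp add: dist_real_def)
      qed
      also have "\<dots> \<le> 1/2 * dist \<phi> \<psi>"
        using small by (intro mult_right_mono) auto
      finally show "dist (T \<phi> x) (T \<psi> x) \<le> 1/2 * dist \<phi> \<psi>" .
    qed
  qed auto
  then obtain \<phi> where \<phi>: "T \<phi> = \<phi>" by blast
  have "shooting_solution p k \<phi>"
    unfolding shooting_solution_def
  proof (intro conjI ballI)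
    fix x assume "x \<in> {-a..a}"
    then show "\<phi> x = u x + k * (u1 x + a * u x) + volterra p \<phi> x"
      using T[of \<phi> x] c(2) by (simp add: \<phi> S_def)
  qed simp
  then show ?thesis by blast
qed

text \<open>
  Subtract the two integral equations: the term with the difference of the solutions is absorbed by
  the contraction, at the cost of the factor two.
\<close>
lemma shooting_perturbation:
  assumes f: "shooting_solution p k f" and g: "shooting_solution q l g"
    and p: "p absolutely_integrable_on {-a..a}" and q: "q absolutely_integrable_on {-a..a}"
    and small: "4 * M\<^sup>2 * L1 p \<le> 1" and B: "\<And>x. x \<in> {-a..a} \<Longrightarrow> \<bar>g x\<bar> \<le> B" and x: "x \<in> {-a..a}"
  shows "\<bar>f x - g x\<bar> \<le> 2 * (\<bar>k - l\<bar> * (M * (1 + a)) + 2 * M\<^sup>2 * L1 (\<lambda>t. p t - q t) * B)"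
proof -
  have fc: "continuous_on {-a..a} f" and gc: "continuous_on {-a..a} g"
    using f g by (auto simp: shooting_solution_def)
  have dc: "continuous_on {-a..a} (\<lambda>x. f x - g x)"
    by (intro continuous_intros fc gc)
  have dc': "continuous_on {-a..a} (\<lambda>x. \<bar>f x - g x\<bar>)"
    by (intro continuous_intros dc)
  obtain m where m: "m \<in> {-a..a}" "\<And>x. x \<in> {-a..a} \<Longrightarrow> \<bar>f x - g x\<bar> \<le> \<bar>f m - g m\<bar>"
    using continuous_attains_sup[OF _ _ dc'] a_pos by auto
  have "f m - g m = (k - l) * (u1 m + a * u m) + (volterra p f m - volterra q g m)"
    using f g m(1) by (simp add: shooting_solution_def algebra_simps)
  also have "volterra p f m - volterra q g m =
      volterra p (\<lambda>x. f x - g x) m + volterra (\<lambda>t. p t - q t) g m"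
    by (simp add: volterra_diff_right[OF p fc gc m(1)] volterra_diff_left[OF p q gc m(1)])
  finally have eq: "f m - g m = (k - l) * (u1 m + a * u m)
      + (volterra p (\<lambda>x. f x - g x) m + volterra (\<lambda>t. p t - q t) g m)" .
  have 1: "\<bar>(k - l) * (u1 m + a * u m)\<bar> \<le> \<bar>k - l\<bar> * (M * (1 + a))"
  proof -
    have "\<bar>u1 m + a * u m\<bar> \<le> \<bar>u1 m\<bar> + a * \<bar>u m\<bar>"
      using a_pos abs_triangle_ineq[of "u1 m" "a * u m"] by (simp add: abs_mult)
    also have "\<dots> \<le> M + a * M"
      using bound m(1) a_pos by (intro add_mono mult_left_mono) auto
    finally have "\<bar>u1 m + a * u m\<bar> \<le> M * (1 + a)"
      by (simp add: algebra_simps)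
    then show ?thesis
      unfolding abs_mult by (rule mult_left_mono) simp
  qed
  have "\<bar>volterra p (\<lambda>x. f x - g x) m\<bar> \<le> 2 * M\<^sup>2 * L1 p * \<bar>f m - g m\<bar>"
    by (rule volterra_bound[OF p dc m(2) m(1)])
  also have "\<dots> \<le> 1/2 * \<bar>f m - g m\<bar>"
    using small by (intro mult_right_mono) auto
  finally have 2: "\<bar>volterra p (\<lambda>x. f x - g x) m\<bar> \<le> 1/2 * \<bar>f m - g m\<bar>" .
  have 3: "\<bar>volterra (\<lambda>t. p t - q t) g m\<bar> \<le> 2 * M\<^sup>2 * L1 (\<lambda>t. p t - q t) * B"
    by (rule volterra_bound[OF _ gc B m(1)]) (intro set_integral_diff(1) p q)
  have "\<bar>f m - g m\<bar> \<le> 2 * (\<bar>k - l\<bar> * (M * (1 + a)) + 2 * M\<^sup>2 * L1 (\<lambda>t. p t - q t) * B)"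
  proof -
    have "\<bar>d\<bar> \<le> 2 * (r + s)" if "d = b + (c + e)" "\<bar>b\<bar> \<le> r" "\<bar>c\<bar> \<le> 1/2 * \<bar>d\<bar>" "\<bar>e\<bar> \<le> s" for b c d e r s :: real
      using that unfolding distrib_left by linarith
    from this[OF eq 1 2 3] show ?thesis .
  qed
  then show ?thesis
    using m(2)[OF x] by linarith
qed

lemma shooting_solution_unperturbed: "shooting_solution (\<lambda>_. 0) 0 u"
  by (simp add: shooting_solution_def volterra_def continuous_u)

text \<open>
  Convergence of the weights in \<open>L\<^sup>1\<close> and of the functions in the sup norm: every limit in the
  asymptotic analysis is an instance of this lemma.
\<close>
lemma uniform_limit_weighted_integral:
  assumes P: "\<forall>\<^sub>F n in F. P n absolutely_integrable_on {-a..a}" "Q absolutely_integrable_on {-a..a}"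
    and PQ: "((\<lambda>n. L1 (\<lambda>x. P n x - Q x)) \<longlongrightarrow> 0) F"
    and f: "\<forall>\<^sub>F n in F. continuous_on {-a..a} (f n)" "continuous_on {-a..a} g"
    and fg: "uniform_limit {-a..a} f g F"
  shows "uniform_limit {-a..a} (\<lambda>n x. integral {-a..x} (\<lambda>t. P n t * f n t)) (\<lambda>x. integral {-a..x} (\<lambda>t. Q t * g t)) F"
proof (rule uniform_limitI)
  fix e :: real assume e: "e > 0"
  obtain B where B: "\<And>x. x \<in> {-a..a} \<Longrightarrow> \<bar>g x\<bar> \<le> B"
    using continuous_on_interval_bound[OF f(2)] by blast
  have B0: "0 \<le> B"
    using B[of a] a_pos abs_ge_zero[of "g a"] by force
  have Q0: "0 \<le> L1 Q" by (rule L1_nonneg[OF P(2)])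
  define d where "d = e / (2 * (L1 Q + 1))"
  have d: "d > 0" "d * L1 Q < e / 2"
    using e Q0 by (auto simp: d_def field_simps)
  have "\<forall>\<^sub>F n in F. \<forall>x\<in>{-a..a}. dist (f n x) (g x) < min d 1"
    using uniform_limitD[OF fg, of "min d 1"] d(1) by linarith
  moreover have "\<forall>\<^sub>F n in F. L1 (\<lambda>x. P n x - Q x) < e / (2 * (B + 1))"
    using order_tendstoD(2)[OF PQ] e B0 by simp
  ultimately show "\<forall>\<^sub>F n in F. \<forall>x\<in>{-a..a}. dist (integral {-a..x} (\<lambda>t. P n t * f n t)) (integral {-a..x} (\<lambda>t. Q t * g t)) < e"
    using P(1) f(1)
  proof eventually_elim
    case (elim n)
    show ?case
    proof
      fix x assume x: "x \<in> {-a..a}"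
      have PQi: "(\<lambda>t. P n t - Q t) absolutely_integrable_on {-a..a}"
        by (intro set_integral_diff(1) elim P(2))
      have fgc: "continuous_on {-a..a} (\<lambda>t. f n t - g t)"
        by (intro continuous_intros elim f(2))
      have i: "(\<lambda>t. (P n t - Q t) * f n t) integrable_on {-a..x}" "(\<lambda>t. Q t * (f n t - g t)) integrable_on {-a..x}"
        "(\<lambda>t. P n t * f n t) integrable_on {-a..x}" "(\<lambda>t. Q t * g t) integrable_on {-a..x}"
        using x by (auto intro!: weighted_integrable(2) PQi P(2) fgc elim f(2))
      have "integral {-a..x} (\<lambda>t. P n t * f n t) - integral {-a..x} (\<lambda>t. Q t * g t) =
          integral {-a..x} (\<lambda>t. (P n t - Q t) * f n t) + integral {-a..x} (\<lambda>t. Q t * (f n t - g t))"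
        using i by (simp flip: integral_add integral_diff add: algebra_simps)
      moreover have "\<bar>integral {-a..x} (\<lambda>t. (P n t - Q t) * f n t)\<bar> \<le> (B + 1) * L1 (\<lambda>t. P n t - Q t)"
      proof (rule weighted_integral_bound[OF PQi _ _ x])
        fix t assume "t \<in> {-a..a}"
        then have "\<bar>f n t - g t\<bar> < 1" "\<bar>g t\<bar> \<le> B" using elim(1) B by (auto simp: dist_real_def)
        then show "\<bar>f n t\<bar> \<le> B + 1" by linarith
      qed (rule elim)
      moreover have "\<bar>integral {-a..x} (\<lambda>t. Q t * (f n t - g t))\<bar> \<le> d * L1 Q"
        by (rule weighted_integral_bound[OF P(2) fgc _ x])
          (use elim(1) in \<open>auto simp: dist_real_def less_imp_le\<close>)
      moreover have "(B + 1) * L1 (\<lambda>t. P n t - Q t) < e / 2"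
        using elim(2) B0 by (simp add: field_simps)
      ultimately show "dist (integral {-a..x} (\<lambda>t. P n t * f n t)) (integral {-a..x} (\<lambda>t. Q t * g t)) < e"
        using d(2) by (simp add: dist_real_def)
    qed
  qed
qed

lemma uniform_limit_mult_fixed:
  fixes v :: "real \<Rightarrow> real"
  assumes v: "\<And>x. x \<in> {-a..a} \<Longrightarrow> \<bar>v x\<bar> \<le> M" and f: "uniform_limit {-a..a} f g F"
  shows "uniform_limit {-a..a} (\<lambda>n x. v x * f n x) (\<lambda>x. v x * g x) F"
proof (rule uniform_limitI)
  fix e :: real assume "e > 0"
  then have "\<forall>\<^sub>F n in F. \<forall>x\<in>{-a..a}. dist (f n x) (g x) < e / M"
    using uniform_limitD[OF f] M_ge_1 by simp
  then show "\<forall>\<^sub>F n in F. \<forall>x\<in>{-a..a}. dist (v x * f n x) (v x * g x) < e"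
  proof eventually_elim
    case (elim n)
    show ?case
    proof
      fix x assume x: "x \<in> {-a..a}"
      have "dist (v x * f n x) (v x * g x) = \<bar>v x\<bar> * dist (f n x) (g x)"
        by (simp add: dist_real_def abs_mult flip: right_diff_distrib)
      also have "\<dots> \<le> M * dist (f n x) (g x)"
        using v[OF x] by (intro mult_right_mono) auto
      also have "\<dots> < e"
        using elim x M_ge_1 by (simp add: field_simps)
      finally show "dist (v x * f n x) (v x * g x) < e" .
    qed
  qed
qed

lemma uniform_limit_weighted_product:
  assumes P: "\<forall>\<^sub>F n in F. P n absolutely_integrable_on {-a..a}" "Q absolutely_integrable_on {-a..a}"
    and PQ: "((\<lambda>n. L1 (\<lambda>x. P n x - Q x)) \<longlongrightarrow> 0) F"
    and f: "\<forall>\<^sub>F n in F. continuous_on {-a..a} (f n)" "continuous_on {-a..a} g"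
    and fg: "uniform_limit {-a..a} f g F"
    and v: "continuous_on {-a..a} v" "\<And>x. x \<in> {-a..a} \<Longrightarrow> \<bar>v x\<bar> \<le> M"
  shows "uniform_limit {-a..a} (\<lambda>n x. integral {-a..x} (\<lambda>t. P n t * (v t * f n t))) (\<lambda>x. integral {-a..x} (\<lambda>t. Q t * (v t * g t))) F"
proof (rule uniform_limit_weighted_integral[OF P PQ _ _ uniform_limit_mult_fixed[OF v(2) fg]])
  show "\<forall>\<^sub>F n in F. continuous_on {-a..a} (\<lambda>x. v x * f n x)"
    using f(1) by eventually_elim (intro continuous_intros v)
  show "continuous_on {-a..a} (\<lambda>x. v x * g x)"
    by (intro continuous_intros v f)
qed auto

lemma tendsto_weighted_integral:
  assumes P: "\<forall>\<^sub>F n in F. P n absolutely_integrable_on {-a..a}" "Q absolutely_integrable_on {-a..a}"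
    and PQ: "((\<lambda>n. L1 (\<lambda>x. P n x - Q x)) \<longlongrightarrow> 0) F"
    and f: "\<forall>\<^sub>F n in F. continuous_on {-a..a} (f n)" "continuous_on {-a..a} g"
    and fg: "uniform_limit {-a..a} f g F"
    and v: "continuous_on {-a..a} v" "\<And>x. x \<in> {-a..a} \<Longrightarrow> \<bar>v x\<bar> \<le> M"
  shows "((\<lambda>n. integral {-a..a} (\<lambda>t. P n t * (v t * f n t))) \<longlongrightarrow> integral {-a..a} (\<lambda>t. Q t * (v t * g t))) F"
  using tendsto_uniform_limitI[OF uniform_limit_weighted_product[OF assms], of a] a_pos by simp

lemma uniform_limit_volterra:
  assumes P: "\<forall>\<^sub>F n in F. P n absolutely_integrable_on {-a..a}" "Q absolutely_integrable_on {-a..a}"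
    and PQ: "((\<lambda>n. L1 (\<lambda>x. P n x - Q x)) \<longlongrightarrow> 0) F"
    and f: "\<forall>\<^sub>F n in F. continuous_on {-a..a} (f n)" "continuous_on {-a..a} g"
    and fg: "uniform_limit {-a..a} f g F"
  shows "uniform_limit {-a..a} (\<lambda>n. volterra (P n) (f n)) (volterra Q g) F"
  unfolding volterra_def[abs_def]
  by (intro uniform_limit_minus uniform_limit_mult_fixed bound
      uniform_limit_weighted_product[OF P PQ f fg] continuous_u)

text \<open>
  Shooting solutions for different \<open>k\<close> are chosen independently of each other; continuity in \<open>k\<close>
  comes from \<open>shooting_perturbation\<close>, which applies to any such choice.
\<close>
lemma matching_continuous:
  assumes W: "W absolutely_integrable_on {-a..a}" and small: "4 * M\<^sup>2 * (L1 W + 2 * a * K\<^sup>2) \<le> 1"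
    and g: "\<And>k. k \<in> {0..K} \<Longrightarrow> shooting_solution (\<lambda>x. W x + k\<^sup>2) k (g k)"
  shows "continuous_on {0..K} (\<lambda>k. matching (\<lambda>x. W x + k\<^sup>2) k (g k))"
  unfolding continuous_on_def
proof
  fix k0 assume k0: "k0 \<in> {0..K}"
  let ?F = "at k0 within {0..K}"
  have Wk: "(\<lambda>x. W x + k\<^sup>2) absolutely_integrable_on {-a..a}" for k
    by (intro set_integral_add(1) W const_integrable)
  have gc: "continuous_on {-a..a} (g k)" if "k \<in> {0..K}" for k
    using g[OF that] by (simp add: shooting_solution_def)
  have ev: "\<forall>\<^sub>F k in ?F. k \<in> {0..K}"
    by (simp add: eventually_at_filter)
  have sm: "4 * M\<^sup>2 * L1 (\<lambda>x. W x + k\<^sup>2) \<le> 1" if k: "k \<in> {0..K}" for k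
  proof -
    have "L1 (\<lambda>x. W x + k\<^sup>2) \<le> L1 W + 2 * a * k\<^sup>2"
      using L1_add[OF W const_integrable[of "k\<^sup>2"]] by (simp add: L1_const)
    also have "\<dots> \<le> L1 W + 2 * a * K\<^sup>2"
      using k a_pos by (intro add_left_mono mult_left_mono power_mono) auto
    finally have "4 * M\<^sup>2 * L1 (\<lambda>x. W x + k\<^sup>2) \<le> 4 * M\<^sup>2 * (L1 W + 2 * a * K\<^sup>2)"
      by (intro mult_left_mono) auto
    with small show ?thesis by linarith
  qed
  obtain B where B: "\<And>x. x \<in> {-a..a} \<Longrightarrow> \<bar>g k0 x\<bar> \<le> B"
    using continuous_on_interval_bound[OF gc[OF k0]] by blast
  have L1_diff: "L1 (\<lambda>x. (W x + k\<^sup>2) - (W x + k0\<^sup>2)) = 2 * a * \<bar>k\<^sup>2 - k0\<^sup>2\<bar>" for k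
    by (simp add: L1_const)
  have k_lim: "((\<lambda>k. k) \<longlongrightarrow> k0) ?F"
    by (rule tendsto_ident_at)
  have ul: "uniform_limit {-a..a} g (g k0) ?F"
  proof (rule uniform_limit_dominated)
    show "\<forall>\<^sub>F k in ?F. \<forall>x\<in>{-a..a}. \<bar>g k x - g k0 x\<bar> \<le>
        2 * (\<bar>k - k0\<bar> * (M * (1 + a)) + 2 * M\<^sup>2 * (2 * a * \<bar>k\<^sup>2 - k0\<^sup>2\<bar>) * B)"
      using ev
    proof eventually_elim
      case (elim k)
      show ?case
        using shooting_perturbation[OF g[OF elim] g[OF k0] Wk Wk sm[OF elim] B]
        unfolding L1_diff by blast
    qed
    have "((\<lambda>k. 2 * (\<bar>k - k0\<bar> * (M * (1 + a)) + 2 * M\<^sup>2 * (2 * a * \<bar>k\<^sup>2 - k0\<^sup>2\<bar>) * B)) \<longlongrightarrow>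
        2 * (\<bar>k0 - k0\<bar> * (M * (1 + a)) + 2 * M\<^sup>2 * (2 * a * \<bar>k0\<^sup>2 - k0\<^sup>2\<bar>) * B)) ?F"
      by (intro tendsto_intros k_lim)
    then show "((\<lambda>k. 2 * (\<bar>k - k0\<bar> * (M * (1 + a)) + 2 * M\<^sup>2 * (2 * a * \<bar>k\<^sup>2 - k0\<^sup>2\<bar>) * B)) \<longlongrightarrow> 0) ?F"
      by simp
  qed
  have L1_lim: "((\<lambda>k. L1 (\<lambda>x. (W x + k\<^sup>2) - (W x + k0\<^sup>2))) \<longlongrightarrow> 0) ?F"
  proof -
    have "((\<lambda>k. 2 * a * \<bar>k\<^sup>2 - k0\<^sup>2\<bar>) \<longlongrightarrow> 2 * a * \<bar>k0\<^sup>2 - k0\<^sup>2\<bar>) ?F"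
      by (intro tendsto_intros k_lim)
    then show ?thesis unfolding L1_diff by simp
  qed
  have evc: "\<forall>\<^sub>F k in ?F. continuous_on {-a..a} (g k)"
    using ev by eventually_elim (rule gc)
  have int: "((\<lambda>k. integral {-a..a} (\<lambda>t. (W t + k\<^sup>2) * (v t * g k t))) \<longlongrightarrow>
      integral {-a..a} (\<lambda>t. (W t + k0\<^sup>2) * (v t * g k0 t))) ?F"
    if "continuous_on {-a..a} v" "\<And>x. x \<in> {-a..a} \<Longrightarrow> \<bar>v x\<bar> \<le> M" for v
    by (rule tendsto_weighted_integral[OF _ Wk L1_lim evc gc[OF k0] ul that]) (simp add: Wk)
  show "((\<lambda>k. matching (\<lambda>x. W x + k\<^sup>2) k (g k)) \<longlongrightarrow> matching (\<lambda>x. W x + k0\<^sup>2) k0 (g k0)) ?F"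
    unfolding matching_def by (intro tendsto_intros k_lim int continuous_u bound)
qed

end

section \<open>Asymptotics of the matching condition\<close>

text \<open>
  The coupling constant is written \<open>l\<close>, and \<open>k\<close> is a function of it wherever limits are taken.
\<close>
locale perturbed_resonance = resonance +
  fixes V V1 :: "real \<Rightarrow> real" and Vl :: "real \<Rightarrow> real \<Rightarrow> real"
  assumes V: "V absolutely_integrable_on {-a..a}" and V1: "V1 absolutely_integrable_on {-a..a}"
    and Vl: "\<And>l. l > 0 \<Longrightarrow> Vl l absolutely_integrable_on {-a..a}"
    and remainder: "((\<lambda>l. L1 (\<lambda>x. Vl l x - V x - l * V1 x) / l) \<longlongrightarrow> 0) (at_right 0)"
begin

text \<open>
  The eigenvalue equation for \<open>- k\<^sup>2\<close> reads \<open>f'' = (U + pert k l) f\<close>.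
\<close>
definition pert :: "real \<Rightarrow> real \<Rightarrow> real \<Rightarrow> real" where
  "pert k l = (\<lambda>x. l * Vl l x + k\<^sup>2)"

lemma pert_integrable: "l > 0 \<Longrightarrow> pert k l absolutely_integrable_on {-a..a}"
  unfolding pert_def using Vl[of l] by (intro set_integral_add(1) const_integrable) auto

lemma remainder_integrable: "l > 0 \<Longrightarrow> (\<lambda>x. Vl l x - V x - l * V1 x) absolutely_integrable_on {-a..a}"
  using Vl[of l] V V1 by (intro set_integral_diff(1)) auto

lemma eventually_pos: "\<forall>\<^sub>F l in at_right (0::real). l > 0"
  by (simp add: eventually_at_right_less)

lemma tendsto_id_0: "((\<lambda>l::real. l) \<longlongrightarrow> 0) (at_right 0)"
  by (rule tendsto_ident_at)

lemma Vl_tendsto: "((\<lambda>l. L1 (\<lambda>x. Vl l x - V x)) \<longlongrightarrow> 0) (at_right 0)"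
proof (rule Lim_null_comparison)
  show "\<forall>\<^sub>F l in at_right 0. norm (L1 (\<lambda>x. Vl l x - V x)) \<le>
      L1 (\<lambda>x. Vl l x - V x - l * V1 x) / l * l + \<bar>l\<bar> * L1 V1"
    using eventually_pos
  proof eventually_elim
    case (elim l)
    have "L1 (\<lambda>x. (Vl l x - V x - l * V1 x) + l * V1 x) \<le> L1 (\<lambda>x. Vl l x - V x - l * V1 x) + L1 (\<lambda>x. l * V1 x)"
      by (intro L1_add remainder_integrable elim) (use V1 in auto)
    moreover have "0 \<le> L1 (\<lambda>x. Vl l x - V x)"
      using Vl[OF elim] V by (intro L1_nonneg set_integral_diff(1))
    ultimately show ?case
      using elim by (simp add: L1_cmult)
  qed
  have "((\<lambda>l. L1 (\<lambda>x. Vl l x - V x - l * V1 x) / l * l + \<bar>l\<bar> * L1 V1) \<longlongrightarrow> 0 * 0 + \<bar>0\<bar> * L1 V1) (at_right 0)"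
    by (intro tendsto_intros remainder tendsto_id_0)
  then show "((\<lambda>l. L1 (\<lambda>x. Vl l x - V x - l * V1 x) / l * l + \<bar>l\<bar> * L1 V1) \<longlongrightarrow> 0) (at_right 0)"
    by simp
qed

lemma pert_tendsto_0:
  assumes k: "(k \<longlongrightarrow> 0) (at_right 0)"
  shows "((\<lambda>l. L1 (pert (k l) l)) \<longlongrightarrow> 0) (at_right 0)"
    and "((\<lambda>l. L1 (\<lambda>x. l * Vl l x) + 2 * a * (k l)\<^sup>2) \<longlongrightarrow> 0) (at_right 0)"
proof -
  have le: "\<forall>\<^sub>F l in at_right 0. 0 \<le> L1 (pert (k l) l)
      \<and> L1 (pert (k l) l) \<le> L1 (\<lambda>x. l * Vl l x) + 2 * a * (k l)\<^sup>2
      \<and> L1 (\<lambda>x. l * Vl l x) + 2 * a * (k l)\<^sup>2 \<le> \<bar>l\<bar> * (L1 (\<lambda>x. Vl l x - V x) + L1 V) + 2 * a * (k l)\<^sup>2"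
    using eventually_pos
  proof eventually_elim
    case (elim l)
    have "0 \<le> L1 (pert (k l) l)"
      by (intro L1_nonneg pert_integrable elim)
    moreover have "L1 (pert (k l) l) \<le> L1 (\<lambda>x. l * Vl l x) + L1 (\<lambda>x. (k l)\<^sup>2)"
      unfolding pert_def by (intro L1_add const_integrable) (use Vl[OF elim] in auto)
    moreover have "L1 (\<lambda>x. (Vl l x - V x) + V x) \<le> L1 (\<lambda>x. Vl l x - V x) + L1 V"
      using Vl[OF elim] V by (intro L1_add set_integral_diff(1))
    then have "\<bar>l\<bar> * L1 (Vl l) \<le> \<bar>l\<bar> * (L1 (\<lambda>x. Vl l x - V x) + L1 V)"
      by (intro mult_left_mono) auto
    ultimately show ?case
      by (simp add: L1_const L1_cmult)
  qed
  have "((\<lambda>l. \<bar>l\<bar> * (L1 (\<lambda>x. Vl l x - V x) + L1 V) + 2 * a * (k l)\<^sup>2) \<longlongrightarrow> \<bar>0\<bar> * (0 + L1 V) + 2 * a * 0\<^sup>2) (at_right 0)"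
    by (intro tendsto_intros tendsto_id_0 Vl_tendsto k)
  then have lim: "((\<lambda>l. \<bar>l\<bar> * (L1 (\<lambda>x. Vl l x - V x) + L1 V) + 2 * a * (k l)\<^sup>2) \<longlongrightarrow> 0) (at_right 0)"
    by simp
  show "((\<lambda>l. L1 (pert (k l) l)) \<longlongrightarrow> 0) (at_right 0)"
    by (rule Lim_null_comparison[OF _ lim]) (use le in eventually_elim, simp)
  show "((\<lambda>l. L1 (\<lambda>x. l * Vl l x) + 2 * a * (k l)\<^sup>2) \<longlongrightarrow> 0) (at_right 0)"
    by (rule Lim_null_comparison[OF _ lim]) (use le in eventually_elim, simp)
qed

lemma eventually_small:
  assumes k: "(k \<longlongrightarrow> 0) (at_right 0)"
  shows "\<forall>\<^sub>F l in at_right 0. 4 * M\<^sup>2 * L1 (pert (k l) l) \<le> 1"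
    and "\<forall>\<^sub>F l in at_right 0. 4 * M\<^sup>2 * (L1 (\<lambda>x. l * Vl l x) + 2 * a * (k l)\<^sup>2) \<le> 1"
proof -
  have "\<forall>\<^sub>F l in at_right 0. 4 * M\<^sup>2 * h l \<le> 1" if h: "(h \<longlongrightarrow> 0) (at_right 0)" for h :: "real \<Rightarrow> real"
  proof -
    have "((\<lambda>l. 4 * M\<^sup>2 * h l) \<longlongrightarrow> 4 * M\<^sup>2 * 0) (at_right 0)"
      by (intro tendsto_intros h)
    then have "\<forall>\<^sub>F l in at_right 0. 4 * M\<^sup>2 * h l < 1"
      by (rule order_tendstoD) simp
    then show ?thesis by eventually_elim simp
  qed
  then show "\<forall>\<^sub>F l in at_right 0. 4 * M\<^sup>2 * L1 (pert (k l) l) \<le> 1"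
    and "\<forall>\<^sub>F l in at_right 0. 4 * M\<^sup>2 * (L1 (\<lambda>x. l * Vl l x) + 2 * a * (k l)\<^sup>2) \<le> 1"
    using pert_tendsto_0[OF k] by blast+
qed

lemma shooting_uniform_limit:
  assumes k: "(k \<longlongrightarrow> 0) (at_right 0)"
    and f: "\<forall>\<^sub>F l in at_right 0. shooting_solution (pert (k l) l) (k l) (f l)"
  shows "uniform_limit {-a..a} f u (at_right 0)"
proof (rule uniform_limit_dominated)
  show "\<forall>\<^sub>F l in at_right 0. \<forall>x\<in>{-a..a}. \<bar>f l x - u x\<bar> \<le>
      2 * (\<bar>k l - 0\<bar> * (M * (1 + a)) + 2 * M\<^sup>2 * L1 (pert (k l) l) * M)"
    using f eventually_small(1)[OF k] eventually_pos
  proof eventually_elim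
    case (elim l)
    have z: "(\<lambda>_. 0 :: real) absolutely_integrable_on {-a..a}"
      by (rule const_integrable)
    show ?case
      using shooting_perturbation[OF elim(1) shooting_solution_unperturbed pert_integrable[OF elim(3)] z elim(2) bound(1)]
      by simp
  qed
  have "((\<lambda>l. 2 * (\<bar>k l - 0\<bar> * (M * (1 + a)) + 2 * M\<^sup>2 * L1 (pert (k l) l) * M)) \<longlongrightarrow>
      2 * (\<bar>0 - 0\<bar> * (M * (1 + a)) + 2 * M\<^sup>2 * 0 * M)) (at_right 0)"
    by (intro tendsto_intros k pert_tendsto_0)
  then show "((\<lambda>l. 2 * (\<bar>k l - 0\<bar> * (M * (1 + a)) + 2 * M\<^sup>2 * L1 (pert (k l) l) * M)) \<longlongrightarrow> 0) (at_right 0)"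
    by simp
qed

lemma shooting_continuous:
  assumes f: "\<forall>\<^sub>F l in at_right 0. shooting_solution (pert (k l) l) (k l) (f l)"
  shows "\<forall>\<^sub>F l in at_right 0. continuous_on {-a..a} (f l)"
  using f by eventually_elim (simp add: shooting_solution_def)

text \<open>
  The matrix element \<open>\<integral> V v u\<close>; the first-order coefficient is \<open>J u\<close>.
\<close>
definition J :: "(real \<Rightarrow> real) \<Rightarrow> real" where
  "J v = integral {-a..a} (\<lambda>t. V t * (v t * u t))"

lemma tendsto_0_of_ratio:
  assumes "((\<lambda>l. k l / l) \<longlongrightarrow> \<kappa>) (at_right 0)"
  shows "(k \<longlongrightarrow> 0) (at_right (0::real))"
proof -
  have "((\<lambda>l. k l / l * l) \<longlongrightarrow> \<kappa> * 0) (at_right 0)"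
    by (intro tendsto_intros assms tendsto_id_0)
  then have "((\<lambda>l. k l / l * l) \<longlongrightarrow> 0) (at_right 0)"
    by simp
  then show ?thesis
    by (rule Lim_transform_eventually) (use eventually_pos in eventually_elim, simp)
qed

text \<open>
  For \<open>k\<close> proportional to \<open>l\<close> in the limit, \<open>pert (k l) l / l\<close> tends to \<open>V\<close> in \<open>L\<^sup>1\<close>, since \<open>k\<^sup>2 = o(l)\<close>.
\<close>
lemma matching_ratio:
  assumes \<kappa>: "((\<lambda>l. k l / l) \<longlongrightarrow> \<kappa>) (at_right 0)"
    and f: "\<forall>\<^sub>F l in at_right 0. shooting_solution (pert (k l) l) (k l) (f l)"
  shows "((\<lambda>l. L1 (\<lambda>x. pert (k l) l x / l - V x)) \<longlongrightarrow> 0) (at_right 0)"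
    and "\<And>v. continuous_on {-a..a} v \<Longrightarrow> (\<And>x. x \<in> {-a..a} \<Longrightarrow> \<bar>v x\<bar> \<le> M) \<Longrightarrow>
      ((\<lambda>l. integral {-a..a} (\<lambda>t. pert (k l) l t * (v t * f l t)) / l) \<longlongrightarrow> J v) (at_right 0)"
    and "((\<lambda>l. matching (pert (k l) l) (k l) (f l) / l) \<longlongrightarrow> \<kappa> * (1 + \<theta>\<^sup>2) + J u) (at_right 0)"
proof -
  have k: "(k \<longlongrightarrow> 0) (at_right 0)"
    by (rule tendsto_0_of_ratio[OF \<kappa>])
  show L: "((\<lambda>l. L1 (\<lambda>x. pert (k l) l x / l - V x)) \<longlongrightarrow> 0) (at_right 0)"
  proof (rule Lim_null_comparison)
    show "\<forall>\<^sub>F l in at_right 0. norm (L1 (\<lambda>x. pert (k l) l x / l - V x)) \<le>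
        L1 (\<lambda>x. Vl l x - V x) + 2 * a * \<bar>k l / l * k l\<bar>"
      using eventually_pos
    proof eventually_elim
      case (elim l)
      have eq: "(\<lambda>x. pert (k l) l x / l - V x) = (\<lambda>x. (Vl l x - V x) + k l / l * k l)"
        using elim by (auto simp: pert_def fun_eq_iff field_simps power2_eq_square)
      have d: "(\<lambda>x. Vl l x - V x) absolutely_integrable_on {-a..a}"
        using Vl[OF elim] V by (rule set_integral_diff(1))
      have "0 \<le> L1 (\<lambda>x. (Vl l x - V x) + k l / l * k l)"
        by (intro L1_nonneg set_integral_add(1) d const_integrable)
      then show ?case
        unfolding eq using L1_add[OF d const_integrable[of "k l / l * k l"]] by (simp add: L1_const)
    qed
    have "((\<lambda>l. L1 (\<lambda>x. Vl l x - V x) + 2 * a * \<bar>k l / l * k l\<bar>) \<longlongrightarrow> 0 + 2 * a * \<bar>\<kappa> * 0\<bar>) (at_right 0)"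
      by (intro tendsto_intros Vl_tendsto \<kappa> k)
    then show "((\<lambda>l. L1 (\<lambda>x. Vl l x - V x) + 2 * a * \<bar>k l / l * k l\<bar>) \<longlongrightarrow> 0) (at_right 0)"
      by simp
  qed
  have pi: "\<forall>\<^sub>F l in at_right 0. (\<lambda>x. pert (k l) l x / l) absolutely_integrable_on {-a..a}"
    using eventually_pos by eventually_elim (use pert_integrable in auto)
  have I: "((\<lambda>l. integral {-a..a} (\<lambda>t. pert (k l) l t * (v t * f l t)) / l) \<longlongrightarrow> J v) (at_right 0)"
    if v: "continuous_on {-a..a} v" "\<And>x. x \<in> {-a..a} \<Longrightarrow> \<bar>v x\<bar> \<le> M" for v
    using tendsto_weighted_integral[OF pi V L shooting_continuous[OF f] continuous_u(1) shooting_uniform_limit[OF k f] v]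
    by (simp add: J_def flip: integral_divide)
  then show "\<And>v. continuous_on {-a..a} v \<Longrightarrow> (\<And>x. x \<in> {-a..a} \<Longrightarrow> \<bar>v x\<bar> \<le> M) \<Longrightarrow>
      ((\<lambda>l. integral {-a..a} (\<lambda>t. pert (k l) l t * (v t * f l t)) / l) \<longlongrightarrow> J v) (at_right 0)" .
  let ?Iu = "\<lambda>l. integral {-a..a} (\<lambda>t. pert (k l) l t * (u t * f l t)) / l"
  let ?I1 = "\<lambda>l. integral {-a..a} (\<lambda>t. pert (k l) l t * (u1 t * f l t)) / l"
  have "((\<lambda>l. (k l / l + ?Iu l) * (1 + k l * (a + \<theta> * \<theta>1)) + k l / l * \<theta>\<^sup>2 * (1 + k l * a - ?I1 l * l)) \<longlongrightarrow>
      (\<kappa> + J u) * (1 + 0 * (a + \<theta> * \<theta>1)) + \<kappa> * \<theta>\<^sup>2 * (1 + 0 * a - J u1 * 0)) (at_right 0)"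
    by (intro tendsto_intros \<kappa> k tendsto_id_0 I continuous_u bound)
  then have "((\<lambda>l. (k l / l + ?Iu l) * (1 + k l * (a + \<theta> * \<theta>1)) + k l / l * \<theta>\<^sup>2 * (1 + k l * a - ?I1 l * l)) \<longlongrightarrow>
      \<kappa> * (1 + \<theta>\<^sup>2) + J u) (at_right 0)"
    by (simp add: algebra_simps)
  then show "((\<lambda>l. matching (pert (k l) l) (k l) (f l) / l) \<longlongrightarrow> \<kappa> * (1 + \<theta>\<^sup>2) + J u) (at_right 0)"
  proof (rule Lim_transform_eventually)
    show "\<forall>\<^sub>F l in at_right 0. (k l / l + ?Iu l) * (1 + k l * (a + \<theta> * \<theta>1)) + k l / l * \<theta>\<^sup>2 * (1 + k l * a - ?I1 l * l)
        = matching (pert (k l) l) (k l) (f l) / l"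
      using eventually_pos by eventually_elim (simp add: matching_def add_divide_distrib[symmetric])
  qed
qed

text \<open>
  Here only \<open>k \<rightarrow> 0\<close> is known, not \<open>k = O(l)\<close>. But the contribution of \<open>k\<^sup>2\<close> to \<open>\<integral> p u f\<close> can be
  absorbed into the coefficient \<open>D\<close> of \<open>k\<close>, which turns the matching condition into
  \<open>k D = - l A (1 + k b)\<close> with \<open>D \<rightarrow> 1 + \<theta>\<^sup>2\<close> and \<open>A \<rightarrow> J u\<close>.
\<close>
lemma first_order:
  assumes k: "(k \<longlongrightarrow> 0) (at_right 0)"
    and f: "\<forall>\<^sub>F l in at_right 0. shooting_solution (pert (k l) l) (k l) (f l)"
    and match: "\<forall>\<^sub>F l in at_right 0. matching (pert (k l) l) (k l) (f l) = 0"
  shows "((\<lambda>l. k l / l) \<longlongrightarrow> - J u / (1 + \<theta>\<^sup>2)) (at_right 0)"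
proof -
  note fc = shooting_continuous[OF f] and fu = shooting_uniform_limit[OF k f]
  define A where "A l = integral {-a..a} (\<lambda>t. Vl l t * (u t * f l t))" for l
  define B where "B l = integral {-a..a} (\<lambda>t. 1 * (u t * f l t))" for l
  define I1 where "I1 l = integral {-a..a} (\<lambda>t. pert (k l) l t * (u1 t * f l t))" for l
  define b where "b = a + \<theta> * \<theta>1"
  have evVl: "\<forall>\<^sub>F l in at_right 0. Vl l absolutely_integrable_on {-a..a}"
    using eventually_pos by eventually_elim (rule Vl)
  have evp: "\<forall>\<^sub>F l in at_right 0. pert (k l) l absolutely_integrable_on {-a..a}"
    using eventually_pos by eventually_elim (rule pert_integrable)
  have A: "(A \<longlongrightarrow> J u) (at_right 0)"
    unfolding A_def[abs_def] J_def
    by (rule tendsto_weighted_integral[OF evVl V Vl_tendsto fc continuous_u(1) fu continuous_u(1) bound(1)])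
  have B: "(B \<longlongrightarrow> integral {-a..a} (\<lambda>t. 1 * (u t * u t))) (at_right 0)"
    unfolding B_def[abs_def]
    by (rule tendsto_weighted_integral[OF _ const_integrable _ fc continuous_u(1) fu continuous_u(1) bound(1)])
      (simp_all add: const_integrable L1_const)
  have "(I1 \<longlongrightarrow> integral {-a..a} (\<lambda>t. 0 * (u1 t * u t))) (at_right 0)"
    unfolding I1_def[abs_def]
    by (rule tendsto_weighted_integral[OF evp const_integrable _ fc continuous_u(1) fu continuous_u(2) bound(2)])
      (use pert_tendsto_0(1)[OF k] in simp_all)
  then have I1: "(I1 \<longlongrightarrow> 0) (at_right 0)"
    by simp
  define D where "D l = (1 + k l * B l) * (1 + k l * b) + \<theta>\<^sup>2 * (1 + k l * a - I1 l)" for l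
  have "(D \<longlongrightarrow> (1 + 0 * integral {-a..a} (\<lambda>t. 1 * (u t * u t))) * (1 + 0 * b) + \<theta>\<^sup>2 * (1 + 0 * a - 0)) (at_right 0)"
    unfolding D_def[abs_def] by (intro tendsto_intros k B I1)
  then have D: "(D \<longlongrightarrow> 1 + \<theta>\<^sup>2) (at_right 0)"
    by simp
  have "((\<lambda>l. - A l * (1 + k l * b) / D l) \<longlongrightarrow> - J u * (1 + 0 * b) / (1 + \<theta>\<^sup>2)) (at_right 0)"
    by (intro tendsto_intros A k D) (use pos\<theta> in simp)
  then have lim: "((\<lambda>l. - A l * (1 + k l * b) / D l) \<longlongrightarrow> - J u / (1 + \<theta>\<^sup>2)) (at_right 0)"
    by simp
  have "\<forall>\<^sub>F l in at_right 0. D l > 0"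
    using order_tendstoD(1)[OF D pos\<theta>] .
  then have "\<forall>\<^sub>F l in at_right 0. - A l * (1 + k l * b) / D l = k l / l"
    using match eventually_pos fc
  proof eventually_elim
    case (elim l)
    have "integral {-a..a} (\<lambda>t. pert (k l) l t * (u t * f l t)) = l * A l + (k l)\<^sup>2 * B l"
    proof -
      have uf: "continuous_on {-a..a} (\<lambda>t. u t * f l t)"
        by (intro continuous_intros continuous_u elim)
      have i: "(\<lambda>t. Vl l t * (u t * f l t)) integrable_on {-a..a}" "(\<lambda>t. 1 * (u t * f l t)) integrable_on {-a..a}"
        using weighted_integrable(2)[OF Vl[OF elim(3)] uf] weighted_integrable(2)[OF const_integrable[of 1] uf] by blast+
      have "integral {-a..a} (\<lambda>t. pert (k l) l t * (u t * f l t)) =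
          integral {-a..a} (\<lambda>t. l * (Vl l t * (u t * f l t)) + (k l)\<^sup>2 * (1 * (u t * f l t)))"
        by (rule integral_cong) (simp add: pert_def algebra_simps)
      also have "\<dots> = l * A l + (k l)\<^sup>2 * B l"
        unfolding A_def B_def using i by (subst integral_add) (auto intro!: integrable_on_mult_right)
      finally show ?thesis .
    qed
    then have "(k l + (l * A l + (k l)\<^sup>2 * B l)) * (1 + k l * b) + k l * \<theta>\<^sup>2 * (1 + k l * a - I1 l) = 0"
      using elim(2) by (simp add: matching_def b_def I1_def)
    then have "k l * D l = - (l * (A l * (1 + k l * b)))"
      by (simp add: D_def algebra_simps power2_eq_square)
    then show ?case
      using elim by (simp add: field_simps)
  qed
  with lim show ?thesis
    by (rule Lim_transform_eventually)
qed

text \<open>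
  The coefficient of \<open>l\<^sup>2\<close> in \<open>matching\<close> for \<open>k \<approx> \<kappa> l\<close>, apart from the contribution of
  \<open>k (1 + \<theta>\<^sup>2) + l J u\<close>.
\<close>
definition second_order_term :: "real \<Rightarrow> real" where
  "second_order_term \<kappa> =
     integral {-a..a} (\<lambda>t. (V1 t + \<kappa>\<^sup>2) * (u t * u t))
     + integral {-a..a} (\<lambda>t. V t * (u t * (\<kappa> * u1 t + a * \<kappa> * u t + volterra V u t)))
     + \<kappa> * (a + \<theta> * \<theta>1) * (\<kappa> + J u) + \<kappa>\<^sup>2 * \<theta>\<^sup>2 * a - \<kappa> * \<theta>\<^sup>2 * J u1"

text \<open>
  After subtracting the first-order terms, \<open>\<integral> p u f - l \<integral> V u\<^sup>2 = \<integral> (p - l V) u\<^sup>2 + \<integral> p u (f - u)\<close>,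
  and both parts can be divided by \<open>l\<^sup>2\<close>: \<open>q = (p - l V)/l\<^sup>2\<close> tends to \<open>V1 + \<kappa>\<^sup>2\<close> in \<open>L\<^sup>1\<close>, and the
  integral equation for \<open>f\<close> shows that \<open>h = (f - u)/l\<close> tends uniformly to
  \<open>\<kappa> (u1 + a u) + volterra V u\<close>.
\<close>
lemma second_order:
  assumes \<kappa>: "((\<lambda>l. k l / l) \<longlongrightarrow> \<kappa>) (at_right 0)"
    and f: "\<forall>\<^sub>F l in at_right 0. shooting_solution (pert (k l) l) (k l) (f l)"
    and match: "\<forall>\<^sub>F l in at_right 0. matching (pert (k l) l) (k l) (f l) = 0"
  shows "((\<lambda>l. (k l * (1 + \<theta>\<^sup>2) + l * J u) / l\<^sup>2) \<longlongrightarrow> - second_order_term \<kappa>) (at_right 0)"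
proof -
  have k: "(k \<longlongrightarrow> 0) (at_right 0)"
    by (rule tendsto_0_of_ratio[OF \<kappa>])
  note fc = shooting_continuous[OF f] and fu = shooting_uniform_limit[OF k f]
    and ratio = matching_ratio[OF \<kappa> f]
  define q where "q l x = (pert (k l) l x - l * V x) / l\<^sup>2" for l x
  define Q where "Q x = V1 x + \<kappa>\<^sup>2" for x
  define h where "h l x = (f l x - u x) / l" for l x
  define H where "H x = \<kappa> * u1 x + a * \<kappa> * u x + volterra V u x" for x
  have pi: "\<forall>\<^sub>F l in at_right 0. (\<lambda>x. pert (k l) l x / l) absolutely_integrable_on {-a..a}"
    using eventually_pos by eventually_elim (use pert_integrable in auto)
  have qi: "q l absolutely_integrable_on {-a..a}" if "l > 0" for l
    using pert_integrable[OF that, of "k l"] V unfolding q_def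
    by (intro set_integrable_divide set_integral_diff(1)) auto
  have Qi: "Q absolutely_integrable_on {-a..a}"
    unfolding Q_def by (intro set_integral_add(1) V1 const_integrable)
  have qQ: "((\<lambda>l. L1 (\<lambda>x. q l x - Q x)) \<longlongrightarrow> 0) (at_right 0)"
  proof (rule Lim_null_comparison)
    show "\<forall>\<^sub>F l in at_right 0. norm (L1 (\<lambda>x. q l x - Q x)) \<le>
        L1 (\<lambda>x. Vl l x - V x - l * V1 x) / l + 2 * a * \<bar>(k l / l)\<^sup>2 - \<kappa>\<^sup>2\<bar>"
      using eventually_pos
    proof eventually_elim
      case (elim l)
      have eq: "(\<lambda>x. q l x - Q x) = (\<lambda>x. (1 / l) * (Vl l x - V x - l * V1 x) + ((k l / l)\<^sup>2 - \<kappa>\<^sup>2))"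
        using elim by (auto simp: q_def Q_def pert_def fun_eq_iff field_simps power2_eq_square)
      have d: "(\<lambda>x. (1 / l) * (Vl l x - V x - l * V1 x)) absolutely_integrable_on {-a..a}"
        using remainder_integrable[OF elim] by auto
      have "0 \<le> L1 (\<lambda>x. q l x - Q x)"
        by (intro L1_nonneg set_integral_diff(1) qi elim Qi)
      then show ?case
        unfolding eq using L1_add[OF d const_integrable[of "(k l / l)\<^sup>2 - \<kappa>\<^sup>2"]] elim
          L1_cmult[of "1 / l" "\<lambda>x. Vl l x - V x - l * V1 x"]
        by (simp add: L1_const)
    qed
    have "((\<lambda>l. L1 (\<lambda>x. Vl l x - V x - l * V1 x) / l + 2 * a * \<bar>(k l / l)\<^sup>2 - \<kappa>\<^sup>2\<bar>) \<longlongrightarrow> 0 + 2 * a * \<bar>\<kappa>\<^sup>2 - \<kappa>\<^sup>2\<bar>) (at_right 0)"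
      by (intro tendsto_intros remainder \<kappa>)
    then show "((\<lambda>l. L1 (\<lambda>x. Vl l x - V x - l * V1 x) / l + 2 * a * \<bar>(k l / l)\<^sup>2 - \<kappa>\<^sup>2\<bar>) \<longlongrightarrow> 0) (at_right 0)"
      by simp
  qed
  have hc: "\<forall>\<^sub>F l in at_right 0. continuous_on {-a..a} (h l)"
    using fc eventually_pos by eventually_elim (auto simp: h_def[abs_def] intro!: continuous_intros continuous_u)
  have Hc: "continuous_on {-a..a} H"
    unfolding H_def[abs_def] by (intro continuous_intros continuous_u volterra_continuous V)
  have hH: "uniform_limit {-a..a} h H (at_right 0)"
  proof -
    have "uniform_limit {-a..a} (\<lambda>l x. u1 x * (k l / l) + u x * (a * (k l / l)) + volterra (\<lambda>x. pert (k l) l x / l) (f l) x)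
        (\<lambda>x. u1 x * \<kappa> + u x * (a * \<kappa>) + volterra V u x) (at_right 0)"
      by (intro uniform_limit_add uniform_limit_mult_fixed[OF bound(2) uniform_limit_constants[OF \<kappa>]]
          uniform_limit_mult_fixed[OF bound(1) uniform_limit_constants[OF tendsto_mult_left[OF \<kappa>]]]
          uniform_limit_volterra[OF pi V ratio(1) fc continuous_u(1) fu])
    moreover have "\<forall>\<^sub>F l in at_right 0. \<forall>x\<in>{-a..a}.
        u1 x * (k l / l) + u x * (a * (k l / l)) + volterra (\<lambda>x. pert (k l) l x / l) (f l) x = h l x"
      using f eventually_pos
    proof eventually_elim
      case (elim l)
      have "volterra (\<lambda>x. pert (k l) l x / l) (f l) x = volterra (pert (k l) l) (f l) x / l" for x
        by (simp add: volterra_def diff_divide_distrib)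
      then show ?case
        using elim by (auto simp: h_def shooting_solution_def add_divide_distrib distrib_left mult_ac)
    qed
    moreover have "u1 x * \<kappa> + u x * (a * \<kappa>) + volterra V u x = H x" for x
      by (simp add: H_def mult_ac)
    ultimately show ?thesis
      using uniform_limit_cong[where f = "\<lambda>l x. u1 x * (k l / l) + u x * (a * (k l / l)) + volterra (\<lambda>x. pert (k l) l x / l) (f l) x"
          and h = "\<lambda>x. u1 x * \<kappa> + u x * (a * \<kappa>) + volterra V u x" and g = h and i = H] by blast
  qed
  define Iu where "Iu l = integral {-a..a} (\<lambda>t. pert (k l) l t * (u t * f l t))" for l
  define I1 where "I1 l = integral {-a..a} (\<lambda>t. pert (k l) l t * (u1 t * f l t))" for l
  define X where "X l = integral {-a..a} (\<lambda>t. q l t * (u t * u t))" for l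
  define Y where "Y l = integral {-a..a} (\<lambda>t. pert (k l) l t / l * (u t * h l t))" for l
  define b where "b = a + \<theta> * \<theta>1"
  have X: "(X \<longlongrightarrow> integral {-a..a} (\<lambda>t. Q t * (u t * u t))) (at_right 0)"
    unfolding X_def[abs_def]
  proof (rule tendsto_weighted_integral[OF _ Qi qQ _ continuous_u(1) _ continuous_u(1) bound(1)])
    show "\<forall>\<^sub>F l in at_right 0. q l absolutely_integrable_on {-a..a}"
      using eventually_pos by eventually_elim (rule qi)
    show "uniform_limit {-a..a} (\<lambda>l. u) u (at_right 0)"
      by (rule uniform_limit_const)
  qed (auto simp: continuous_u)
  have Y: "(Y \<longlongrightarrow> integral {-a..a} (\<lambda>t. V t * (u t * H t))) (at_right 0)"
    unfolding Y_def[abs_def]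
    by (rule tendsto_weighted_integral[OF pi V ratio(1) hc Hc hH continuous_u(1) bound(1)])
  have Iu: "((\<lambda>l. Iu l / l) \<longlongrightarrow> J u) (at_right 0)" and I1: "((\<lambda>l. I1 l / l) \<longlongrightarrow> J u1) (at_right 0)"
    unfolding Iu_def I1_def
    using ratio(2)[OF continuous_u(1) bound(1)] ratio(2)[OF continuous_u(2) bound(2)] by blast+
  have "((\<lambda>l. - (X l + Y l + k l / l * b * (k l / l + Iu l / l) + (k l / l)\<^sup>2 * \<theta>\<^sup>2 * a - k l / l * \<theta>\<^sup>2 * (I1 l / l))) \<longlongrightarrow>
     - (integral {-a..a} (\<lambda>t. Q t * (u t * u t)) + integral {-a..a} (\<lambda>t. V t * (u t * H t))
        + \<kappa> * b * (\<kappa> + J u) + \<kappa>\<^sup>2 * \<theta>\<^sup>2 * a - \<kappa> * \<theta>\<^sup>2 * J u1)) (at_right 0)"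
    by (intro tendsto_intros X Y Iu I1 \<kappa>)
  moreover have "\<forall>\<^sub>F l in at_right 0. - (X l + Y l + k l / l * b * (k l / l + Iu l / l) + (k l / l)\<^sup>2 * \<theta>\<^sup>2 * a - k l / l * \<theta>\<^sup>2 * (I1 l / l))
      = (k l * (1 + \<theta>\<^sup>2) + l * J u) / l\<^sup>2"
    using match eventually_pos fc hc
  proof eventually_elim
    case (elim l)
    have XY: "X l + Y l = (Iu l - l * J u) / l\<^sup>2"
    proof -
      note p = pert_integrable[OF elim(2), of "k l"]
      have i: "(\<lambda>t. q l t * (u t * u t)) integrable_on {-a..a}"
        "(\<lambda>t. pert (k l) l t * (u t * h l t)) integrable_on {-a..a}"
        "(\<lambda>t. pert (k l) l t * (u t * f l t)) integrable_on {-a..a}"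
        "(\<lambda>t. V t * (u t * u t)) integrable_on {-a..a}"
        by (auto intro!: weighted_integrable(2) qi p V elim continuous_intros continuous_u)
      have i': "(\<lambda>t. pert (k l) l t / l * (u t * h l t)) integrable_on {-a..a}"
        using integrable_on_divide[OF i(2), of l] by simp
      have "X l + Y l = integral {-a..a} (\<lambda>t. q l t * (u t * u t) + pert (k l) l t / l * (u t * h l t))"
        unfolding X_def Y_def using i(1) i' by (rule integral_add[symmetric])
      also have "\<dots> = integral {-a..a} (\<lambda>t. (pert (k l) l t * (u t * f l t) - l * (V t * (u t * u t))) / l\<^sup>2)"
        by (rule integral_cong) (use elim(2) in \<open>simp add: q_def h_def field_simps power2_eq_square\<close>)
      also have "\<dots> = (Iu l - l * J u) / l\<^sup>2"
        unfolding Iu_def J_def using i(3,4) by (simp add: integral_diff integrable_on_mult_right)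
      finally show ?thesis .
    qed
    have "(k l + Iu l) * (1 + k l * b) + k l * \<theta>\<^sup>2 * (1 + k l * a - I1 l) = 0"
      using elim(1) by (simp add: matching_def b_def Iu_def I1_def)
    then have "k l * (1 + \<theta>\<^sup>2) + l * J u =
        - ((Iu l - l * J u) + k l * b * (k l + Iu l) + (k l)\<^sup>2 * \<theta>\<^sup>2 * a - k l * \<theta>\<^sup>2 * I1 l)"
      by (simp add: algebra_simps power2_eq_square)
    then have "(k l * (1 + \<theta>\<^sup>2) + l * J u) / l\<^sup>2 =
        - ((Iu l - l * J u) / l\<^sup>2 + k l * b * (k l + Iu l) / l\<^sup>2 + (k l)\<^sup>2 * \<theta>\<^sup>2 * a / l\<^sup>2 - k l * \<theta>\<^sup>2 * I1 l / l\<^sup>2)"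
      by (simp add: add_divide_distrib diff_divide_distrib)
    also have "k l * b * (k l + Iu l) / l\<^sup>2 = k l / l * b * (k l / l + Iu l / l)"
      by (simp add: power2_eq_square add_divide_distrib[symmetric])
    finally show ?case
      unfolding XY by (simp add: power2_eq_square)
  qed
  ultimately show ?thesis
    unfolding second_order_term_def Q_def H_def b_def by (rule Lim_transform_eventually)
qed

text \<open>
  With \<open>k = d l\<close> the quotient \<open>matching/l\<close> tends to \<open>d (1 + \<theta>\<^sup>2) + J u\<close>, which is negative for
  \<open>d = 0\<close> and equals one for \<open>d = c\<close>.
\<close>
lemma matching_zero_exists:
  assumes J: "J u < 0"
  obtains c where "c > 0"
    "\<forall>\<^sub>F l in at_right 0. \<exists>k f. 0 < k \<and> k \<le> c * l \<and> shooting_solution (pert k l) k f \<and> matching (pert k l) k f = 0"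
proof
  define c where "c = (1 - J u) / (1 + \<theta>\<^sup>2)"
  show c0: "c > 0"
    using J pos\<theta> by (simp add: c_def)
  define g where "g l k = (SOME f. shooting_solution (pert k l) k f)" for l k
  have g: "shooting_solution (pert k l) k (g l k)" if "l > 0" "4 * M\<^sup>2 * L1 (pert k l) \<le> 1" for k l
    unfolding g_def by (rule someI_ex[OF shooting_exists[OF pert_integrable[OF that(1)] that(2)]])
  have lim: "((\<lambda>l. matching (pert (d * l) l) (d * l) (g l (d * l)) / l) \<longlongrightarrow> d * (1 + \<theta>\<^sup>2) + J u) (at_right 0)" for d
  proof (rule matching_ratio(3)[of "\<lambda>l. d * l"])
    show r: "((\<lambda>l. d * l / l) \<longlongrightarrow> d) (at_right 0)"
      by (rule tendsto_eventually) (use eventually_pos in eventually_elim, simp)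
    show "\<forall>\<^sub>F l in at_right 0. shooting_solution (pert (d * l) l) (d * l) (g l (d * l))"
      using eventually_pos eventually_small(1)[OF tendsto_0_of_ratio[OF r]] by eventually_elim (rule g)
  qed
  have neg: "\<forall>\<^sub>F l in at_right 0. matching (pert (0 * l) l) (0 * l) (g l (0 * l)) / l < 0"
    by (rule order_tendstoD(2)[OF lim]) (use J in simp)
  have "c * (1 + \<theta>\<^sup>2) + J u = 1"
    using pos\<theta> by (simp add: c_def)
  then have posi: "\<forall>\<^sub>F l in at_right 0. matching (pert (c * l) l) (c * l) (g l (c * l)) / l > 0"
    by (intro order_tendstoD(1)[OF lim]) simp
  have "((\<lambda>l. c * l) \<longlongrightarrow> c * 0) (at_right 0)"
    by (intro tendsto_intros tendsto_id_0)
  then have "\<forall>\<^sub>F l in at_right 0. 4 * M\<^sup>2 * (L1 (\<lambda>x. l * Vl l x) + 2 * a * (c * l)\<^sup>2) \<le> 1"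
    by (intro eventually_small(2)) simp
  then show "\<forall>\<^sub>F l in at_right 0. \<exists>k f. 0 < k \<and> k \<le> c * l \<and> shooting_solution (pert k l) k f \<and> matching (pert k l) k f = 0"
    using neg posi eventually_pos
  proof eventually_elim
    case (elim l)
    have W: "(\<lambda>x. l * Vl l x) absolutely_integrable_on {-a..a}"
      using Vl[OF elim(4)] by auto
    have gk: "shooting_solution (pert k l) k (g l k)" if k: "k \<in> {0..c * l}" for k
    proof (rule g[OF elim(4)])
      have "L1 (pert k l) \<le> L1 (\<lambda>x. l * Vl l x) + 2 * a * k\<^sup>2"
        unfolding pert_def using L1_add[OF W const_integrable[of "k\<^sup>2"]] by (simp add: L1_const)
      also have "\<dots> \<le> L1 (\<lambda>x. l * Vl l x) + 2 * a * (c * l)\<^sup>2"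
        using k a_pos by (intro add_left_mono mult_left_mono power_mono) auto
      finally have "4 * M\<^sup>2 * L1 (pert k l) \<le> 4 * M\<^sup>2 * (L1 (\<lambda>x. l * Vl l x) + 2 * a * (c * l)\<^sup>2)"
        by (intro mult_left_mono) auto
      with elim(1) show "4 * M\<^sup>2 * L1 (pert k l) \<le> 1" by linarith
    qed
    have cont: "continuous_on {0..c * l} (\<lambda>k. matching (pert k l) k (g l k))"
      using matching_continuous[OF W elim(1), of "g l"] gk unfolding pert_def by blast
    obtain k where k: "0 \<le> k" "k \<le> c * l" "matching (pert k l) k (g l k) = 0"
      using IVT'[of "\<lambda>k. matching (pert k l) k (g l k)" 0 0 "c * l", OF _ _ _ cont] elim c0
      by (auto simp: divide_less_0_iff zero_less_divide_iff)
    have "k \<noteq> 0"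
      using elim(2,4) k(3) by auto
    then show ?case
      using k gk[of k] by (intro exI[of _ k] exI[of _ "g l k"]) auto
  qed
qed

text \<open>
  Rewrites the expressions over the interval \<open>[-a, a]\<close> as the integrals over the line that define
  \<open>omega0\<close> and \<open>omega1\<close>. Replacing \<open>\<integral> u\<^sup>2\<close> over \<open>[-a, a]\<close> by \<open>\<integral> (u\<^sup>2 - \<Theta>\<^sup>2)\<close> produces
  \<open>a (1 + \<theta>\<^sup>2)\<close>, which cancels the remaining terms containing \<open>a\<close>.
\<close>
lemma omega_identities:
  assumes meas: "V \<in> borel_measurable lebesgue" "V1 \<in> borel_measurable lebesgue"
    and zero: "AE x in lebesgue. a \<le> \<bar>x\<bar> \<longrightarrow> V x = 0" "AE x in lebesgue. a \<le> \<bar>x\<bar> \<longrightarrow> V1 x = 0"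
    and u_out: "\<And>x. x \<le> -a \<Longrightarrow> u x = 1" "\<And>x. a \<le> x \<Longrightarrow> u x = \<theta>"
    and vs: "continuous_on UNIV vs" "\<And>x. x \<in> {-a..a} \<Longrightarrow> vs x = volterra V u x"
    and \<kappa>: "\<kappa> = - omega0 V u \<theta>"
  shows "\<kappa> * (1 + \<theta>\<^sup>2) + J u = 0"
    and "second_order_term \<kappa> = (1 + \<theta>\<^sup>2) * omega1 V V1 u \<theta> u1 \<theta>1 vs"
proof -
  have cm: "g \<in> borel_measurable lebesgue" if "continuous_on UNIV g" for g :: "real \<Rightarrow> real"
    using borel_measurable_continuous_onI[OF that] by (simp add: measurable_completion)
  have LI: "(\<integral>x. W x * g x \<partial>lebesgue) = integral {-a..a} (\<lambda>x. W x * g x)"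
    if W: "W absolutely_integrable_on {-a..a}" "W \<in> borel_measurable lebesgue" "AE x in lebesgue. a \<le> \<bar>x\<bar> \<longrightarrow> W x = 0"
      and g: "continuous_on UNIV g" for W g :: "real \<Rightarrow> real"
  proof (rule lebesgue_integral_AE_zero_outside)
    show "(\<lambda>x. W x * g x) \<in> borel_measurable lebesgue"
      using W(2) cm[OF g] by measurable
    show "(\<lambda>x. W x * g x) absolutely_integrable_on {-a..a}"
      by (rule weighted_integrable(1)[OF W(1) continuous_on_subset[OF g]]) simp_all
    show "AE x in lebesgue. a \<le> \<bar>x\<bar> \<longrightarrow> W x * g x = 0"
      using W(3) by eventually_elim simp
  qed
  have int: "(\<lambda>x. W x * g x) integrable_on {-a..a}"
    if "W absolutely_integrable_on {-a..a}" "continuous_on UNIV g" for W g :: "real \<Rightarrow> real"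
    by (rule weighted_integrable(2)[OF that(1) continuous_on_subset[OF that(2)]]) simp_all
  have Ju: "(\<integral>x. V x * (u x)\<^sup>2 \<partial>lebesgue) = J u"
    using LI[OF V meas(1) zero(1), of "\<lambda>x. (u x)\<^sup>2"]
    by (simp add: J_def power2_eq_square continuous_intros continuous_u)
  define w where "w = omega0 V u \<theta>"
  have Jw: "J u = w * (1 + \<theta>\<^sup>2)"
    using pos\<theta> by (simp add: w_def omega0_def Ju add.commute)
  show "\<kappa> * (1 + \<theta>\<^sup>2) + J u = 0"
    by (simp add: \<kappa> Jw w_def algebra_simps)
  define Jv where "Jv = integral {-a..a} (\<lambda>t. V t * (u t * vs t))"
  define S where "S = integral {-a..a} (\<lambda>t. 1 * (u t * u t))"
  define T where "T = integral {-a..a} (\<lambda>t. V1 t * (u t * u t))"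
  have e1: "(\<integral>x. V x * (vs x + w * (\<theta>\<^sup>2 - 1) * u1 x) * u x \<partial>lebesgue) = Jv + w * (\<theta>\<^sup>2 - 1) * J u1"
  proof -
    have "(\<integral>x. V x * (vs x + w * (\<theta>\<^sup>2 - 1) * u1 x) * u x \<partial>lebesgue) =
        (\<integral>x. V x * ((vs x + w * (\<theta>\<^sup>2 - 1) * u1 x) * u x) \<partial>lebesgue)"
      by (simp add: mult.assoc)
    also have "\<dots> = integral {-a..a} (\<lambda>x. V x * ((vs x + w * (\<theta>\<^sup>2 - 1) * u1 x) * u x))"
      by (rule LI[OF V meas(1) zero(1)]) (intro continuous_intros vs continuous_u)
    also have "\<dots> = integral {-a..a} (\<lambda>x. V x * (u x * vs x) + w * (\<theta>\<^sup>2 - 1) * (V x * (u1 x * u x)))"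
      by (rule integral_cong) (simp add: algebra_simps)
    also have "\<dots> = Jv + w * (\<theta>\<^sup>2 - 1) * J u1"
      unfolding Jv_def J_def
      by (subst integral_add) (auto intro!: int V continuous_intros vs continuous_u integrable_on_mult_right)
    finally show ?thesis .
  qed
  have e2: "(\<integral>x. V1 x * (u x)\<^sup>2 \<partial>lebesgue) = T"
    using LI[OF V1 meas(2) zero(2), of "\<lambda>x. (u x)\<^sup>2"]
    by (simp add: T_def power2_eq_square continuous_intros continuous_u)
  have e3: "(\<integral>x. (u x)\<^sup>2 - (Theta_step \<theta> x)\<^sup>2 \<partial>lebesgue) = S - a * (1 + \<theta>\<^sup>2)"
  proof -
    have "ac_deriv (\<lambda>x. x :: real) (\<lambda>x. 1)"
      by (rule ac_deriv_C1) (auto intro!: derivative_eq_intros)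
    then have "ac_deriv (\<lambda>x. if x \<le> 0 then x else \<theta>\<^sup>2 * x) (\<lambda>x. if x \<le> 0 then 1 else \<theta>\<^sup>2 * 1)"
      by (intro ac_deriv_glue ac_deriv_cmult) simp_all
    moreover have "AE x in lebesgue. (if x \<le> 0 then 1 else \<theta>\<^sup>2 * 1) = (Theta_step \<theta> x)\<^sup>2"
      by (rule AE_lebesgue_negligibleI[of "{0}"]) (auto simp: Theta_step_def)
    ultimately have ac: "ac_deriv (\<lambda>x. if x \<le> 0 then x else \<theta>\<^sup>2 * x) (\<lambda>x. (Theta_step \<theta> x)\<^sup>2)"
      by (rule ac_deriv_negligible_change)
    have T: "integral {-a..a} (\<lambda>x. (Theta_step \<theta> x)\<^sup>2) = a * (1 + \<theta>\<^sup>2)"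
      using ac_deriv_integral[OF ac, of "-a" a] a_pos by (simp add: algebra_simps)
    have uu: "(\<lambda>x. (u x)\<^sup>2) absolutely_integrable_on {-a..a}"
      by (intro absolutely_integrable_continuous_real continuous_intros continuous_u)
    have d: "(\<lambda>x. (u x)\<^sup>2 - (Theta_step \<theta> x)\<^sup>2) absolutely_integrable_on {-a..a}"
      by (intro set_integral_diff(1) uu ac_deriv_abs_integrable[OF ac])
    have "(\<integral>x. (u x)\<^sup>2 - (Theta_step \<theta> x)\<^sup>2 \<partial>lebesgue) = integral {-a..a} (\<lambda>x. (u x)\<^sup>2 - (Theta_step \<theta> x)\<^sup>2)"
    proof (rule lebesgue_integral_eq_interval_integral(2)[OF d])
      fix x assume "x \<notin> {-a..a}"
      then consider "x \<le> -a" | "a \<le> x" by force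
      then show "(u x)\<^sup>2 - (Theta_step \<theta> x)\<^sup>2 = 0"
        using u_out a_pos by cases (auto simp: Theta_step_def)
    qed
    also have "\<dots> = integral {-a..a} (\<lambda>x. (u x)\<^sup>2) - integral {-a..a} (\<lambda>x. (Theta_step \<theta> x)\<^sup>2)"
      by (intro integral_diff set_lebesgue_integral_eq_integral(1)[OF uu] ac_deriv_integrable[OF ac])
    finally show ?thesis
      unfolding T by (simp add: S_def power2_eq_square)
  qed
  have om: "(1 + \<theta>\<^sup>2) * omega1 V V1 u \<theta> u1 \<theta>1 vs =
      (Jv + w * (\<theta>\<^sup>2 - 1) * J u1) + w\<^sup>2 * (S - a * (1 + \<theta>\<^sup>2)) - w\<^sup>2 * \<theta> ^ 3 * \<theta>1 + T"
    unfolding omega1_def w_def[symmetric] e1 e2 e3 using pos\<theta> by (simp add: add.commute)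
  have q1: "integral {-a..a} (\<lambda>t. (V1 t + \<kappa>\<^sup>2) * (u t * u t)) = T + \<kappa>\<^sup>2 * S"
  proof -
    have "integral {-a..a} (\<lambda>t. (V1 t + \<kappa>\<^sup>2) * (u t * u t)) =
        integral {-a..a} (\<lambda>t. V1 t * (u t * u t) + \<kappa>\<^sup>2 * (1 * (u t * u t)))"
      by (rule integral_cong) (simp add: algebra_simps)
    also have "\<dots> = T + \<kappa>\<^sup>2 * S"
    proof -
      have "(\<lambda>t. V1 t * (u t * u t)) integrable_on {-a..a}" "(\<lambda>t. 1 * (u t * u t)) integrable_on {-a..a}"
        by (intro int V1 const_integrable continuous_intros continuous_u)+
      then show ?thesis
        unfolding T_def S_def by (subst integral_add) (auto intro: integrable_on_mult_right)
    qed
    finally show ?thesis .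
  qed
  have q2: "integral {-a..a} (\<lambda>t. V t * (u t * (\<kappa> * u1 t + a * \<kappa> * u t + volterra V u t))) =
      \<kappa> * J u1 + a * \<kappa> * J u + Jv"
  proof -
    have "integral {-a..a} (\<lambda>t. V t * (u t * (\<kappa> * u1 t + a * \<kappa> * u t + volterra V u t))) =
        integral {-a..a} (\<lambda>t. (\<kappa> * (V t * (u1 t * u t)) + a * \<kappa> * (V t * (u t * u t))) + V t * (u t * vs t))"
      by (rule integral_cong) (simp add: vs(2) algebra_simps)
    also have "\<dots> = \<kappa> * J u1 + a * \<kappa> * J u + Jv"
      unfolding Jv_def J_def
      by (subst integral_add; (subst integral_add)?)
        (auto intro!: int V continuous_intros vs continuous_u integrable_on_mult_right integrable_add)
    finally show ?thesis .
  qed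
  have "\<kappa> = - w" by (simp add: \<kappa> w_def)
  then show "second_order_term \<kappa> = (1 + \<theta>\<^sup>2) * omega1 V V1 u \<theta> u1 \<theta>1 vs"
    unfolding second_order_term_def q1 q2 om Jw by (simp add: algebra_simps power2_eq_square power3_eq_cube)
qed

lemma threshold_eigenvalue_exists:
  assumes J: "J u < 0"
    and eig: "\<forall>\<^sub>F l in at_right 0. \<forall>k>0. \<forall>f. shooting_solution (pert k l) k f \<longrightarrow> matching (pert k l) k f = 0
      \<longrightarrow> is_eigenvalue (H l) (- k\<^sup>2)"
  shows "coupling_constant_threshold_zero H"
proof -
  obtain c where c: "c > 0" and ex: "\<forall>\<^sub>F l in at_right 0. \<exists>k f. 0 < k \<and> k \<le> c * l \<and>
      shooting_solution (pert k l) k f \<and> matching (pert k l) k f = 0"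
    using matching_zero_exists[OF J] .
  have ex': "\<forall>\<^sub>F l in at_right 0. \<exists>k. 0 < k \<and> k \<le> c * l \<and> is_eigenvalue (H l) (- k\<^sup>2)"
    using ex eig by eventually_elim blast
  define k where "k l = (SOME k. 0 < k \<and> k \<le> c * l \<and> is_eigenvalue (H l) (- k\<^sup>2))" for l
  have k: "\<forall>\<^sub>F l in at_right 0. 0 < k l \<and> k l \<le> c * l \<and> is_eigenvalue (H l) (- (k l)\<^sup>2)"
    using ex' unfolding k_def by eventually_elim (rule someI_ex)
  have "(k \<longlongrightarrow> 0) (at_right 0)"
  proof (rule Lim_null_comparison)
    show "\<forall>\<^sub>F l in at_right 0. norm (k l) \<le> c * l"
      using k by eventually_elim simp
    have "((\<lambda>l. c * l) \<longlongrightarrow> c * 0) (at_right 0)"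
      by (intro tendsto_intros tendsto_id_0)
    then show "((\<lambda>l. c * l) \<longlongrightarrow> 0) (at_right 0)"
      by simp
  qed
  then have "((\<lambda>l. - (k l)\<^sup>2) \<longlongrightarrow> - 0\<^sup>2) (at_right 0)"
    by (intro tendsto_intros)
  moreover have "\<forall>\<^sub>F l in at_right 0. - (k l)\<^sup>2 < 0 \<and> is_eigenvalue (H l) (- (k l)\<^sup>2)"
    using k by eventually_elim simp
  ultimately have "threshold_eigenvalue H (\<lambda>l. - (k l)\<^sup>2)"
    by (simp add: threshold_eigenvalue_def)
  then show ?thesis
    unfolding coupling_constant_threshold_zero_def by blast
qed

text \<open>
  With \<open>k = sqrt (- e)\<close> the expansion of \<open>e\<close> is that of \<open>k/l\<close>: since \<open>J u = w0 (1 + \<theta>\<^sup>2)\<close>, the limit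
  in \<open>second_order\<close> is the one of \<open>(k/l + w0) (1 + \<theta>\<^sup>2)/l\<close>. The sign of \<open>k/l\<close> is opposite to
  the one of \<open>w0\<close> and disappears in the square.
\<close>
lemma threshold_eigenvalue_asymptotics:
  assumes thr: "threshold_eigenvalue H e"
    and shoot: "\<forall>\<^sub>F l in at_right 0. \<forall>k>0. 4 * M\<^sup>2 * L1 (pert k l) \<le> 1 \<longrightarrow> is_eigenvalue (H l) (- k\<^sup>2)
      \<longrightarrow> (\<exists>f. shooting_solution (pert k l) k f \<and> matching (pert k l) k f = 0)"
    and \<kappa>: "- w0 * (1 + \<theta>\<^sup>2) + J u = 0"
    and w1: "second_order_term (- w0) = (1 + \<theta>\<^sup>2) * w1"
  shows "\<exists>r. r \<in> o[at_right 0](\<lambda>l. l) \<and> (\<forall>\<^sub>F l in at_right 0. e l = - l\<^sup>2 * (w0 + w1 * l + r l)\<^sup>2)"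
proof -
  define k where "k l = sqrt (- e l)" for l
  have ev: "\<forall>\<^sub>F l in at_right 0. 0 < k l \<and> e l = - (k l)\<^sup>2 \<and> is_eigenvalue (H l) (- (k l)\<^sup>2)"
  proof -
    have "\<forall>\<^sub>F l in at_right 0. e l < 0 \<and> is_eigenvalue (H l) (e l)"
      using thr by (simp add: threshold_eigenvalue_def)
    then show ?thesis
      by eventually_elim (simp add: k_def)
  qed
  have "((\<lambda>l. sqrt (- e l)) \<longlongrightarrow> sqrt (- 0)) (at_right 0)"
    by (intro tendsto_intros) (use thr in \<open>simp add: threshold_eigenvalue_def\<close>)
  then have k: "(k \<longlongrightarrow> 0) (at_right 0)"
    by (simp add: k_def[abs_def])
  define f where "f l = (SOME f. shooting_solution (pert (k l) l) (k l) f \<and> matching (pert (k l) l) (k l) f = 0)" for l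
  have "\<forall>\<^sub>F l in at_right 0. shooting_solution (pert (k l) l) (k l) (f l) \<and> matching (pert (k l) l) (k l) (f l) = 0"
    using ev shoot eventually_small(1)[OF k]
  proof eventually_elim
    case (elim l)
    then have "\<exists>f. shooting_solution (pert (k l) l) (k l) f \<and> matching (pert (k l) l) (k l) f = 0"
      by (elim conjE) (drule spec[of _ "k l"], simp)
    then show ?case
      unfolding f_def by (rule someI_ex)
  qed
  then have f: "\<forall>\<^sub>F l in at_right 0. shooting_solution (pert (k l) l) (k l) (f l)"
    and m: "\<forall>\<^sub>F l in at_right 0. matching (pert (k l) l) (k l) (f l) = 0"
    by (simp_all add: eventually_conj_iff)
  have "- J u / (1 + \<theta>\<^sup>2) = - w0"
    using \<kappa> pos\<theta> by (simp add: field_simps)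
  with first_order[OF k f m] have ratio: "((\<lambda>l. k l / l) \<longlongrightarrow> - w0) (at_right 0)"
    by simp
  from second_order[OF ratio f m]
  have lim: "((\<lambda>l. (k l * (1 + \<theta>\<^sup>2) + l * J u) / l\<^sup>2) \<longlongrightarrow> - ((1 + \<theta>\<^sup>2) * w1)) (at_right 0)"
    unfolding w1 .
  define r where "r l = - (k l / l) - w0 - w1 * l" for l
  have "((\<lambda>l. - ((k l * (1 + \<theta>\<^sup>2) + l * J u) / l\<^sup>2) / (1 + \<theta>\<^sup>2) - w1) \<longlongrightarrow>
      - (- ((1 + \<theta>\<^sup>2) * w1)) / (1 + \<theta>\<^sup>2) - w1) (at_right 0)"
    by (intro tendsto_intros lim) (use pos\<theta> in simp)
  then have "((\<lambda>l. - ((k l * (1 + \<theta>\<^sup>2) + l * J u) / l\<^sup>2) / (1 + \<theta>\<^sup>2) - w1) \<longlongrightarrow> 0) (at_right 0)"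
    using pos\<theta> by simp
  then have "((\<lambda>l. r l / l) \<longlongrightarrow> 0) (at_right 0)"
  proof (rule Lim_transform_eventually)
    show "\<forall>\<^sub>F l in at_right 0. - ((k l * (1 + \<theta>\<^sup>2) + l * J u) / l\<^sup>2) / (1 + \<theta>\<^sup>2) - w1 = r l / l"
      using eventually_pos
    proof eventually_elim
      case (elim l)
      have "J u = w0 * (1 + \<theta>\<^sup>2)" using \<kappa> by simp
      then have "k l * (1 + \<theta>\<^sup>2) + l * J u = (k l + l * w0) * (1 + \<theta>\<^sup>2)"
        by (simp add: algebra_simps)
      then have "- ((k l * (1 + \<theta>\<^sup>2) + l * J u) / l\<^sup>2) / (1 + \<theta>\<^sup>2) = - ((k l + l * w0) / l\<^sup>2)"
        using pos\<theta> by simp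
      then show ?case
        using elim by (simp add: r_def field_simps power2_eq_square)
    qed
  qed
  then have "r \<in> o[at_right 0](\<lambda>l. l)"
    by (rule smalloI_tendsto) (use eventually_pos in eventually_elim, simp)
  moreover have "\<forall>\<^sub>F l in at_right 0. e l = - l\<^sup>2 * (w0 + w1 * l + r l)\<^sup>2"
    using ev eventually_pos
  proof eventually_elim
    case (elim l)
    have "w0 + w1 * l + r l = - (k l / l)" by (simp add: r_def)
    then show ?case
      using elim by (simp add: power_divide)
  qed
  ultimately show ?thesis by blast
qed

end

section \<open>The threshold eigenvalue\<close>

text \<open>
  Outside the support of \<open>U\<close> both solutions are affine. Boundedness forces \<open>u\<close> to be constant there,
  and comparing the Wronskian at both ends gives \<open>\<theta> \<noteq> 0\<close> and the slope \<open>1 / \<theta>\<close> of \<open>u1\<close>.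
\<close>
lemma resonance_data:
  fixes U u u1 :: "real \<Rightarrow> real"
  assumes U: "Linf_compact_support U"
    and u: "normalized_half_bound_state U u" "(u \<longlongrightarrow> \<theta>) at_top"
    and u1: "solves_schroedinger U (\<lambda>_. 0) u1" "\<And>x. (\<forall>y\<in>ess_support U. x < y) \<Longrightarrow> u1 x = x"
    and theta1: "\<forall>\<^sub>F x in at_top. u1 x = inverse \<theta> * x + \<theta>1"
  obtains a u' u1' M where "a0 \<le> a" "resonance U u u' u1 u1' \<theta> \<theta>1 a M"
    "\<And>x. x \<le> -a \<Longrightarrow> u x = 1" "\<And>x. a \<le> x \<Longrightarrow> u x = \<theta>"
proof -
  obtain CU n where n: "\<And>x. n \<le> \<bar>x\<bar> \<Longrightarrow> x \<notin> ess_support U" "AE x in lebesgue. n \<le> \<bar>x\<bar> \<longrightarrow> U x = 0"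
    using Linf_bounds[OF U] by metis
  obtain X where X: "\<And>x. X \<le> x \<Longrightarrow> u1 x = inverse \<theta> * x + \<theta>1"
    using theta1 by (auto simp: eventually_at_top_linorder)
  define a where "a = max 1 (max a0 (max n X))"
  have a: "1 \<le> a" "a0 \<le> a" "n \<le> a" "X \<le> a"
    by (auto simp: a_def)
  have U0: "AE x in lebesgue. a \<le> \<bar>x\<bar> \<longrightarrow> U x = 0"
    using n(2) by eventually_elim (use a in auto)
  have hb: "solves_schroedinger U (\<lambda>_. 0) u" "bounded (range u)" "(u \<longlongrightarrow> 1) at_bot"
    using u(1) by (auto simp: normalized_half_bound_state_def half_bound_state_def)
  obtain u' where u': "ac_deriv u u'" "ac_deriv u' (\<lambda>x. U x * u x)"
    using solves_schroedinger_ac[OF hb(1)] by auto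
  obtain u1' where u1': "ac_deriv u1 u1'" "ac_deriv u1' (\<lambda>x. U x * u1 x)"
    using solves_schroedinger_ac[OF u1(1)] by auto
  have left0: "AE x in lebesgue. x \<in> {s..-a} \<longrightarrow> U x * v x = 0" for s and v :: "real \<Rightarrow> real"
    using U0 by eventually_elim (use a in auto)
  have right0: "AE x in lebesgue. x \<in> {a..s} \<longrightarrow> U x * v x = 0" for s and v :: "real \<Rightarrow> real"
    using U0 by eventually_elim (use a in auto)
  obtain B where B: "\<And>x. \<bar>u x\<bar> \<le> B"
    using hb(2) by (auto simp: bounded_iff)
  have flat: "c = 0" if lin: "\<And>d. 0 \<le> d \<Longrightarrow> \<exists>x y. u x = u y + c * d" for c
  proof (rule ccontr)
    assume "c \<noteq> 0"
    then obtain x y where "u x = u y + c * ((2 * B + 1) / \<bar>c\<bar>)"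
      using lin[of "(2 * B + 1) / \<bar>c\<bar>"] B[of 0] by (auto intro!: divide_nonneg_nonneg)
    then have "\<bar>u x - u y\<bar> = \<bar>c * ((2 * B + 1) / \<bar>c\<bar>)\<bar>" by simp
    also have "\<dots> = \<bar>2 * B + 1\<bar>" using \<open>c \<noteq> 0\<close> by (simp add: abs_mult)
    finally show False using B[of x] B[of y] B[of 0] by linarith
  qed
  have u_left: "u x = u (-a) + u' (-a) * (x - (-a))" if "x \<le> -a" for x
  proof -
    have "u' (-a) = u' x" "u (-a) = u x + u' x * (-a - x)"
      using affine_where_second_derivative_vanishes[OF u' left0[of x u], of "-a"] that by simp_all
    then show ?thesis by (simp add: algebra_simps)
  qed
  have u'l: "u' (-a) = 0"
  proof (rule flat)
    fix d :: real assume "0 \<le> d"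
    then show "\<exists>x y. u x = u y + u' (-a) * d"
      using u_left[of "-a - d"] by (intro exI[of _ "-a"] exI[of _ "-a - d"]) (simp add: algebra_simps)
  qed
  have u_left': "u x = u (-a)" if "x \<le> -a" for x
    using u_left[OF that] u'l by simp
  have "(u \<longlongrightarrow> u (-a)) at_bot"
    by (rule tendsto_eventually) (unfold eventually_at_bot_linorder, use u_left' in blast)
  then have ul: "u (-a) = 1"
    using hb(3) tendsto_unique trivial_limit_at_bot_linorder by blast
  have u_right: "u x = u a + u' a * (x - a)" if "a \<le> x" for x
    using affine_where_second_derivative_vanishes(2)[OF u' right0[of x u], of x] that by simp
  have u'r: "u' a = 0"
  proof (rule flat)
    fix d :: real assume "0 \<le> d"
    then show "\<exists>x y. u x = u y + u' a * d"
      using u_right[of "a + d"] by (intro exI[of _ "a + d"] exI[of _ a]) simp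
  qed
  have u_right': "u x = u a" if "a \<le> x" for x
    using u_right[OF that] u'r by simp
  have "(u \<longlongrightarrow> u a) at_top"
    by (rule tendsto_eventually) (unfold eventually_at_top_linorder, use u_right' in blast)
  then have ur: "u a = \<theta>"
    using u(2) tendsto_unique trivial_limit_at_top_linorder by blast
  have u1_left: "u1 x = x" if "x \<le> -a" for x
  proof (rule u1(2), rule ballI)
    fix y assume "y \<in> ess_support U"
    then have "\<bar>y\<bar> < n" using n(1)[of y] by force
    then show "x < y" using that a by linarith
  qed
  have u1l: "u1 (-a) = -a" "u1' (-a) = 1"
    using u1_left[of "-a"] u1_left[of "-a - 1"]
      affine_where_second_derivative_vanishes[OF u1' left0[of "-a - 1" u1], of "-a"] by simp_all
  have u1r: "u1 a = inverse \<theta> * a + \<theta>1" "u1' a = inverse \<theta>"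
    using X[of a] X[of "a + 1"] a(4)
      affine_where_second_derivative_vanishes(2)[OF u1' right0[of "a + 1" u1], of "a + 1"]
    by (simp_all add: algebra_simps)
  have "u a * u1' a - u' a * u1 a = u (-a) * u1' (-a) - u' (-a) * u1 (-a)"
    by (rule wronskian_constant[OF u' u1'])
  then have \<theta>: "\<theta> \<noteq> 0"
    using ul ur u'l u'r u1l u1r by auto
  obtain M1 M2 where "\<And>x. x \<in> {-a..a} \<Longrightarrow> \<bar>u x\<bar> \<le> M1" "\<And>x. x \<in> {-a..a} \<Longrightarrow> \<bar>u1 x\<bar> \<le> M2"
    using continuous_on_interval_bound[OF ac_deriv_continuous[OF u'(1)]]
      continuous_on_interval_bound[OF ac_deriv_continuous[OF u1'(1)]] by metis
  then have M: "\<bar>u x\<bar> \<le> max M1 M2" "\<bar>u1 x\<bar> \<le> max M1 M2" if "x \<in> {-a..a}" for x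
    using that by (auto simp: le_max_iff_disj)
  have "resonance U u u' u1 u1' \<theta> \<theta>1 a (max M1 M2)"
    by (unfold_locales; (rule U0 u' u1' ul u'l u1l ur u'r \<theta> M)?)
      (use a u1r in \<open>auto simp: field_simps\<close>)
  then show thesis
    using that a(2) u_left' u_right' ul ur by metis
qed

theorem theorem1:
  fixes U V V1 u u1 vs :: "real \<Rightarrow> real"
    and Vl :: "real \<Rightarrow> real \<Rightarrow> real"
    and \<theta> \<theta>1 :: real
  assumes "Linf_compact_support U"
    and "Linf_compact_support V"
    and "Linf_compact_support V1"
    and "\<And>l. l > 0 \<Longrightarrow> Linf_compact_support (Vl l)"
    and common_support: "\<exists>R. \<forall>\<^sub>F l in at_right 0. ess_support (Vl l) \<subseteq> {-R..R}"
    and "(\<lambda>l. L2_norm_real (\<lambda>x. Vl l x - V x - l * V1 x)) \<in> o[at_right 0](\<lambda>l. l)"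
    and "zero_energy_resonance U"
    and "normalized_half_bound_state U u"
    and theta: "(u \<longlongrightarrow> \<theta>) at_top"
    and u1: "solves_schroedinger U (\<lambda>_. 0) u1"
        "\<And>x. (\<forall>y\<in>ess_support U. x < y) \<Longrightarrow> u1 x = x"
    and theta1: "\<forall>\<^sub>F x in at_top. u1 x = inverse \<theta> * x + \<theta>1"
    and vs: "solves_schroedinger U (\<lambda>x. - (V x * u x)) vs"
        "\<And>x. (\<forall>y\<in>ess_support U \<union> ess_support V. x < y) \<Longrightarrow> vs x = 0"
    and "(\<integral>x. V x * (u x)\<^sup>2 \<partial>lebesgue) < 0"
  shows "coupling_constant_threshold_zero (H_op U Vl) \<and>
    (\<forall>e. threshold_eigenvalue (H_op U Vl) e \<longrightarrow>
      (\<exists>r. r \<in> o[at_right 0](\<lambda>l. l) \<and>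
        (\<forall>\<^sub>F l in at_right 0.
           e l = - l\<^sup>2 * (omega0 V u \<theta> + omega1 V V1 u \<theta> u1 \<theta>1 vs * l + r l)\<^sup>2)))"
proof -
  note U_Linf = assms(1) and V_Linf = assms(2) and V1_Linf = assms(3) and Vl_Linf = assms(4) and neg = assms(15)
  obtain CU nU where nU: "AE x in lebesgue. \<bar>U x\<bar> \<le> CU" "\<And>x. nU \<le> \<bar>x\<bar> \<Longrightarrow> x \<notin> ess_support U"
    using Linf_bounds[OF U_Linf] by metis
  obtain nV where nV: "\<And>x. nV \<le> \<bar>x\<bar> \<Longrightarrow> x \<notin> ess_support V" "AE x in lebesgue. nV \<le> \<bar>x\<bar> \<longrightarrow> V x = 0"
    using Linf_bounds[OF V_Linf] by metis
  obtain n1 where n1: "AE x in lebesgue. n1 \<le> \<bar>x\<bar> \<longrightarrow> V1 x = 0"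
    using Linf_bounds[OF V1_Linf] by metis
  obtain R where R: "\<forall>\<^sub>F l in at_right 0. ess_support (Vl l) \<subseteq> {-R..R}"
    using common_support by blast
  obtain a u' u1' M where a0: "max nU (max nV (max n1 (R + 1))) \<le> a"
    and res: "resonance U u u' u1 u1' \<theta> \<theta>1 a M"
    and u_out: "\<And>x. x \<le> -a \<Longrightarrow> u x = 1" "\<And>x. a \<le> x \<Longrightarrow> u x = \<theta>"
    using resonance_data[OF U_Linf assms(8) theta u1 theta1] by metis
  then have a: "nU \<le> a" "nV \<le> a" "n1 \<le> a" "R < a" by auto
  interpret resonance U u u' u1 u1' \<theta> \<theta>1 a M by (rule res)
  interpret perturbed_resonance U u u' u1 u1' \<theta> \<theta>1 a M V V1 Vl
  proof
    show "((\<lambda>l. L1 (\<lambda>x. Vl l x - V x - l * V1 x) / l) \<longlongrightarrow> 0) (at_right 0)"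
      unfolding L1_def by (rule remainder_L1_small[OF V_Linf V1_Linf Vl_Linf assms(6) a_pos])
  qed (intro Linf_abs_integrable V_Linf V1_Linf Vl_Linf; assumption)+
  have V0: "AE x in lebesgue. a \<le> \<bar>x\<bar> \<longrightarrow> V x = 0"
    using nV(2) by eventually_elim (use a in auto)
  have V10: "AE x in lebesgue. a \<le> \<bar>x\<bar> \<longrightarrow> V1 x = 0"
    using n1 by eventually_elim (use a in auto)
  have Vl0: "\<forall>\<^sub>F l in at_right 0. AE x in lebesgue. a \<le> \<bar>x\<bar> \<longrightarrow> l * Vl l x = 0"
    using R
  proof eventually_elim
    case (elim l)
    have out: "x \<notin> ess_support (Vl l)" if "a \<le> \<bar>x\<bar>" for x
      using elim that a by force
    show ?case
      using AE_zero_outside_ess_support[of "Vl l"] by eventually_elim (use out in auto)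
  qed
  obtain vs' where vs': "ac_deriv vs vs'" "ac_deriv vs' (\<lambda>x. U x * vs x + V x * u x)"
    using solves_schroedinger_ac[OF vs(1)] by auto
  have vs_left: "vs x = 0" if "x \<le> -a" for x
  proof (rule vs(2), rule ballI)
    fix y assume "y \<in> ess_support U \<union> ess_support V"
    then have "\<bar>y\<bar> < a" using nU(2)[of y] nV(1)[of y] a by force
    then show "x < y" using that by linarith
  qed
  have "AE x in lebesgue. x \<in> {-a-1..-a} \<longrightarrow> U x * vs x + V x * u x = 0"
    using U_outside V0 by eventually_elim (use a_pos in auto)
  from affine_where_second_derivative_vanishes[OF vs' this, of "-a"]
  have vs0: "vs (-a) = 0" "vs' (-a) = 0"
    using vs_left[of "-a"] vs_left[of "-a - 1"] by simp_all
  \<comment> \<open>both \<open>v\<^sub>*\<close> and its derivative vanish at \<open>- a\<close>, so variation of constants gives \<open>v\<^sub>* = T\<^sub>V u\<close>\<close>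
  have vs_volterra: "vs x = volterra V u x" if "x \<in> {-a..a}" for x
    using variation_of_constants(3)[OF vs', of x] that vs0 by (simp add: volterra_def mult_ac)
  have meas: "V \<in> borel_measurable lebesgue" "V1 \<in> borel_measurable lebesgue"
    using V_Linf V1_Linf by (auto simp: Linf_compact_support_def)
  note om = omega_identities[OF meas V0 V10 u_out ac_deriv_continuous[OF vs'(1)] vs_volterra refl]
  have "omega0 V u \<theta> < 0"
    using neg \<theta>_nonzero by (simp add: omega0_def divide_less_0_iff add_pos_nonneg)
  moreover have "J u = omega0 V u \<theta> * (1 + \<theta>\<^sup>2)"
    using om(1) by simp
  ultimately have J: "J u < 0"
    by (simp add: mult_less_0_iff add_pos_nonneg)
  have "\<forall>\<^sub>F l in at_right 0. \<forall>k>0. \<forall>f. shooting_solution (pert k l) k f \<longrightarrow> matching (pert k l) k f = 0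
      \<longrightarrow> is_eigenvalue (H_op U Vl l) (- k\<^sup>2)"
    using Vl0 eventually_pos
  proof eventually_elim
    case (elim l)
    obtain C where C: "AE x in lebesgue. \<bar>Vl l x\<bar> \<le> C"
      using Linf_bounds[OF Vl_Linf[OF elim(2)]] by metis
    have W: "(\<lambda>x. l * Vl l x) absolutely_integrable_on {-a..a}"
      using Linf_abs_integrable[OF Vl_Linf[OF elim(2)]] by auto
    have m: "(\<lambda>x. U x + l * Vl l x) \<in> borel_measurable lebesgue"
      using U_Linf Vl_Linf[OF elim(2)]
      by (intro borel_measurable_add borel_measurable_times borel_measurable_const) (auto simp: Linf_compact_support_def)
    have b: "AE x in lebesgue. \<bar>U x + l * Vl l x\<bar> \<le> CU + l * C"
      using nU(1) C
    proof eventually_elim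
      case (elim x)
      have "\<bar>l * Vl l x\<bar> \<le> l * C"
        using elim(2) \<open>0 < l\<close> by (simp add: abs_mult)
      then show ?case using elim(1) by linarith
    qed
    show ?case
      unfolding H_op_def pert_def using shooting_imp_eigenvalue[OF _ _ elim(1) W _ m b] by blast
  qed
  then have exists: "coupling_constant_threshold_zero (H_op U Vl)"
    by (rule threshold_eigenvalue_exists[OF J])
  have shoot: "\<forall>\<^sub>F l in at_right 0. \<forall>k>0. 4 * M\<^sup>2 * L1 (pert k l) \<le> 1 \<longrightarrow> is_eigenvalue (H_op U Vl l) (- k\<^sup>2)
      \<longrightarrow> (\<exists>f. shooting_solution (pert k l) k f \<and> matching (pert k l) k f = 0)"
    using Vl0 eventually_pos
  proof eventually_elim
    case (elim l)
    have W: "(\<lambda>x. l * Vl l x) absolutely_integrable_on {-a..a}"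
      using Linf_abs_integrable[OF Vl_Linf[OF elim(2)]] by auto
    show ?case
    proof (intro allI impI)
      fix k :: real
      assume k: "0 < k" and small: "4 * M\<^sup>2 * L1 (pert k l) \<le> 1"
        and eig: "is_eigenvalue (H_op U Vl l) (- k\<^sup>2)"
      obtain f where "shooting_solution (\<lambda>x. l * Vl l x + k\<^sup>2) k f"
        "matching (\<lambda>x. l * Vl l x + k\<^sup>2) k f = 0"
        by (rule eigenvalue_imp_shooting[OF eig[unfolded H_op_def] elim(1) W k small[unfolded pert_def]])
      then show "\<exists>f. shooting_solution (pert k l) k f \<and> matching (pert k l) k f = 0"
        unfolding pert_def by blast
    qed
  qed
  show ?thesis
    by (intro conjI exists allI impI) (rule threshold_eigenvalue_asymptotics[OF _ shoot om])
qed

end
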